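(* Assume that $\Omega$ is convex. Let $\vec{x}_0\in\overline{\Omega}$ and for each small $h>0$ let $$\vec{x}_0^{\,h}=\vec{x}_0+\beta_h\vec{\nu}_\perp+(r_h+\alpha_0^h)\vec{\nu}\in\overline{\Omega},$$ where $\beta_h\in\mathbb{R}$ satisfies $\max\{\omega_0(|\beta_h|),|\beta_h|\}\le h$ with $\omega_0$ the modulus of continuity described in the context, $r_h\in\mathbb{R}$ satisfies $|r_h|<h$, and $\alpha_0^h=k_0^hh$ for some $k_0^h\in\mathbb{Z}$. Suppose $\lim_{h\to0^+}r_h=0$ and $\lim_{h\to0^+}\alpha_0^h=0$. Then the rescaled chemical reaction process $X^h(t)$ with $X^h(0)=\vec{x}_0^{\,h}$ satisfies, at each time $t$, the large deviation principle on $\overline{\Omega}$ (as $h\to0^+$, with speed $1/h$) with the good rate function $$\tilde{I}(\vec{y};\vec{x}_0,t)=\begin{cases}I\left(\frac{(\vec{y}-\vec{x}_0)\cdot\vec{\nu}}{|\vec{\nu}|^2};0,t\right),&\vec{y}\in S_0,\\ \infty,&\text{otherwise},\end{cases}$$ where $S_0$ and $I$ are defined in the context.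
   Context: Setting. $\mathbb{R}^2_+=\{x\in\mathbb{R}^2:x_1>0,x_2>0\}$, and $\Omega\subset\mathbb{R}^2_+$ is a bounded open domain with $\overline{\Omega}\subset\mathbb{R}^2_+$. The reaction vector is $\vec{\nu}=(-\nu^+_{11},\nu^-_{12})$ with nonnegative integers $\nu^+_{11},\nu^-_{12}$ not both zero, and $\vec{\nu}_\perp=(\nu^-_{12},\nu^+_{11})$. The intensities $\Phi^\pm:\overline{\Omega}\to\mathbb{R}$ are continuous with $\Phi^\pm\ge c_0>0$. Segments. For $\beta\in\mathbb{R}$ with $S_\beta:=\{\vec{x}_0+\beta\vec{\nu}_\perp+\alpha\vec{\nu}:\alpha\in\mathbb{R}\}\cap\overline{\Omega}\ne\emptyset$, write $S_\beta=\{\vec{x}_0+\beta\vec{\nu}_\perp+\alpha\vec{\nu}:a_\beta\le\alpha\le b_\beta\}$; $a=a_0$, $b=b_0$, $S_0=\{\vec{x}_0+\alpha\vec{\nu}:a\le\alpha\le b\}$. Since $\Omega$ is convex there is a modulus of continuity $\omega_0$ (continuous nondecreasing on $[0,\infty)$, $\omega_0(0)=0$) with $|a_\beta-a|\le\omega_0(|\beta|)$ and $|b_\beta-b|\le\omega_0(|\beta|)$ for all small $\beta$ with $S_\beta\neq\emptyset$; one such $\omega_0$ is fixed. Process. $X^h$ is the continuous-time Markov chain on the finite set $\hat{\Omega}_h=\{\vec{x}_0+\beta_h\vec{\nu}_\perp+(r_h+kh)\vec{\nu}\in\overline{\Omega}:k\in\mathbb{Z}\}$ with generator $$(Qf)(\vec{x})=\tfrac1h\mathbb{1}_{\{\vec{x}+h\vec{\nu}\in\hat{\Omega}_h\}}\Phi^+(\vec{x})[f(\vec{x}+h\vec{\nu})-f(\vec{x})]+\tfrac1h\mathbb{1}_{\{\vec{x}-h\vec{\nu}\in\hat{\Omega}_h\}}\Phi^-(\vec{x})[f(\vec{x}-h\vec{\nu})-f(\vec{x})].$$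 Rate function. Let $\tilde{\Phi}^\pm(\alpha)=\Phi^\pm(\vec{x}_0+\alpha\vec{\nu})$, $\tilde{H}(\alpha,p)=\tilde{\Phi}^+(\alpha)(e^p-1)+\tilde{\Phi}^-(\alpha)(e^{-p}-1)$, and $\tilde{L}(\alpha,v)=\sup_{p\in\mathbb{R}}\{pv-\tilde{H}(\alpha,p)\}$ for $\alpha\in[a,b]$. For $\alpha\in[a,b]$, $\mathrm{SP}(\alpha)$ is the set of triples $(\eta,v,l)$ with $\eta\in AC_{loc}([0,\infty),\mathbb{R})$, $v,l\in L^1_{loc}([0,\infty),\mathbb{R})$, $\eta(0)=\alpha$, $\eta(s)\in[a,b]$ for all $s\ge0$, and for a.e. $s>0$: $\dot{\eta}(s)+l(s)n(\eta(s))=v(s)$, $l(s)\ge0$, $l(s)=0$ if $\eta(s)\in(a,b)$, where $n(a)=-1$, $n(b)=1$. Then $$I(y;\alpha,t)=\inf\Big\{\int_0^t\tilde{L}(\eta(s),v(s))\,ds:\ \eta(t)=y,\ (\eta,v,l)\in\mathrm{SP}(\alpha)\Big\}.$$ If $a=b=0$ the convention is $I(0;0,t)=0$. *)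

theory Defs
  imports "HOL-Probability.Probability"
begin

section \<open>Large deviation principle\<close>

definition ln_ext :: "real \<Rightarrow> ereal" where
  "ln_ext p = (if p = 0 then -\<infinity> else ereal (ln p))"

definition good_rate_function :: "'a::topological_space set \<Rightarrow> ('a \<Rightarrow> ereal) \<Rightarrow> bool" where
  "good_rate_function S J \<longleftrightarrow>
     (\<forall>y\<in>S. 0 \<le> J y) \<and>
     (\<forall>c::real. closedin (top_of_set S) {y \<in> S. J y \<le> ereal c}) \<and>
     (\<forall>c::real. compact {y \<in> S. J y \<le> ereal c})"

text \<open>The principle on the space \<open>S\<close> (with its subspace topology) for \<open>h \<rightarrow> 0+\<close> and speed \<open>1/h\<close>.
  Infima over the empty set are \<open>\<infinity>\<close>.\<close>

definition satisfies_LDP ::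
    "'a::topological_space set \<Rightarrow> (real \<Rightarrow> 'a measure) \<Rightarrow> ('a \<Rightarrow> ereal) \<Rightarrow> bool" where
  "satisfies_LDP S \<mu> J \<longleftrightarrow>
     (\<forall>F. closedin (top_of_set S) F \<longrightarrow>
        Limsup (at_right 0) (\<lambda>h. ereal h * ln_ext (measure (\<mu> h) F)) \<le> - (INF y\<in>F. J y)) \<and>
     (\<forall>G. openin (top_of_set S) G \<longrightarrow>
        - (INF y\<in>G. J y) \<le> Liminf (at_right 0) (\<lambda>h. ereal h * ln_ext (measure (\<mu> h) G)))"


section \<open>Continuous-time Markov chains on a finite set\<close>

text \<open>The semigroup \<open>e\<^sup>t\<^sup>Q\<close> applied to \<open>f\<close>, where \<open>Q\<close> acts on functions.\<close>

definition semigroup_of :: "(('a \<Rightarrow> real) \<Rightarrow> 'a \<Rightarrow> real) \<Rightarrow> real \<Rightarrow> ('a \<Rightarrow> real) \<Rightarrow> 'a \<Rightarrow> real" where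
  "semigroup_of Q t f x = (\<Sum>n. t ^ n / fact n * (Q ^^ n) f x)"

text \<open>A right-continuous process \<open>X\<close> with values in the finite set \<open>S\<close>, started at \<open>x\<close>, which has the
  Markov property with transition probabilities
  \<open>p\<^sub>t(z, y) = (e\<^sup>t\<^sup>Q 1\<^bsub>{y}\<^esub>)(z)\<close>. The Markov property is stated in product form, so that
  conditioning on null events is avoided.\<close>

definition markov_chain_on ::
    "'w measure \<Rightarrow> (real \<Rightarrow> 'w \<Rightarrow> 'a::topological_space) \<Rightarrow> 'a set
      \<Rightarrow> (('a \<Rightarrow> real) \<Rightarrow> 'a \<Rightarrow> real) \<Rightarrow> 'a \<Rightarrow> bool" where
  "markov_chain_on M X S Q x \<longleftrightarrow>
     prob_space M \<and> finite S \<and>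
     (\<forall>t\<ge>0. X t \<in> borel_measurable M) \<and>
     (\<forall>t\<ge>0. \<forall>\<omega>\<in>space M. X t \<omega> \<in> S) \<and>
     (\<forall>t\<ge>0. \<forall>\<omega>\<in>space M. continuous (at_right t) (\<lambda>s. X s \<omega>)) \<and>
     (AE \<omega> in M. X 0 \<omega> = x) \<and>
     (\<forall>(n::nat) (\<tau>::nat \<Rightarrow> real) z s y.
        0 \<le> \<tau> 0 \<longrightarrow> (\<forall>i<n. \<tau> i \<le> \<tau> (Suc i)) \<longrightarrow> \<tau> n \<le> s \<longrightarrow>
        (\<forall>i\<le>n. z i \<in> S) \<longrightarrow> y \<in> S \<longrightarrow>
        measure M {\<omega> \<in> space M. (\<forall>i\<le>n. X (\<tau> i) \<omega> = z i) \<and> X s \<omega> = y}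
        = measure M {\<omega> \<in> space M. \<forall>i\<le>n. X (\<tau> i) \<omega> = z i}
          * semigroup_of Q (s - \<tau> n) (indicator {y}) (z n))"


section \<open>Segments of the domain in the reaction direction\<close>

text \<open>In this section \<open>D\<close> stands for the closure of the domain, \<open>u\<close> for the reaction vector and \<open>w\<close>
  for its orthogonal vector.\<close>

definition segment ::
    "(real^2) set \<Rightarrow> real^2 \<Rightarrow> real^2 \<Rightarrow> real^2 \<Rightarrow> real \<Rightarrow> (real^2) set" where
  "segment D x0 u w \<beta> = {x0 + \<beta> *\<^sub>R w + \<alpha> *\<^sub>R u |\<alpha>. True} \<inter> D"

definition segment_params ::
    "(real^2) set \<Rightarrow> real^2 \<Rightarrow> real^2 \<Rightarrow> real^2 \<Rightarrow> real \<Rightarrow> real set" where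
  "segment_params D x0 u w \<beta> = {\<alpha>. x0 + \<beta> *\<^sub>R w + \<alpha> *\<^sub>R u \<in> D}"

text \<open>The end points \<open>a\<^sub>\<beta>\<close> and \<open>b\<^sub>\<beta>\<close>; see \<open>segment_eq\<close> below.\<close>

definition seg_lo :: "(real^2) set \<Rightarrow> real^2 \<Rightarrow> real^2 \<Rightarrow> real^2 \<Rightarrow> real \<Rightarrow> real" where
  "seg_lo D x0 u w \<beta> = Inf (segment_params D x0 u w \<beta>)"

definition seg_hi :: "(real^2) set \<Rightarrow> real^2 \<Rightarrow> real^2 \<Rightarrow> real^2 \<Rightarrow> real \<Rightarrow> real" where
  "seg_hi D x0 u w \<beta> = Sup (segment_params D x0 u w \<beta>)"

lemma segment_eq:
  assumes "compact D" "convex D" "u \<noteq> 0" "segment D x0 u w \<beta> \<noteq> {}"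
  shows "segment D x0 u w \<beta>
    = {x0 + \<beta> *\<^sub>R w + \<alpha> *\<^sub>R u |\<alpha>. seg_lo D x0 u w \<beta> \<le> \<alpha> \<and> \<alpha> \<le> seg_hi D x0 u w \<beta>}"
proof -
  let ?P = "segment_params D x0 u w \<beta>"
  let ?f = "\<lambda>\<alpha>. (x0 + \<beta> *\<^sub>R w) + \<alpha> *\<^sub>R u"
  have P: "?P = ?f -` D"
    by (auto simp: segment_params_def)
  have ne: "?P \<noteq> {}"
    using assms(4) by (auto simp: segment_def segment_params_def)
  have cl: "closed ?P"
    unfolding P using compact_imp_closed[OF assms(1)]
    by (intro continuous_closed_vimage continuous_intros)
  obtain B where B: "\<And>x. x \<in> D \<Longrightarrow> norm x \<le> B"
    using compact_imp_bounded[OF assms(1)] by (auto simp: bounded_iff)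
  have "\<bar>\<alpha>\<bar> \<le> (B + norm (x0 + \<beta> *\<^sub>R w)) / norm u" if "\<alpha> \<in> ?P" for \<alpha>
  proof -
    have "\<bar>\<alpha>\<bar> * norm u = norm (?f \<alpha> - (x0 + \<beta> *\<^sub>R w))"
      by simp
    also have "\<dots> \<le> norm (?f \<alpha>) + norm (x0 + \<beta> *\<^sub>R w)"
      by (rule norm_triangle_ineq4)
    also have "norm (?f \<alpha>) \<le> B"
      using that B by (auto simp: segment_params_def)
    finally show ?thesis
      using assms(3) by (simp add: field_simps)
  qed
  then have bd: "bounded ?P"
    unfolding bounded_iff by auto
  have cv: "convex ?P"
    unfolding convex_alt
  proof (intro ballI allI impI)
    fix p q c :: real
    assume pq: "p \<in> ?P" "q \<in> ?P" and c: "0 \<le> c \<and> c \<le> 1"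
    have "?f ((1 - c) *\<^sub>R p + c *\<^sub>R q) = (1 - c) *\<^sub>R ?f p + c *\<^sub>R ?f q"
      by (simp add: algebra_simps)
    moreover have "(1 - c) *\<^sub>R ?f p + c *\<^sub>R ?f q \<in> D"
      using assms(2) pq c unfolding convex_alt segment_params_def by blast
    ultimately show "(1 - c) *\<^sub>R p + c *\<^sub>R q \<in> ?P"
      by (simp add: segment_params_def)
  qed
  have bdd: "bdd_below ?P" "bdd_above ?P"
    using bd by (auto intro: bounded_imp_bdd_below bounded_imp_bdd_above)
  have ends: "Inf ?P \<in> ?P" "Sup ?P \<in> ?P"
    using closed_contains_Inf[OF ne bdd(1) cl] closed_contains_Sup[OF ne bdd(2) cl] by auto
  have iff: "\<alpha> \<in> ?P \<longleftrightarrow> Inf ?P \<le> \<alpha> \<and> \<alpha> \<le> Sup ?P" for \<alpha>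
  proof
    assume "\<alpha> \<in> ?P"
    then show "Inf ?P \<le> \<alpha> \<and> \<alpha> \<le> Sup ?P"
      using bdd by (auto intro: cInf_lower cSup_upper)
  next
    assume "Inf ?P \<le> \<alpha> \<and> \<alpha> \<le> Sup ?P"
    then show "\<alpha> \<in> ?P"
      using cv ends mem_is_interval_1_I[of ?P "Inf ?P" "Sup ?P" \<alpha>]
      by (simp add: is_interval_convex_1)
  qed
  have "segment D x0 u w \<beta> = {?f \<alpha> |\<alpha>. \<alpha> \<in> ?P}"
    unfolding segment_def segment_params_def by blast
  then show ?thesis
    unfolding seg_lo_def seg_hi_def iff .
qed

definition segment_modulus ::
    "(real^2) set \<Rightarrow> real^2 \<Rightarrow> real^2 \<Rightarrow> real^2 \<Rightarrow> (real \<Rightarrow> real) \<Rightarrow> bool" where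
  "segment_modulus D x0 u w \<omega> \<longleftrightarrow>
     continuous_on {0..} \<omega> \<and> mono_on {0..} \<omega> \<and> \<omega> 0 = 0 \<and>
     (\<exists>\<delta>>0. \<forall>\<beta>. \<bar>\<beta>\<bar> < \<delta> \<longrightarrow> segment D x0 u w \<beta> \<noteq> {} \<longrightarrow>
        \<bar>seg_lo D x0 u w \<beta> - seg_lo D x0 u w 0\<bar> \<le> \<omega> \<bar>\<beta>\<bar> \<and>
        \<bar>seg_hi D x0 u w \<beta> - seg_hi D x0 u w 0\<bar> \<le> \<omega> \<bar>\<beta>\<bar>)"


section \<open>The rescaled chemical reaction process\<close>

definition lattice_states ::
    "(real^2) set \<Rightarrow> real^2 \<Rightarrow> real^2 \<Rightarrow> real^2 \<Rightarrow> real \<Rightarrow> real \<Rightarrow> real \<Rightarrow> (real^2) set" where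
  "lattice_states D x0 u w \<beta> r h =
     {x0 + \<beta> *\<^sub>R w + (r + of_int k * h) *\<^sub>R u |k::int. True} \<inter> D"

definition reaction_generator ::
    "(real^2) set \<Rightarrow> real^2 \<Rightarrow> (real^2 \<Rightarrow> real) \<Rightarrow> (real^2 \<Rightarrow> real) \<Rightarrow> real
      \<Rightarrow> (real^2 \<Rightarrow> real) \<Rightarrow> real^2 \<Rightarrow> real" where
  "reaction_generator S u \<Phi>p \<Phi>m h f x =
     1 / h * indicator S (x + h *\<^sub>R u) * \<Phi>p x * (f (x + h *\<^sub>R u) - f x) +
     1 / h * indicator S (x - h *\<^sub>R u) * \<Phi>m x * (f (x - h *\<^sub>R u) - f x)"


section \<open>The rate function\<close>

text \<open>In this section \<open>\<phi>p\<close> and \<open>\<phi>m\<close> are the intensities along \<open>S\<^sub>0\<close> as functions of \<open>\<alpha>\<close>.\<close>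

definition hamiltonian :: "(real \<Rightarrow> real) \<Rightarrow> (real \<Rightarrow> real) \<Rightarrow> real \<Rightarrow> real \<Rightarrow> real" where
  "hamiltonian \<phi>p \<phi>m \<alpha> p = \<phi>p \<alpha> * (exp p - 1) + \<phi>m \<alpha> * (exp (-p) - 1)"

definition lagrangian :: "(real \<Rightarrow> real) \<Rightarrow> (real \<Rightarrow> real) \<Rightarrow> real \<Rightarrow> real \<Rightarrow> ereal" where
  "lagrangian \<phi>p \<phi>m \<alpha> v = (SUP p. ereal (p * v - hamiltonian \<phi>p \<phi>m \<alpha> p))"

definition abs_continuous_on_interval :: "real \<Rightarrow> real \<Rightarrow> (real \<Rightarrow> real) \<Rightarrow> bool" where
  "abs_continuous_on_interval c d f \<longleftrightarrow>
     (\<forall>\<epsilon>>0. \<exists>\<delta>>0. \<forall>(n::nat) (p::nat \<Rightarrow> real) q.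
        (\<forall>i<n. c \<le> p i \<and> p i \<le> q i \<and> q i \<le> d) \<longrightarrow>
        disjoint_family_on (\<lambda>i. {p i<..<q i}) {..<n} \<longrightarrow>
        (\<Sum>i<n. q i - p i) < \<delta> \<longrightarrow>
        (\<Sum>i<n. \<bar>f (q i) - f (p i)\<bar>) < \<epsilon>)"

definition AC_loc :: "(real \<Rightarrow> real) set" where
  "AC_loc = {f. \<forall>T>0. abs_continuous_on_interval 0 T f}"

definition L1_loc :: "(real \<Rightarrow> real) set" where
  "L1_loc = {f. \<forall>T>0. set_integrable lebesgue {0..T} f}"

text \<open>The outward normal of \<open>[a, b]\<close> for \<open>a < b\<close>. Its value inside the interval is immaterial,
  because the reflection term \<open>l\<close> vanishes there.\<close>

definition outer_normal :: "real \<Rightarrow> real \<Rightarrow> real \<Rightarrow> real" where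
  "outer_normal a b y = (if y = a then -1 else if y = b then 1 else 0)"

definition SP :: "real \<Rightarrow> real \<Rightarrow> real \<Rightarrow> ((real \<Rightarrow> real) \<times> (real \<Rightarrow> real) \<times> (real \<Rightarrow> real)) set" where
  "SP a b \<alpha> = {(\<eta>, v, l).
     \<eta> \<in> AC_loc \<and> v \<in> L1_loc \<and> l \<in> L1_loc \<and> \<eta> 0 = \<alpha> \<and> (\<forall>s\<ge>0. \<eta> s \<in> {a..b}) \<and>
     (AE s in lebesgue. s > 0 \<longrightarrow>
        (\<exists>d. (\<eta> has_real_derivative d) (at s) \<and> d + l s * outer_normal a b (\<eta> s) = v s) \<and>
        l s \<ge> 0 \<and> (\<eta> s \<in> {a<..<b} \<longrightarrow> l s = 0))}"

text \<open>The first case is the convention \<open>I(0;0,t) = 0\<close> for a segment degenerated to a point, where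
  the normal is not defined. The Lagrangian is nonnegative for nonnegative intensities (take
  \<open>p = 0\<close>), so that the Lebesgue integral in \<open>[0, \<infinity>]\<close> is available.\<close>

definition action_inf ::
    "(real \<Rightarrow> real) \<Rightarrow> (real \<Rightarrow> real) \<Rightarrow> real \<Rightarrow> real \<Rightarrow> real \<Rightarrow> real \<Rightarrow> real \<Rightarrow> ereal" where
  "action_inf \<phi>p \<phi>m a b y \<alpha> t =
     (if a = 0 \<and> b = 0 \<and> y = 0 \<and> \<alpha> = 0 then 0
      else INF (\<eta>, v, l) \<in> {(\<eta>, v, l) \<in> SP a b \<alpha>. \<eta> t = y}.
        enn2ereal (\<integral>\<^sup>+ s \<in> {0..t}. e2ennreal (lagrangian \<phi>p \<phi>m (\<eta> s) (v s)) \<partial>lebesgue))"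

definition rate_function ::
    "(real^2) set \<Rightarrow> real^2 \<Rightarrow> real^2 \<Rightarrow> (real^2 \<Rightarrow> real) \<Rightarrow> (real^2 \<Rightarrow> real)
      \<Rightarrow> real^2 \<Rightarrow> real^2 \<Rightarrow> real \<Rightarrow> ereal" where
  "rate_function D u w \<Phi>p \<Phi>m y x0 t =
     (if y \<in> segment D x0 u w 0
      then action_inf (\<lambda>\<alpha>. \<Phi>p (x0 + \<alpha> *\<^sub>R u)) (\<lambda>\<alpha>. \<Phi>m (x0 + \<alpha> *\<^sub>R u))
             (seg_lo D x0 u w 0) (seg_hi D x0 u w 0)
             (((y - x0) \<bullet> u) / (norm u)\<^sup>2) 0 t
      else \<infinity>)"

end

theory Submission
  imports Defs
begin

text \<open>Only the law of \<open>X\<^sup>h(t)\<close> at one time enters, and by the Markov property it is given by the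
semigroup \<open>exp (t Q)\<close> on a finite set. The function \<open>u = exp (t Q) exp (f / h)\<close> solves the linear
equation \<open>u' = Q u\<close>, for which sub- and supersolutions are compared by the maximum principle
(\<open>reaction_comparison\<close>). Write \<open>\<alpha>\<close> for the coordinate along
\<open>\<nu>\<close> and \<open>g = h ln u\<close>. Then \<open>g\<close> solves a difference version of \<open>g' = H(\<alpha>, \<partial>g)\<close>, in which the jump that
would leave the segment is suppressed. The heart of the proof is the Laplace principle: for Lipschitz
\<open>f\<close>, \<open>g(t)\<close> at the initial state converges to the supremum of \<open>f(\<eta>(t))\<close> minus the action of \<open>\<eta>\<close> over the
reflected paths \<open>\<eta>\<close> that start at \<open>0\<close>.

Upper bound (\<open>laplace_upper_bound\<close>). Let \<open>U\<close> be the supremum over paths with finitely many linear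
pieces. It is Lipschitz and satisfies one half of the dynamic programming principle, hence it is a
viscosity supersolution of the Hamilton-Jacobi equation. Doubling the variables, that is, looking at
the maximum of \<open>g(s,x) - U(s,y) - \<kappa> (x - y)\<^sup>2 - \<epsilon> s\<close>, compares \<open>g\<close> with \<open>U\<close>. The reflection causes no
boundary layer: at an end point the slope \<open>2 \<kappa> (x - y)\<close> of the penalty has, up to \<open>O(h)\<close>, the sign for
which a suppressed jump, or a push of the path against the end point, does no harm.

Lower bound (\<open>laplace_lower_bound\<close>). Given any reflected path \<open>\<eta>\<close>, run the chain with jump rates
that are constant on small time intervals and whose drift is the average of the control of \<open>\<eta>\<close>.
By Young's inequality the function \<open>exp (- (\<kappa>(s) (x - \<eta>)\<^sup>2 + c(s)) / h)\<close> is a subsolution of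
\<open>u' = Q u\<close>, where \<open>c\<close> grows with the action of \<open>\<eta>\<close>. At the end points the quadratic has again the
favourable sign, because \<open>\<eta>\<close> can be pushed only while it sits there.

Both bounds together say that for every path there is one with finitely many linear pieces which
ends nearby and costs hardly more. Compressing such a path in time leaves room for a last leg to a
prescribed end point (\<open>reach_compress\<close>, \<open>reach_limit\<close>), so the rate function is lower semicontinuous;
its sublevel sets are compact because the segment is. Choosing \<open>f\<close> as a steep negative multiple of the
distance to a closed set or to a point turns the Laplace principle into the two halves of the large
deviation principle. A segment that degenerates to a point and the time \<open>t = 0\<close> are treated
separately (\<open>degenerate_principle\<close>): there the law concentrates at \<open>x\<^sub>0\<close> and the rate is \<open>0\<close> or \<open>\<infinity>\<close>.\<close>

section \<open>The semigroup of a chain on a finite set\<close>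

lemma iterate_bound:
  fixes Q :: "('a \<Rightarrow> real) \<Rightarrow> 'a \<Rightarrow> real"
  assumes fin: "finite S"
    and Q: "\<And>f x. x \<in> S \<Longrightarrow> Q f x = (\<Sum>y\<in>S. q x y * f y)"
    and x: "x \<in> S"
  shows "\<bar>(Q ^^ n) f x\<bar> \<le> (\<Sum>x\<in>S. \<Sum>y\<in>S. \<bar>q x y\<bar>) ^ n * (\<Sum>y\<in>S. \<bar>f y\<bar>)"
  using x
proof (induction n arbitrary: x)
  case 0
  then show ?case using member_le_sum[of x S "\<lambda>y. \<bar>f y\<bar>"] fin by simp
next
  case (Suc n)
  let ?C = "\<Sum>x\<in>S. \<Sum>y\<in>S. \<bar>q x y\<bar>" and ?B = "\<Sum>y\<in>S. \<bar>f y\<bar>"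
  have C0: "0 \<le> ?C" "0 \<le> ?B" by (auto intro!: sum_nonneg)
  have "\<bar>(Q ^^ Suc n) f x\<bar> = \<bar>\<Sum>y\<in>S. q x y * (Q ^^ n) f y\<bar>"
    using Q[OF Suc.prems] by simp
  also have "\<dots> \<le> (\<Sum>y\<in>S. \<bar>q x y\<bar> * (?C ^ n * ?B))"
    by (rule order_trans[OF sum_abs]) (auto intro!: sum_mono mult_left_mono Suc.IH simp: abs_mult)
  also have "\<dots> = (\<Sum>y\<in>S. \<bar>q x y\<bar>) * (?C ^ n * ?B)"
    by (simp add: sum_distrib_right)
  also have "\<dots> \<le> ?C * (?C ^ n * ?B)"
    using member_le_sum[of x S "\<lambda>x. \<Sum>y\<in>S. \<bar>q x y\<bar>"] fin Suc.prems C0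
    by (intro mult_right_mono) (auto intro!: sum_nonneg)
  finally show ?case by (simp add: mult_ac)
qed

lemma semigroup_summable:
  fixes Q :: "('a \<Rightarrow> real) \<Rightarrow> 'a \<Rightarrow> real"
  assumes fin: "finite S"
    and Q: "\<And>f x. x \<in> S \<Longrightarrow> Q f x = (\<Sum>y\<in>S. q x y * f y)"
    and x: "x \<in> S"
  shows "summable (\<lambda>n. t ^ n / fact n * (Q ^^ n) f x)"
proof -
  let ?C = "\<Sum>x\<in>S. \<Sum>y\<in>S. \<bar>q x y\<bar>" and ?B = "\<Sum>y\<in>S. \<bar>f y\<bar>"
  have "summable (\<lambda>n. inverse (fact n) * (\<bar>t\<bar> * ?C) ^ n * ?B)"
    by (intro summable_mult2 summable_exp)
  then show ?thesis
  proof (rule summable_comparison_test'[where N = 0])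
    fix n
    have "norm (t ^ n / fact n * (Q ^^ n) f x) = \<bar>t\<bar> ^ n / fact n * \<bar>(Q ^^ n) f x\<bar>"
      by (simp add: abs_mult power_abs)
    also have "\<dots> \<le> \<bar>t\<bar> ^ n / fact n * (?C ^ n * ?B)"
      using iterate_bound[of S Q q x n f, OF fin Q x] by (intro mult_left_mono) auto
    finally show "norm (t ^ n / fact n * (Q ^^ n) f x) \<le> inverse (fact n) * (\<bar>t\<bar> * ?C) ^ n * ?B"
      by (simp add: power_mult_distrib field_simps)
  qed
qed

lemma semigroup_has_derivative:
  fixes Q :: "('a \<Rightarrow> real) \<Rightarrow> 'a \<Rightarrow> real"
  assumes fin: "finite S"
    and Q: "\<And>f x. x \<in> S \<Longrightarrow> Q f x = (\<Sum>y\<in>S. q x y * f y)"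
    and x: "x \<in> S"
  shows "((\<lambda>t. semigroup_of Q t f x) has_real_derivative Q (semigroup_of Q t f) x) (at t)"
proof -
  define c where "c n = (Q ^^ n) f x / fact n" for n
  have c: "t ^ n / fact n * (Q ^^ n) f x = c n * t ^ n" for n t
    by (simp add: c_def)
  have "summable (\<lambda>n. c n * t ^ n)" for t
    using semigroup_summable[of S Q q x t f, OF fin Q x] unfolding c .
  then have "((\<lambda>t. \<Sum>n. c n * t ^ n) has_real_derivative (\<Sum>n. diffs c n * t ^ n)) (at t)"
    by (rule termdiffs_strong_converges_everywhere)
  moreover have "(\<Sum>n. diffs c n * t ^ n) = Q (semigroup_of Q t f) x"
  proof -
    have "diffs c n * t ^ n = (\<Sum>y\<in>S. q x y * (t ^ n / fact n * (Q ^^ n) f y))" for n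
    proof -
      have "diffs c n = (Q ^^ Suc n) f x / fact n"
        unfolding diffs_def c_def fact_Suc of_nat_mult by (simp del: of_nat_Suc funpow.simps)
      also have "(Q ^^ Suc n) f x = (\<Sum>y\<in>S. q x y * (Q ^^ n) f y)"
        using Q[OF x] by simp
      finally show ?thesis
        by (simp add: sum_distrib_left sum_divide_distrib sum_distrib_right mult_ac)
    qed
    then have "(\<Sum>n. diffs c n * t ^ n)
        = (\<Sum>n. \<Sum>y\<in>S. q x y * (t ^ n / fact n * (Q ^^ n) f y))"
      by simp
    also have "\<dots> = (\<Sum>y\<in>S. \<Sum>n. q x y * (t ^ n / fact n * (Q ^^ n) f y))"
      by (rule suminf_sum) (intro summable_mult semigroup_summable[OF fin Q])
    also have "\<dots> = (\<Sum>y\<in>S. q x y * semigroup_of Q t f y)"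
      unfolding semigroup_of_def
      by (intro sum.cong refl suminf_mult semigroup_summable[OF fin Q])
    also have "\<dots> = Q (semigroup_of Q t f) x"
      using Q[OF x] by simp
    finally show ?thesis .
  qed
  moreover have "(\<lambda>t. semigroup_of Q t f x) = (\<lambda>t. \<Sum>n. c n * t ^ n)"
    by (rule ext) (simp only: semigroup_of_def c)
  ultimately show ?thesis by simp
qed

lemma semigroup_zero: "semigroup_of Q 0 f x = f x"
proof -
  have "(\<lambda>n. 0 ^ n / fact n * (Q ^^ n) f x) sums (\<Sum>n\<in>{0}. 0 ^ n / fact n * (Q ^^ n) f x)"
    by (rule sums_finite) auto
  then show ?thesis by (simp add: semigroup_of_def sums_iff)
qed

lemma semigroup_expand:
  fixes Q :: "('a \<Rightarrow> real) \<Rightarrow> 'a \<Rightarrow> real"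
  assumes fin: "finite S"
    and Q: "\<And>f x. x \<in> S \<Longrightarrow> Q f x = (\<Sum>y\<in>S. q x y * f y)"
    and x: "x \<in> S"
  shows "semigroup_of Q t f x = (\<Sum>y\<in>S. f y * semigroup_of Q t (indicator {y}) x)"
proof -
  have it: "(Q ^^ n) f x = (\<Sum>y\<in>S. f y * (Q ^^ n) (indicator {y}) x)" if "x \<in> S" for x n
    using that
  proof (induction n arbitrary: x)
    case 0
    then show ?case using fin by (simp add: indicator_def if_distrib sum.delta cong: if_cong)
  next
    case (Suc n)
    have "(Q ^^ Suc n) f x = (\<Sum>z\<in>S. q x z * (\<Sum>y\<in>S. f y * (Q ^^ n) (indicator {y}) z))"
      using Q[OF Suc.prems] Suc.IH by (simp cong: sum.cong)
    also have "\<dots> = (\<Sum>y\<in>S. f y * (\<Sum>z\<in>S. q x z * (Q ^^ n) (indicator {y}) z))"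
      by (subst (2) sum_distrib_left, subst sum_distrib_left, subst sum.swap) (simp add: mult_ac)
    finally show ?case using Q[OF Suc.prems] by simp
  qed
  have "semigroup_of Q t f x = (\<Sum>n. \<Sum>y\<in>S. f y * (t ^ n / fact n * (Q ^^ n) (indicator {y}) x))"
    unfolding semigroup_of_def it[OF x] by (simp add: sum_distrib_left mult_ac)
  also have "\<dots> = (\<Sum>y\<in>S. \<Sum>n. f y * (t ^ n / fact n * (Q ^^ n) (indicator {y}) x))"
    by (rule suminf_sum) (intro summable_mult semigroup_summable[OF fin Q x])
  also have "\<dots> = (\<Sum>y\<in>S. f y * semigroup_of Q t (indicator {y}) x)"
    unfolding semigroup_of_def
    by (intro sum.cong refl suminf_mult semigroup_summable[OF fin Q x])
  finally show ?thesis .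
qed

lemma reaction_generator_matrix:
  assumes fin: "finite S" and x: "x \<in> S"
  shows "reaction_generator S u \<Phi>p \<Phi>m h f x =
    (\<Sum>y\<in>S. (1 / h * indicator S (x + h *\<^sub>R u) * \<Phi>p x * (indicator {x + h *\<^sub>R u} y - indicator {x} y) +
       1 / h * indicator S (x - h *\<^sub>R u) * \<Phi>m x * (indicator {x - h *\<^sub>R u} y - indicator {x} y)) * f y)"
proof -
  have pick: "(\<Sum>y\<in>S. indicator {z} y * f y) = f z" if "z \<in> S" for z
    using fin that by (simp add: indicator_def if_distrib[where f="\<lambda>c. c * _"] sum.delta cong: if_cong)
  have d: "(\<Sum>y\<in>S. (c * indicator S z * p * (indicator {z} y - indicator {x} y)) * f y)
      = c * indicator S z * p * (f z - f x)" for c p z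
  proof (cases "z \<in> S")
    case True
    have "(\<Sum>y\<in>S. (c * indicator S z * p * (indicator {z} y - indicator {x} y)) * f y)
      = c * indicator S z * p * ((\<Sum>y\<in>S. indicator {z} y * f y) - (\<Sum>y\<in>S. indicator {x} y * f y))"
      by (simp add: sum_distrib_left algebra_simps sum_subtractf)
    then show ?thesis using pick True x by simp
  qed simp
  show ?thesis
    by (simp only: reaction_generator_def ring_distribs(2) sum.distrib d)
qed

lemmas reaction_semigroup_has_derivative =
  semigroup_has_derivative[OF _ reaction_generator_matrix]

text \<open>At a minimum of \<open>v(s,x) + \<epsilon> s\<close> the generator is nonnegative, since it is a sum of nonnegative
multiples of differences, whereas the time derivative would have to be nonpositive if the minimum were
attained after \<open>s1\<close>. The term \<open>\<epsilon> s\<close> makes this strict.\<close>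

lemma reaction_comparison:
  fixes v v' :: "real \<Rightarrow> real^2 \<Rightarrow> real"
  assumes fin: "finite S" and h: "h > 0" and \<Phi>: "\<And>x. x \<in> S \<Longrightarrow> 0 \<le> \<Phi>p x \<and> 0 \<le> \<Phi>m x"
    and s: "s1 \<le> s2"
    and der: "\<And>s x. s1 \<le> s \<Longrightarrow> s \<le> s2 \<Longrightarrow> x \<in> S \<Longrightarrow>
        ((\<lambda>s. v s x) has_real_derivative v' s x) (at s within {s1..s2})"
    and ge: "\<And>s x. s1 \<le> s \<Longrightarrow> s \<le> s2 \<Longrightarrow> x \<in> S \<Longrightarrow>
        reaction_generator S u \<Phi>p \<Phi>m h (v s) x \<le> v' s x"
    and init: "\<And>x. x \<in> S \<Longrightarrow> 0 \<le> v s1 x"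
    and x: "x \<in> S"
  shows "0 \<le> v s2 x"
proof (rule field_le_epsilon)
  fix e :: real assume e: "e > 0"
  define \<epsilon> where "\<epsilon> = e / (s2 - s1 + 1)"
  have \<epsilon>: "\<epsilon> > 0" using e s by (simp add: \<epsilon>_def)
  define z where "z s x = v s x + \<epsilon> * (s - s1)" for s x
  have cont: "continuous_on {s1..s2} (\<lambda>s. z s x)" if "x \<in> S" for x
    unfolding z_def
    by (intro continuous_intros DERIV_continuous_on[OF der]) (use that in auto)
  have "\<exists>m\<in>{s1..s2}. \<forall>s\<in>{s1..s2}. z m x \<le> z s x" if "x \<in> S" for x
    using continuous_attains_inf[OF _ _ cont[OF that]] s by auto
  then obtain m where m: "\<And>x. x \<in> S \<Longrightarrow> m x \<in> {s1..s2}"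
      "\<And>x s. x \<in> S \<Longrightarrow> s \<in> {s1..s2} \<Longrightarrow> z (m x) x \<le> z s x"
    by metis
  obtain y where y: "y \<in> S" "\<And>x. x \<in> S \<Longrightarrow> z (m y) y \<le> z (m x) x"
    using ex_min_if_finite[of "(\<lambda>x. z (m x) x) ` S"] fin x by (force simp: not_less)
  have min: "z (m y) y \<le> z s x" if "x \<in> S" "s \<in> {s1..s2}" for x s
    using y(2)[OF that(1)] m(2)[OF that] by linarith
  have my: "s1 \<le> m y" "m y \<le> s2" using m(1)[OF y(1)] by auto
  have "0 \<le> z (m y) y"
  proof (cases "m y = s1")
    case True
    then show ?thesis using init[OF y(1)] by (simp add: z_def)
  next
    case False
    have v_min: "v (m y) y \<le> v (m y) x" if "x \<in> S" for x
      using min[OF that, of "m y"] my by (simp add: z_def)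
    have "0 \<le> reaction_generator S u \<Phi>p \<Phi>m h (v (m y)) y"
      unfolding reaction_generator_def indicator_def
      using h \<Phi>[OF y(1)] v_min by simp
    then have "0 < v' (m y) y + \<epsilon>" using ge[OF my y(1)] \<epsilon> by linarith
    moreover have "((\<lambda>s. z s y) has_real_derivative v' (m y) y + \<epsilon>) (at (m y) within {s1..s2})"
      unfolding z_def by (auto intro!: derivative_eq_intros der my y(1))
    ultimately obtain d where d: "d > 0"
        "\<And>k. 0 < k \<Longrightarrow> m y - k \<in> {s1..s2} \<Longrightarrow> k < d \<Longrightarrow> z (m y - k) y < z (m y) y"
      using has_real_derivative_pos_inc_left by blast
    define k where "k = min (d / 2) (m y - s1)"
    have "0 < k" "k < d" "m y - k \<in> {s1..s2}" using False my d(1) by (auto simp: k_def)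
    then show ?thesis using d(2)[of k] min[OF y(1), of "m y - k"] by linarith
  qed
  then have "0 \<le> z s2 x" using min[OF x, of s2] s by simp
  moreover have "\<epsilon> * (s2 - s1) \<le> e"
    using e s by (simp add: \<epsilon>_def field_simps)
  ultimately show "0 \<le> v s2 x + e" by (simp add: z_def)
qed

text \<open>The form in which the maximum principle is used for the lower bound: the explicit function \<open>w\<close> may
start at any time \<open>s1\<close>, so that bounds obtained on consecutive time intervals can be chained.\<close>

lemma semigroup_ge_subsolution:
  assumes fin: "finite S" and h: "h > 0" and \<Phi>: "\<And>x. x \<in> S \<Longrightarrow> 0 \<le> \<Phi>p x \<and> 0 \<le> \<Phi>m x"
    and s: "s1 \<le> s2"
    and der: "\<And>s x. s1 \<le> s \<Longrightarrow> s \<le> s2 \<Longrightarrow> x \<in> S \<Longrightarrow>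
        ((\<lambda>s. w s x) has_real_derivative w' s x) (at s within {s1..s2})"
    and le: "\<And>s x. s1 \<le> s \<Longrightarrow> s \<le> s2 \<Longrightarrow> x \<in> S \<Longrightarrow>
        w' s x \<le> reaction_generator S u \<Phi>p \<Phi>m h (w s) x"
    and init: "\<And>x. x \<in> S \<Longrightarrow> w s1 x \<le> semigroup_of (reaction_generator S u \<Phi>p \<Phi>m h) s1 F x"
    and x: "x \<in> S"
  shows "w s2 x \<le> semigroup_of (reaction_generator S u \<Phi>p \<Phi>m h) s2 F x"
proof -
  let ?Q = "reaction_generator S u \<Phi>p \<Phi>m h"
  let ?u = "\<lambda>s. semigroup_of ?Q s F"
  have "0 \<le> ?u s2 x - w s2 x"
  proof (rule reaction_comparison[OF fin h \<Phi> s, where v = "\<lambda>s x. ?u s x - w s x" and v' = "\<lambda>s x. ?Q (?u s) x - w' s x" and u = u])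
    show "((\<lambda>s. ?u s x - w s x) has_real_derivative ?Q (?u s) x - w' s x) (at s within {s1..s2})"
      if "s1 \<le> s" "s \<le> s2" "x \<in> S" for s x
      by (intro derivative_intros der that has_field_derivative_at_within[OF reaction_semigroup_has_derivative[OF fin fin]])
    show "?Q (\<lambda>x. ?u s x - w s x) x \<le> ?Q (?u s) x - w' s x" if "s1 \<le> s" "s \<le> s2" "x \<in> S" for s x
    proof -
      have "?Q (\<lambda>x. ?u s x - w s x) x = ?Q (?u s) x - ?Q (w s) x"
        by (simp add: reaction_generator_def algebra_simps add_divide_distrib diff_divide_distrib)
      then show ?thesis using le[OF that] by simp
    qed
  qed (use init x in auto)
  then show ?thesis by simp
qed

lemma semigroup_pos:
  assumes fin: "finite S" and h: "h > 0" and \<Phi>: "\<And>x. x \<in> S \<Longrightarrow> 0 \<le> \<Phi>p x \<and> 0 \<le> \<Phi>m x"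
    and t: "0 \<le> t" and F: "\<And>x. x \<in> S \<Longrightarrow> 0 < F x" and x: "x \<in> S"
  shows "0 < semigroup_of (reaction_generator S u \<Phi>p \<Phi>m h) t F x"
proof -
  define m where "m = Min (F ` S)"
  have "m > 0" unfolding m_def using fin F x by (subst Min_gr_iff) auto
  moreover have "(\<lambda>s x. m) t x \<le> semigroup_of (reaction_generator S u \<Phi>p \<Phi>m h) t F x"
    by (rule semigroup_ge_subsolution[OF fin h \<Phi> t, where w' = "\<lambda>s x. 0" and w = "\<lambda>s x. m"])
      (use fin x in \<open>auto simp: reaction_generator_def semigroup_zero m_def intro!: Min_le\<close>)
  ultimately show ?thesis by simp
qed

section \<open>The Lagrangian and tilted jump rates\<close>

text \<open>The relative entropy rate of a Poisson process of intensity \<open>\<mu>\<close> with respect to one of intensity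
\<open>\<phi>\<close>. It is the Legendre dual of \<open>\<phi> (exp z - 1)\<close> at \<open>\<mu>\<close>.\<close>

definition tilt_cost :: "real \<Rightarrow> real \<Rightarrow> real" where
  "tilt_cost \<mu> \<phi> = \<mu> * ln (\<mu> / \<phi>) - \<mu> + \<phi>"

lemma tilt_cost_young:
  assumes "\<mu> > 0" "\<phi> > 0"
  shows "\<mu> * z - tilt_cost \<mu> \<phi> \<le> \<phi> * (exp z - 1)"
proof -
  define w where "w = z - ln (\<mu> / \<phi>)"
  have "1 + w \<le> exp w" by (rule exp_ge_add_one_self)
  then have "\<mu> * (1 + w) \<le> \<mu> * exp w" using assms by simp
  also have "\<mu> * exp w = \<phi> * exp z" using assms by (simp add: w_def exp_diff)
  finally show ?thesis by (simp add: tilt_cost_def w_def algebra_simps)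
qed

lemma tilt_cost_nonneg: "\<mu> > 0 \<Longrightarrow> \<phi> > 0 \<Longrightarrow> 0 \<le> tilt_cost \<mu> \<phi>"
  using tilt_cost_young[of \<mu> \<phi> 0] by simp

lemma tilt_cost_exp: "\<phi> > 0 \<Longrightarrow> tilt_cost (\<phi> * exp p) \<phi> = \<phi> * exp p * p - \<phi> * (exp p - 1)"
  by (simp add: tilt_cost_def algebra_simps)

lemma tilt_cost_le:
  assumes "\<mu> > 0" "\<phi> > 0" shows "tilt_cost \<mu> \<phi> \<le> \<mu>\<^sup>2 / \<phi> + \<phi>"
proof -
  have "\<mu> * ln (\<mu> / \<phi>) \<le> \<mu> * (\<mu> / \<phi> - 1)"
    using assms ln_le_minus_one[of "\<mu> / \<phi>"] by (intro mult_left_mono) auto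
  then show ?thesis using assms by (simp add: tilt_cost_def power2_eq_square algebra_simps)
qed

text \<open>The error is proportional to \<open>1 + \<mu>\<close> and not to the cost itself; in the lower bound it is summed
over a path of finite total variation.\<close>

lemma tilt_cost_diff:
  assumes "\<mu> > 0" "c > 0" "c \<le> \<phi>" "c \<le> \<psi>" "\<bar>\<phi> - \<psi>\<bar> \<le> e"
  shows "tilt_cost \<mu> \<phi> \<le> tilt_cost \<mu> \<psi> + e * (1 + \<mu> / c)"
proof -
  have p: "\<phi> > 0" "\<psi> > 0" using assms by linarith+
  have e0: "e \<ge> 0" using assms(5) by linarith
  have "ln (\<psi> / \<phi>) \<le> \<psi> / \<phi> - 1" using p by (intro ln_le_minus_one) simp
  also have "\<dots> = (\<psi> - \<phi>) / \<phi>" using p by (simp add: field_simps)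
  also have "\<dots> \<le> e / \<phi>" using assms p by (intro divide_right_mono) auto
  also have "\<dots> \<le> e / c" using assms p e0 by (intro divide_left_mono) auto
  finally have "\<mu> * ln (\<psi> / \<phi>) \<le> \<mu> * (e / c)" using assms by (intro mult_left_mono) auto
  moreover have "ln (\<mu> / \<phi>) = ln (\<mu> / \<psi>) + ln (\<psi> / \<phi>)"
    using assms p by (simp add: ln_div)
  ultimately have "tilt_cost \<mu> \<phi> \<le> \<mu> * ln (\<mu>/\<psi>) + \<mu> * (e / c) - \<mu> + \<phi>"
    by (simp add: tilt_cost_def algebra_simps)
  then show ?thesis using assms by (simp add: tilt_cost_def algebra_simps)
qed

lemma tilt_cost_scale:
  assumes "\<mu> > 0" "\<phi> > 0" "\<theta> \<ge> 1"
  shows "tilt_cost (\<theta> * \<mu>) \<phi> \<le> \<theta> * tilt_cost \<mu> \<phi> + \<theta> * ln \<theta> * \<mu>"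
proof -
  have "ln (\<theta> * \<mu> / \<phi>) = ln \<theta> + ln (\<mu> / \<phi>)"
    using assms by (simp add: ln_mult ln_div)
  moreover have "\<phi> \<le> \<theta> * \<phi>" using assms by simp
  ultimately show ?thesis by (simp add: tilt_cost_def algebra_simps)
qed

lemma lagrangian_ge: "ereal (p * v - hamiltonian \<phi>p \<phi>m x p) \<le> lagrangian \<phi>p \<phi>m x v"
  unfolding lagrangian_def by (rule SUP_upper) simp

lemma lagrangian_nonneg: "0 \<le> lagrangian \<phi>p \<phi>m x v"
  using lagrangian_ge[of 0 v \<phi>p \<phi>m x] by (simp add: hamiltonian_def zero_ereal_def)

text \<open>Splitting a velocity \<open>v = \<mu>p - \<mu>m\<close> into an upward and a downward jump rate bounds the Lagrangian; by
\<open>lagrangian_eq\<close> the split \<open>\<mu>p = \<phi>p exp p\<close>, \<open>\<mu>m = \<phi>m exp (- p)\<close> is optimal. Thus all estimates of the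
Lagrangian reduce to the explicit function \<open>tilt_cost\<close>.\<close>

lemma lagrangian_le_tilt_cost:
  assumes "\<mu>p > 0" "\<mu>m > 0" "\<phi>p x > 0" "\<phi>m x > 0" "\<mu>p - \<mu>m = v"
  shows "lagrangian \<phi>p \<phi>m x v \<le> ereal (tilt_cost \<mu>p (\<phi>p x) + tilt_cost \<mu>m (\<phi>m x))"
  unfolding lagrangian_def
proof (rule SUP_least)
  fix p
  have "p * v = \<mu>p * p + \<mu>m * (- p)" unfolding assms(5)[symmetric] by (simp add: algebra_simps)
  then show "ereal (p * v - hamiltonian \<phi>p \<phi>m x p) \<le> ereal (tilt_cost \<mu>p (\<phi>p x) + tilt_cost \<mu>m (\<phi>m x))"
    using tilt_cost_young[of \<mu>p "\<phi>p x" p] tilt_cost_young[of \<mu>m "\<phi>m x" "-p"] assms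
    by (simp add: hamiltonian_def)
qed

text \<open>The two jump rates have difference \<open>v\<close> and product \<open>A B\<close>, so that \<open>exp p\<close> is the root of a quadratic
equation. Their sum grows only linearly in \<open>v\<close>.\<close>

lemma optimal_tilt:
  fixes A B v :: real
  assumes "A > 0" "B > 0"
  obtains p where "A * exp p - B * exp (-p) = v" "A * exp p + B * exp (-p) \<le> \<bar>v\<bar> + A + B"
proof -
  define r where "r = sqrt (v\<^sup>2 + 4 * A * B)"
  have AB: "0 < A * B" using assms by simp
  have r2: "r\<^sup>2 = v\<^sup>2 + 4 * A * B" using AB by (simp add: r_def)
  have "sqrt (v\<^sup>2) < r" unfolding r_def using AB by (intro real_sqrt_less_mono) simp
  then have r: "\<bar>v\<bar> < r" by simp
  have mp: "(v + r) / 2 > 0" using r by (simp add: abs_less_iff)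
  define p where "p = ln ((v + r) / 2 / A)"
  have e: "A * exp p = (v + r) / 2" using mp assms by (simp add: p_def)
  have "((v + r) / 2) * ((r - v) / 2) = A * B" using r2 by (simp add: power2_eq_square field_simps)
  then have e2: "B * exp (-p) = (r - v) / 2"
    using e assms mp by (simp add: exp_minus field_simps p_def)
  have "r \<le> \<bar>v\<bar> + A + B"
  proof (rule power2_le_imp_le)
    have "4 * A * B \<le> (A + B)\<^sup>2" using zero_le_power2[of "A - B"] by (simp add: power2_eq_square algebra_simps)
    moreover have "0 \<le> \<bar>v\<bar> * (A + B)" using assms by simp
    ultimately show "r\<^sup>2 \<le> (\<bar>v\<bar> + A + B)\<^sup>2" unfolding r2
      by (simp add: power2_eq_square algebra_simps abs_mult_self_eq)
  qed (use assms in auto)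
  then show ?thesis using that[of p] e e2 by (simp add: field_simps)
qed

lemma lagrangian_eq:
  assumes "\<phi>p x > 0" "\<phi>m x > 0" "\<phi>p x * exp p - \<phi>m x * exp (-p) = v"
  shows "lagrangian \<phi>p \<phi>m x v = ereal (p * v - hamiltonian \<phi>p \<phi>m x p)"
    "tilt_cost (\<phi>p x * exp p) (\<phi>p x) + tilt_cost (\<phi>m x * exp (-p)) (\<phi>m x)
      = p * v - hamiltonian \<phi>p \<phi>m x p"
proof -
  show eq: "tilt_cost (\<phi>p x * exp p) (\<phi>p x) + tilt_cost (\<phi>m x * exp (-p)) (\<phi>m x)
      = p * v - hamiltonian \<phi>p \<phi>m x p"
    using tilt_cost_exp[OF assms(1), of p] tilt_cost_exp[OF assms(2), of "-p"] assms(3)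
    by (simp add: hamiltonian_def algebra_simps)
  show "lagrangian \<phi>p \<phi>m x v = ereal (p * v - hamiltonian \<phi>p \<phi>m x p)"
    using lagrangian_le_tilt_cost[of "\<phi>p x * exp p" "\<phi>m x * exp (-p)" \<phi>p x \<phi>m v] eq assms
      lagrangian_ge[of p v \<phi>p \<phi>m x] by (intro antisym) auto
qed

section \<open>Absolutely continuous functions and reflected paths\<close>

text \<open>Absolute continuity, restated for the tagged partial divisions of the gauge integral.\<close>

lemma AC_sum_small:
  fixes f :: "real \<Rightarrow> real"
  assumes ac: "abs_continuous_on_interval c d f" and e: "e > 0"
  shows "\<exists>\<delta>>0. \<forall>\<D>. \<D> tagged_partial_division_of cbox c d \<longrightarrow> (\<Sum>(x,k)\<in>\<D>. measure lborel k) < \<delta> \<longrightarrow>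
    (\<Sum>(x,k)\<in>\<D>. \<bar>f (Sup k) - f (Inf k)\<bar>) < e"
proof -
  obtain \<delta> where \<delta>: "\<delta> > 0" "\<And>(n::nat) (p::nat \<Rightarrow> real) q.
        (\<forall>i<n. c \<le> p i \<and> p i \<le> q i \<and> q i \<le> d) \<Longrightarrow>
        disjoint_family_on (\<lambda>i. {p i<..<q i}) {..<n} \<Longrightarrow>
        (\<Sum>i<n. q i - p i) < \<delta> \<Longrightarrow> (\<Sum>i<n. \<bar>f (q i) - f (p i)\<bar>) < e"
    using ac[unfolded abs_continuous_on_interval_def, rule_format, OF e] by blast
  show ?thesis
  proof (intro exI[of _ \<delta>] conjI allI impI \<delta>(1))
    fix \<D> :: "(real \<times> real set) set"
    assume D: "\<D> tagged_partial_division_of cbox c d"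
      and small: "(\<Sum>(x,k)\<in>\<D>. measure lborel k) < \<delta>"
    have fin: "finite \<D>" using D by (rule tagged_partial_division_ofD)
    have int: "\<exists>p q. k = {p..q} \<and> c \<le> p \<and> p \<le> q \<and> q \<le> d" if xk: "(x, k) \<in> \<D>" for x k
    proof -
      obtain p q where "k = cbox p q" using tagged_partial_division_ofD(4)[OF D xk] by auto
      moreover have "x \<in> k" "k \<subseteq> cbox c d"
        using tagged_partial_division_ofD(2,3)[OF D xk] by auto
      ultimately show ?thesis by (intro exI[of _ p] exI[of _ q]) auto
    qed
    have disj: "interior (snd z) \<inter> interior (snd z') = {}" if "z \<in> \<D>" "z' \<in> \<D>" "z \<noteq> z'" for z z'
      using that tagged_partial_division_ofD(5)[OF D, of "fst z" "snd z" "fst z'" "snd z'"]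
      by (auto simp: prod_eq_iff)
    obtain g where g: "bij_betw g {..<card \<D>} \<D>"
      using ex_bij_betw_nat_finite[OF fin] by (auto simp: atLeast0LessThan)
    define p q where "p i = Inf (snd (g i))" and "q i = Sup (snd (g i))" for i
    have gD: "g i \<in> \<D>" if "i < card \<D>" for i using g that by (auto simp: bij_betw_def)
    have pq: "snd (g i) = {p i..q i} \<and> c \<le> p i \<and> p i \<le> q i \<and> q i \<le> d" if i: "i < card \<D>" for i
    proof -
      obtain p' q' where "snd (g i) = {p'..q'}" "c \<le> p'" "p' \<le> q'" "q' \<le> d"
        using int[of "fst (g i)" "snd (g i)"] gD[OF i] by auto
      then show ?thesis by (simp add: p_def q_def)
    qed
    have "(\<Sum>i<card \<D>. \<bar>f (q i) - f (p i)\<bar>) < e"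
    proof (rule \<delta>(2))
      show "\<forall>i<card \<D>. c \<le> p i \<and> p i \<le> q i \<and> q i \<le> d" using pq by auto
      show "disjoint_family_on (\<lambda>i. {p i<..<q i}) {..<card \<D>}"
        unfolding disjoint_family_on_def
      proof (intro ballI impI)
        fix i j assume ij: "i \<in> {..<card \<D>}" "j \<in> {..<card \<D>}" "i \<noteq> j"
        then have "g i \<noteq> g j" using g by (auto simp: bij_betw_def inj_on_def)
        then have "interior (snd (g i)) \<inter> interior (snd (g j)) = {}" using disj gD ij by auto
        then show "{p i<..<q i} \<inter> {p j<..<q j} = {}" using pq ij by simp
      qed
      have "(\<Sum>i<card \<D>. q i - p i) = (\<Sum>i<card \<D>. case g i of (x,k) \<Rightarrow> measure lborel k)"
        using pq by (intro sum.cong) (auto simp: case_prod_unfold)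
      also have "\<dots> = (\<Sum>(x,k)\<in>\<D>. measure lborel k)" by (rule sum.reindex_bij_betw[OF g])
      finally show "(\<Sum>i<card \<D>. q i - p i) < \<delta>" using small by simp
    qed
    also have "(\<Sum>i<card \<D>. \<bar>f (q i) - f (p i)\<bar>)
        = (\<Sum>i<card \<D>. case g i of (x,k) \<Rightarrow> \<bar>f (Sup k) - f (Inf k)\<bar>)"
      by (simp add: p_def q_def case_prod_unfold)
    also have "\<dots> = (\<Sum>(x,k)\<in>\<D>. \<bar>f (Sup k) - f (Inf k)\<bar>)" by (rule sum.reindex_bij_betw[OF g])
    finally show "(\<Sum>(x,k)\<in>\<D>. \<bar>f (Sup k) - f (Inf k)\<bar>) < e" .
  qed
qed

text \<open>On a fine tagged division the tags outside \<open>N\<close> are controlled by the derivative. The intervals with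
tags in \<open>N\<close> have small total length, because the indicator of \<open>N\<close> has gauge integral \<open>0\<close>, and then
absolute continuity makes the increments of \<open>f\<close> over them small.\<close>

lemma AC_fundamental_theorem:
  fixes f g :: "real \<Rightarrow> real"
  assumes ac: "abs_continuous_on_interval c d f" and cd: "c \<le> d"
    and N: "negligible N"
    and der: "\<And>s. c \<le> s \<Longrightarrow> s \<le> d \<Longrightarrow> s \<notin> N \<Longrightarrow> (f has_real_derivative g s) (at s)"
  shows "(g has_integral (f d - f c)) {c..d}"
proof -
  define g0 where "g0 s = (if s \<in> N then 0 else g s)" for s
  have "(g0 has_integral (f d - f c)) (cbox c d)"
    unfolding has_integral
  proof (intro allI impI)
    fix e :: real assume e: "e > 0"
    define e1 where "e1 = e / (4 * (d - c + 1))"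
    have e1: "e1 > 0" using e cd by (simp add: e1_def)
    obtain \<delta> where \<delta>: "\<delta> > 0" "\<And>\<D>. \<D> tagged_partial_division_of cbox c d \<Longrightarrow>
        (\<Sum>(x,k)\<in>\<D>. measure lborel k) < \<delta> \<Longrightarrow> (\<Sum>(x,k)\<in>\<D>. \<bar>f (Sup k) - f (Inf k)\<bar>) < e / 2"
      using AC_sum_small[OF ac half_gt_zero[OF e]] by blast
    have "((indicator N :: real \<Rightarrow> real) has_integral 0) (cbox c d)"
      using N unfolding negligible_def by blast
    then obtain \<gamma>1 where g1: "gauge \<gamma>1 \<and> (\<forall>\<D>. \<D> tagged_division_of cbox c d \<and> \<gamma>1 fine \<D> \<longrightarrow>
        norm ((\<Sum>(x,k)\<in>\<D>. measure lborel k *\<^sub>R (indicator N x :: real)) - 0) < \<delta>)"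
      using \<delta>(1) unfolding has_integral by meson
    then have \<gamma>1: "gauge \<gamma>1"
      "\<D> tagged_division_of cbox c d \<Longrightarrow> \<gamma>1 fine \<D> \<Longrightarrow>
        norm ((\<Sum>(x,k)\<in>\<D>. measure lborel k *\<^sub>R (indicator N x :: real)) - 0) < \<delta>" for \<D>
      by simp_all
    have "\<exists>r>0. s \<in> {c..d} - N \<longrightarrow> (\<forall>y. \<bar>y - s\<bar> < r \<longrightarrow> \<bar>f y - f s - g s * (y - s)\<bar> \<le> e1 * \<bar>y - s\<bar>)" for s
    proof (cases "s \<in> {c..d} - N")
      case True
      then have "(f has_derivative (*) (g s)) (at s)"
        using der[of s] by (simp add: has_field_derivative_def)
      from this[unfolded has_derivative_at_alt, THEN conjunct2, rule_format, OF e1]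
      obtain r where "r > 0" "\<forall>y. norm (y - s) < r \<longrightarrow> norm (f y - f s - g s * (y - s)) \<le> e1 * norm (y - s)"
        by blast
      then show ?thesis by (intro exI[of _ r]) auto
    qed (auto intro: exI[of _ 1])
    then have "\<forall>s. \<exists>r>0. s \<in> {c..d} - N \<longrightarrow> (\<forall>y. \<bar>y - s\<bar> < r \<longrightarrow> \<bar>f y - f s - g s * (y - s)\<bar> \<le> e1 * \<bar>y - s\<bar>)"
      by blast
    from choice[OF this] obtain r where r: "\<And>s. r s > 0"
      "\<And>s y. s \<in> {c..d} - N \<Longrightarrow> \<bar>y - s\<bar> < r s \<Longrightarrow> \<bar>f y - f s - g s * (y - s)\<bar> \<le> e1 * \<bar>y - s\<bar>"
      by blast
    define \<gamma> where "\<gamma> s = \<gamma>1 s \<inter> ball s (r s)" for s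
    have "gauge \<gamma>" unfolding \<gamma>_def
      using gauge_Int[OF \<gamma>1(1), of "\<lambda>s. ball s (r s)"] gauge_ball_dependent[of r] r(1) by simp
    moreover have "norm ((\<Sum>(x,k)\<in>\<D>. measure lborel k *\<^sub>R g0 x) - (f d - f c)) < e"
      if D: "\<D> tagged_division_of cbox c d" and fine: "\<gamma> fine \<D>" for \<D>
    proof -
      have D': "\<D> tagged_division_of {c..d}" using D by simp
      have fin: "finite \<D>" using D by (rule tagged_division_of_finite)
      have fine1: "\<gamma>1 fine \<D>" and fine2: "(\<lambda>s. ball s (r s)) fine \<D>"
        using fine unfolding \<gamma>_def fine_Int by auto
      have el: "\<exists>p q. k = {p..q} \<and> c \<le> p \<and> p \<le> x \<and> x \<le> q \<and> q \<le> d" if xk: "(x, k) \<in> \<D>" for x k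
      proof -
        obtain p q where "k = cbox p q" using tagged_division_ofD(4)[OF D xk] by auto
        moreover have "x \<in> k" "k \<subseteq> cbox c d"
          using tagged_division_ofD(2,3)[OF D xk] by auto
        ultimately show ?thesis by (intro exI[of _ p] exI[of _ q]) auto
      qed
      define F where "F = (\<lambda>(x, k). measure lborel k *\<^sub>R g0 x - (f (Sup k) - f (Inf k)))"
      define A B where "A = {z \<in> \<D>. fst z \<in> N}" and "B = {z \<in> \<D>. fst z \<notin> N}"
      have AB: "\<D> = A \<union> B" "A \<inter> B = {}" "finite A" "finite B" using fin by (auto simp: A_def B_def)
      have "(\<Sum>(x,k)\<in>\<D>. f (Sup k) - f (Inf k)) = f d - f c"
        by (rule additive_tagged_division_1[OF cd D'])
      then have "(\<Sum>(x,k)\<in>\<D>. measure lborel k *\<^sub>R g0 x) - (f d - f c) = sum F \<D>"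
        by (simp add: F_def case_prod_unfold sum_subtractf)
      also have "\<bar>sum F \<D>\<bar> \<le> (\<Sum>z\<in>A. \<bar>F z\<bar>) + (\<Sum>z\<in>B. \<bar>F z\<bar>)"
        unfolding AB(1) using AB(2-4) sum_abs[of F "A \<union> B"] by (simp add: sum.union_disjoint)
      also have "(\<Sum>z\<in>A. \<bar>F z\<bar>) = (\<Sum>(x,k)\<in>A. \<bar>f (Sup k) - f (Inf k)\<bar>)"
        by (rule sum.cong) (auto simp: A_def F_def g0_def)
      also have "\<dots> < e / 2"
      proof (rule \<delta>(2))
        show "A tagged_partial_division_of cbox c d"
          using D by (auto simp: A_def tagged_division_of_def intro: tagged_partial_division_subset)
        have "(\<Sum>(x,k)\<in>A. measure lborel k) = (\<Sum>(x,k)\<in>\<D>. measure lborel k *\<^sub>R (indicator N x :: real))"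
          by (rule sum.mono_neutral_cong_left) (auto simp: A_def fin indicator_def split: if_splits)
        then show "(\<Sum>(x,k)\<in>A. measure lborel k) < \<delta>" using \<gamma>1(2)[OF D fine1] by simp
      qed
      also have "(\<Sum>z\<in>B. \<bar>F z\<bar>) \<le> (\<Sum>(x,k)\<in>B. e1 * measure lborel k)"
      proof (rule sum_mono, clarify)
        fix x k assume "(x, k) \<in> B"
        then have xk: "(x, k) \<in> \<D>" "x \<notin> N" by (auto simp: B_def)
        obtain p q where pq: "k = {p..q}" "c \<le> p" "p \<le> x" "x \<le> q" "q \<le> d" using el[OF xk(1)] by blast
        have "k \<subseteq> ball x (r x)" using fine2 xk(1) by (auto simp: fine_def)
        moreover have "p \<in> k" "q \<in> k" using pq by auto
        ultimately have "p \<in> ball x (r x)" "q \<in> ball x (r x)" by blast+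
        then have "\<bar>p - x\<bar> < r x" "\<bar>q - x\<bar> < r x" by (auto simp: dist_real_def)
        then have 1: "\<bar>f p - f x - g x * (p - x)\<bar> \<le> e1 * \<bar>p - x\<bar>" "\<bar>f q - f x - g x * (q - x)\<bar> \<le> e1 * \<bar>q - x\<bar>"
          using pq xk(2) by (intro r(2); simp)+
        have "F (x, k) = (f p - f x - g x * (p - x)) - (f q - f x - g x * (q - x))"
          using pq xk(2) by (simp add: F_def g0_def algebra_simps)
        then have "\<bar>F (x, k)\<bar> \<le> e1 * (x - p) + e1 * (q - x)" using 1 pq by simp
        then show "\<bar>F (x, k)\<bar> \<le> e1 * measure lborel k" using pq by (simp add: algebra_simps)
      qed
      also have "(\<Sum>(x,k)\<in>B. e1 * measure lborel k) \<le> (\<Sum>(x,k)\<in>\<D>. e1 * measure lborel k)"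
        using e1 by (intro sum_mono2 fin) (auto simp: B_def)
      also have "\<dots> = e1 * (d - c)"
        using additive_content_tagged_division[OF D] cd
        by (simp add: case_prod_unfold sum_distrib_left[symmetric])
      also have "\<dots> \<le> e1 * (2 * (d - c + 1))" using cd e1 by (intro mult_left_mono) auto
      also have "\<dots> = e / 2" using cd by (simp add: e1_def field_simps)
      finally show ?thesis by simp
    qed
    ultimately show "\<exists>\<gamma>. gauge \<gamma> \<and> (\<forall>\<D>. \<D> tagged_division_of cbox c d \<and> \<gamma> fine \<D> \<longrightarrow>
          norm ((\<Sum>(x,k)\<in>\<D>. measure lborel k *\<^sub>R g0 x) - (f d - f c)) < e)"
      by (intro exI[of _ \<gamma>] conjI allI impI) (simp_all only:)
  qed
  then have "(g0 has_integral (f d - f c)) {c..d}" by simp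
  then show ?thesis
    by (rule has_integral_spike[OF N, rotated]) (auto simp: g0_def)
qed

lemma lipschitz_imp_AC:
  assumes "\<And>s t. c \<le> s \<Longrightarrow> s \<le> t \<Longrightarrow> \<bar>f t - f s\<bar> \<le> K * (t - s)" and K: "K \<ge> 0"
  shows "abs_continuous_on_interval c d f"
  unfolding abs_continuous_on_interval_def
proof (intro allI impI)
  fix e :: real assume e: "e > 0"
  show "\<exists>\<delta>>0. \<forall>(n::nat) (p::nat \<Rightarrow> real) q.
        (\<forall>i<n. c \<le> p i \<and> p i \<le> q i \<and> q i \<le> d) \<longrightarrow>
        disjoint_family_on (\<lambda>i. {p i<..<q i}) {..<n} \<longrightarrow>
        (\<Sum>i<n. q i - p i) < \<delta> \<longrightarrow> (\<Sum>i<n. \<bar>f (q i) - f (p i)\<bar>) < e"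
  proof (intro exI[of _ "e / (K + 1)"] conjI allI impI)
    show "0 < e / (K + 1)" using e K by simp
    fix n :: nat and p q :: "nat \<Rightarrow> real"
    assume i: "\<forall>i<n. c \<le> p i \<and> p i \<le> q i \<and> q i \<le> d" and s: "(\<Sum>i<n. q i - p i) < e / (K + 1)"
    have "(\<Sum>i<n. \<bar>f (q i) - f (p i)\<bar>) \<le> (\<Sum>i<n. K * (q i - p i))"
      using i assms(1) by (intro sum_mono) auto
    also have "\<dots> = K * (\<Sum>i<n. q i - p i)" by (simp add: sum_distrib_left)
    also have "\<dots> \<le> K * (e / (K + 1))" using s K by (intro mult_left_mono) auto
    also have "\<dots> < e" using e K by (simp add: field_simps)
    finally show "(\<Sum>i<n. \<bar>f (q i) - f (p i)\<bar>) < e" .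
  qed
qed

lemma AC_imp_continuous:
  assumes ac: "abs_continuous_on_interval c d f"
  shows "continuous_on {c..d} f"
  unfolding continuous_on_iff
proof (intro ballI allI impI)
  fix x e :: real assume x: "x \<in> {c..d}" and e: "0 < e"
  obtain \<delta> where \<delta>: "\<delta> > 0" "\<And>(n::nat) (p::nat \<Rightarrow> real) q.
        (\<forall>i<n. c \<le> p i \<and> p i \<le> q i \<and> q i \<le> d) \<Longrightarrow>
        disjoint_family_on (\<lambda>i. {p i<..<q i}) {..<n} \<Longrightarrow>
        (\<Sum>i<n. q i - p i) < \<delta> \<Longrightarrow> (\<Sum>i<n. \<bar>f (q i) - f (p i)\<bar>) < e"
    using ac[unfolded abs_continuous_on_interval_def, rule_format, OF e] by blast
  have "dist (f y) (f x) < e" if y: "y \<in> {c..d}" "dist y x < \<delta>" for y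
  proof (cases "x \<le> y")
    case True
    then show ?thesis
      using \<delta>(2)[of 1 "\<lambda>_. x" "\<lambda>_. y"] x y by (simp add: disjoint_family_on_def dist_real_def)
  next
    case False
    then show ?thesis
      using \<delta>(2)[of 1 "\<lambda>_. y" "\<lambda>_. x"] x y by (simp add: disjoint_family_on_def dist_real_def abs_minus_commute)
  qed
  then show "\<exists>\<delta>>0. \<forall>y\<in>{c..d}. dist y x < \<delta> \<longrightarrow> dist (f y) (f x) < e" using \<delta>(1) by blast
qed

text \<open>A reflected path in integrated form. The density \<open>m\<close> of the reflection is \<open>l\<close>, set to \<open>0\<close> on an
exceptional null set, so that the almost everywhere conditions become conditions at every point.\<close>

lemma SP_decompose:
  assumes SP: "(\<eta>, v, l) \<in> SP a b \<alpha>" and t: "0 < t"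
  obtains m where "set_integrable lebesgue {0..t} v \<and> m integrable_on {0..t} \<and> (\<forall>s. 0 \<le> m s) \<and>
      continuous_on {0..t} \<eta> \<and> (\<forall>s\<ge>0. \<eta> s \<in> {a..b}) \<and> \<eta> 0 = \<alpha> \<and>
      (\<forall>r q. 0 \<le> r \<longrightarrow> r \<le> q \<longrightarrow> q \<le> t \<longrightarrow>
        ((\<lambda>s. m s * outer_normal a b (\<eta> s)) has_integral (integral {r..q} v - (\<eta> q - \<eta> r))) {r..q})"
proof -
  have ac: "abs_continuous_on_interval 0 t \<eta>" and v: "set_integrable lebesgue {0..t} v"
    and l: "set_integrable lebesgue {0..t} l"
    and \<eta>: "\<eta> 0 = \<alpha>" "\<And>s. 0 \<le> s \<Longrightarrow> \<eta> s \<in> {a..b}"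
    and ae: "AE s in lebesgue. s > 0 \<longrightarrow>
        (\<exists>d. (\<eta> has_real_derivative d) (at s) \<and> d + l s * outer_normal a b (\<eta> s) = v s) \<and>
        l s \<ge> 0 \<and> (\<eta> s \<in> {a<..<b} \<longrightarrow> l s = 0)"
    using SP t by (auto simp: SP_def AC_loc_def L1_loc_def)
  define G where "G s \<longleftrightarrow> (s > 0 \<longrightarrow>
        (\<exists>d. (\<eta> has_real_derivative d) (at s) \<and> d + l s * outer_normal a b (\<eta> s) = v s) \<and>
        l s \<ge> 0 \<and> (\<eta> s \<in> {a<..<b} \<longrightarrow> l s = 0))" for s
  have "AE s in lebesgue. G s" using ae by (simp add: G_def)
  then obtain N0 where N0': "\<And>s. s \<in> space lebesgue - N0 \<Longrightarrow> G s" and N0_null: "N0 \<in> null_sets lebesgue"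
    using AE_E3 by blast
  then have N0: "N0 \<in> null_sets lebesgue" "\<And>s. s \<notin> N0 \<Longrightarrow> G s" by simp_all
  define N where "N = insert 0 N0"
  have N: "negligible N" using N0(1) by (simp add: N_def negligible_iff_null_sets)
  define m where "m s = (if s \<in> N \<or> s \<le> 0 then 0 else l s)" for s
  have m: "m integrable_on {0..t}"
  proof (rule integrable_spike[OF _ N])
    show "l integrable_on {0..t}" using l by (rule set_lebesgue_integral_eq_integral)
  qed (auto simp: m_def N_def)
  have m0: "0 \<le> m s" for s using N0(2)[of s, unfolded G_def] by (auto simp: m_def N_def)
  have vint: "v integrable_on {0..t}" using v by (rule set_lebesgue_integral_eq_integral)
  have "((\<lambda>s. m s * outer_normal a b (\<eta> s)) has_integral (integral {r..q} v - (\<eta> q - \<eta> r))) {r..q}"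
    if r: "0 \<le> r" "r \<le> q" "q \<le> t" for r q
  proof -
    have ac': "abs_continuous_on_interval r q \<eta>"
      using ac r unfolding abs_continuous_on_interval_def by (meson order_trans)
    have g: "((\<lambda>s. v s - m s * outer_normal a b (\<eta> s)) has_integral (\<eta> q - \<eta> r)) {r..q}"
    proof (rule AC_fundamental_theorem[OF ac' r(2) N])
      fix s assume s: "r \<le> s" "s \<le> q" "s \<notin> N"
      then have "s > 0" "s \<notin> N0" using r by (auto simp: N_def)
      then obtain d where d: "(\<eta> has_real_derivative d) (at s)" "d + l s * outer_normal a b (\<eta> s) = v s"
        using N0(2)[of s, unfolded G_def] by blast
      have "m s = l s" using s \<open>s > 0\<close> by (simp add: m_def)
      then have "d = v s - m s * outer_normal a b (\<eta> s)" using d(2) by simp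
      then show "(\<eta> has_real_derivative v s - m s * outer_normal a b (\<eta> s)) (at s)"
        using d(1) by simp
    qed
    have "(v has_integral integral {r..q} v) {r..q}"
      using integrable_on_subinterval[OF vint, of r q] r by (simp add: integrable_integral)
    from has_integral_diff[OF this g] show ?thesis by simp
  qed
  then show ?thesis using that[of m] v m m0 AC_imp_continuous[OF ac] \<eta> by blast
qed

lemma sum_integral_pieces:
  fixes f :: "real \<Rightarrow> real"
  assumes f: "f integrable_on {0..real N * \<delta>}" and \<delta>: "0 \<le> \<delta>"
  shows "(\<Sum>k<N. integral {real k * \<delta>..(real k + 1) * \<delta>} f) = integral {0..real N * \<delta>} f"
  using f
proof (induction N)
  case (Suc N)
  have le: "0 \<le> real N * \<delta>" "real N * \<delta> \<le> real (Suc N) * \<delta>" using \<delta> by (auto simp: algebra_simps)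
  have "f integrable_on {0..real N * \<delta>}"
    by (rule integrable_on_subinterval[OF Suc.prems]) (use le in auto)
  then show ?case
    using Suc.IH Henstock_Kurzweil_Integration.integral_combine[OF le Suc.prems] by (simp add: add.commute)
qed simp

section \<open>Paths with finitely many linear pieces\<close>

text \<open>The data of the variational problem: a nondegenerate segment with its two intensities.\<close>

locale reflected_segment =
  fixes a b c0 C1 :: real and \<phi>p \<phi>m :: "real \<Rightarrow> real"
  assumes ab: "a < b" and c0: "0 < c0"
    and \<phi>: "\<And>y. y \<in> {a..b} \<Longrightarrow> c0 \<le> \<phi>p y \<and> \<phi>p y \<le> C1 \<and> c0 \<le> \<phi>m y \<and> \<phi>m y \<le> C1"
    and cont: "continuous_on {a..b} \<phi>p" "continuous_on {a..b} \<phi>m"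
begin

abbreviation "L \<equiv> lagrangian \<phi>p \<phi>m"
abbreviation "H \<equiv> hamiltonian \<phi>p \<phi>m"

lemma \<phi>_pos: "y \<in> {a..b} \<Longrightarrow> 0 < \<phi>p y \<and> 0 < \<phi>m y"
  using \<phi>[of y] c0 by auto

lemma C1: "c0 \<le> C1" "0 < C1"
  using \<phi>[of a] ab c0 by auto

lemma hamiltonian_le:
  assumes "y \<in> {a..b}" "\<bar>q\<bar> \<le> K"
  shows "H y q \<le> 2 * C1 * exp K"
proof -
  have *: "A * (exp x - 1) \<le> C1 * exp K" if "0 < A" "A \<le> C1" "x \<le> K" for A x
  proof -
    have "A * (exp x - 1) \<le> A * exp x" using that by simp
    also have "\<dots> \<le> C1 * exp K" using that by (intro mult_mono) auto
    finally show ?thesis .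
  qed
  have "\<phi>p y * (exp q - 1) \<le> C1 * exp K" "\<phi>m y * (exp (-q) - 1) \<le> C1 * exp K"
    using assms(2) \<phi>[OF assms(1)] \<phi>_pos[OF assms(1)] by (auto intro!: *)
  then show ?thesis by (simp add: hamiltonian_def)
qed

lemma lagrangian_superlinear:
  assumes "y \<in> {a..b}" "L y v \<le> ereal \<rho>" "0 \<le> K"
  shows "K * \<bar>v\<bar> - \<rho> \<le> 2 * C1 * exp K"
proof -
  define q where "q = K * sgn v"
  have q: "q * v = K * \<bar>v\<bar>" "\<bar>q\<bar> \<le> K"
    using assms(3) by (auto simp: q_def sgn_if)
  have "ereal (q * v - H y q) \<le> ereal \<rho>"
    using lagrangian_ge[of q v \<phi>p \<phi>m y] assms(2) by (rule order_trans)
  then show ?thesis using hamiltonian_le[OF assms(1) q(2)] q(1) by simp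
qed

lemma lagrangian_bounded:
  assumes "y \<in> {a..b}" "\<bar>v\<bar> \<le> R"
  shows "L y v \<le> ereal (2 * ((R + 1)\<^sup>2 / c0 + C1))"
proof -
  define \<mu>p \<mu>m where "\<mu>p = max v 0 + 1" and "\<mu>m = max (-v) 0 + 1"
  have \<mu>: "0 < \<mu>p" "0 < \<mu>m" "\<mu>p \<le> R + 1" "\<mu>m \<le> R + 1" "\<mu>p - \<mu>m = v"
    using assms(2) by (auto simp: \<mu>p_def \<mu>m_def)
  have "tilt_cost \<mu> f \<le> (R + 1)\<^sup>2 / c0 + C1" if "0 < \<mu>" "\<mu> \<le> R + 1" "c0 \<le> f" "f \<le> C1" for \<mu> f
  proof -
    have "tilt_cost \<mu> f \<le> \<mu>\<^sup>2 / f + f" using that c0 by (intro tilt_cost_le) auto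
    also have "\<mu>\<^sup>2 / f \<le> (R + 1)\<^sup>2 / c0"
      using that c0 by (intro frac_le power_mono) auto
    finally show ?thesis using that by simp
  qed
  from this[of \<mu>p "\<phi>p y"] this[of \<mu>m "\<phi>m y"] \<mu> \<phi>[OF assms(1)]
  have "tilt_cost \<mu>p (\<phi>p y) + tilt_cost \<mu>m (\<phi>m y) \<le> 2 * ((R + 1)\<^sup>2 / c0 + C1)" by simp
  then show ?thesis
    using lagrangian_le_tilt_cost[OF \<mu>(1,2) _ _ \<mu>(5), of \<phi>p y \<phi>m] \<phi>_pos[OF assms(1)]
    by (auto intro: order_trans)
qed

text \<open>Speeding a path up by the factor \<open>\<theta>\<close> multiplies both jump rates by \<open>\<theta>\<close>, which costs little more than
the factor \<open>\<theta>\<close> itself. This is what makes compression in time cheap.\<close>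

lemma lagrangian_scale:
  assumes y: "y \<in> {a..b}" and le: "L y v \<le> ereal \<rho>" and \<theta>: "1 \<le> \<theta>"
  shows "L y (\<theta> * v) \<le> ereal (\<theta> * (\<rho> + ln \<theta> * (2 * \<rho> + 4 * C1 * exp 1 + 4 * C1)))"
proof -
  have pos: "0 < \<phi>p y" "0 < \<phi>m y" using \<phi>_pos[OF y] by auto
  obtain p where p: "\<phi>p y * exp p - \<phi>m y * exp (-p) = v"
      "\<phi>p y * exp p + \<phi>m y * exp (-p) \<le> \<bar>v\<bar> + \<phi>p y + \<phi>m y"
    using optimal_tilt[OF pos] .
  define \<mu>p \<mu>m where "\<mu>p = \<phi>p y * exp p" and "\<mu>m = \<phi>m y * exp (-p)"
  have \<mu>: "0 < \<mu>p" "0 < \<mu>m" "\<mu>p - \<mu>m = v" using pos p by (auto simp: \<mu>p_def \<mu>m_def)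
  have sum: "tilt_cost \<mu>p (\<phi>p y) + tilt_cost \<mu>m (\<phi>m y) \<le> \<rho>"
    using lagrangian_eq[of \<phi>p y \<phi>m p v, OF pos p(1)] le by (simp add: \<mu>p_def \<mu>m_def)
  have v: "\<bar>v\<bar> \<le> \<rho> + 2 * C1 * exp 1"
    using lagrangian_superlinear[OF y le, of 1] by simp
  have l0: "0 \<le> \<rho>" using order_trans[OF lagrangian_nonneg le] by simp
  have m: "\<mu>p + \<mu>m \<le> \<rho> + 2 * C1 * exp 1 + 2 * C1"
    using p(2) v \<phi>[OF y] by (simp add: \<mu>p_def \<mu>m_def)
  have "L y (\<theta> * v) \<le> ereal (tilt_cost (\<theta> * \<mu>p) (\<phi>p y) + tilt_cost (\<theta> * \<mu>m) (\<phi>m y))"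
    using \<mu> \<theta> pos by (intro lagrangian_le_tilt_cost) (auto simp flip: right_diff_distrib)
  also have "\<dots> \<le> ereal (\<theta> * (tilt_cost \<mu>p (\<phi>p y) + tilt_cost \<mu>m (\<phi>m y)) + \<theta> * ln \<theta> * (\<mu>p + \<mu>m))"
    using tilt_cost_scale[OF \<mu>(1) pos(1) \<theta>] tilt_cost_scale[OF \<mu>(2) pos(2) \<theta>]
    by (simp add: algebra_simps)
  also have "\<dots> \<le> ereal (\<theta> * \<rho> + \<theta> * ln \<theta> * (2 * \<rho> + 4 * C1 * exp 1 + 4 * C1))"
  proof -
    have "\<mu>p + \<mu>m \<le> 2 * \<rho> + 4 * C1 * exp 1 + 4 * C1"
    proof -
      have "0 \<le> C1 * exp 1" using C1 by simp
      then show ?thesis using m l0 C1 by linarith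
    qed
    then have "\<theta> * ln \<theta> * (\<mu>p + \<mu>m) \<le> \<theta> * ln \<theta> * (2 * \<rho> + 4 * C1 * exp 1 + 4 * C1)"
      using \<theta> by (intro mult_left_mono) auto
    moreover have "\<theta> * (tilt_cost \<mu>p (\<phi>p y) + tilt_cost \<mu>m (\<phi>m y)) \<le> \<theta> * \<rho>"
      using sum \<theta> by (intro mult_left_mono) auto
    ultimately show ?thesis by simp
  qed
  finally show ?thesis by (simp add: algebra_simps)
qed

text \<open>\<open>reach s y z c\<close> states that some reflected path made of finitely many pieces leads from \<open>y\<close> to \<open>z\<close> in
time \<open>s\<close> with action at most \<open>c\<close>. A piece either moves with constant velocity or is pushed against an
end point, where any outward control is admissible and the path rests. Pieces are added in front,
which suits the dynamic programming principle.\<close>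

inductive reach :: "real \<Rightarrow> real \<Rightarrow> real \<Rightarrow> real \<Rightarrow> bool" where
  stop: "y \<in> {a..b} \<Longrightarrow> reach 0 y y 0"
| run: "0 \<le> \<delta> \<Longrightarrow> y \<in> {a..b} \<Longrightarrow> y + \<delta> * v \<in> {a..b} \<Longrightarrow>
    (\<And>\<tau>. 0 \<le> \<tau> \<Longrightarrow> \<tau> \<le> \<delta> \<Longrightarrow> L (y + \<tau> * v) v \<le> ereal \<rho>) \<Longrightarrow>
    reach s (y + \<delta> * v) z c \<Longrightarrow> reach (\<delta> + s) y z (\<delta> * \<rho> + c)"
| push: "0 \<le> \<delta> \<Longrightarrow> y \<in> {a, b} \<Longrightarrow> 0 \<le> v * outer_normal a b y \<Longrightarrow> L y v \<le> ereal \<rho> \<Longrightarrow>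
    reach s y z c \<Longrightarrow> reach (\<delta> + s) y z (\<delta> * \<rho> + c)"

lemma run_between:
  assumes "y \<in> {a..b}" "y + \<delta> * v \<in> {a..b}" "0 \<le> \<tau>" "\<tau> \<le> \<delta>"
  shows "y + \<tau> * v \<in> {a..b}"
proof (cases "v \<ge> 0")
  case True
  then have "0 \<le> \<tau> * v" "\<tau> * v \<le> \<delta> * v" using assms by (auto intro: mult_right_mono)
  then show ?thesis using assms by auto
next
  case False
  then have "\<tau> * v \<le> 0" "\<delta> * v \<le> \<tau> * v" using assms by (auto intro: mult_right_mono_neg mult_nonneg_nonpos)
  then show ?thesis using assms by auto
qed

lemma ereal_lagrangian_nonneg: "L y v \<le> ereal \<rho> \<Longrightarrow> 0 \<le> \<rho>"
  using order_trans[OF lagrangian_nonneg[of \<phi>p \<phi>m y v], of "ereal \<rho>"] by simp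

lemma reach_bounds: "reach s y z c \<Longrightarrow> 0 \<le> s \<and> 0 \<le> c \<and> y \<in> {a..b} \<and> z \<in> {a..b}"
proof (induction rule: reach.induct)
  case (run \<delta> y v \<rho> s z c)
  then have "0 \<le> \<rho>" using ereal_lagrangian_nonneg[of y v \<rho>] run(4)[of 0] by simp
  then show ?case using run by auto
next
  case (push \<delta> y v \<rho> s z c)
  then show ?case using ab ereal_lagrangian_nonneg[OF push(4)] by auto
qed auto

lemma reach_trans: "reach s x y c \<Longrightarrow> reach t y z d \<Longrightarrow> reach (s + t) x z (c + d)"
proof (induction rule: reach.induct)
  case (run \<delta> y v \<rho> s z' c)
  then show ?case using reach.run[of \<delta> y v \<rho> "s + t" z "c + d"] by (simp add: add.assoc)
next
  case (push \<delta> y v \<rho> s z' c)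
  then show ?case using reach.push[of \<delta> y v \<rho> "s + t" z "c + d"] by (simp add: add.assoc)
qed auto

text \<open>A bound for the Lagrangian at all velocities up to \<open>R\<close>.\<close>

definition speed_cost :: "real \<Rightarrow> real" where
  "speed_cost R = 2 * ((R + 1)\<^sup>2 / c0 + C1)"

lemma speed_cost_nonneg: "0 \<le> speed_cost R"
  using c0 C1 by (simp add: speed_cost_def)

lemma reach_straight:
  assumes "0 \<le> s" "y \<in> {a..b}" "z \<in> {a..b}" "\<bar>z - y\<bar> \<le> R * s"
  shows "reach s y z (s * speed_cost R)"
proof (cases "s = 0")
  case True
  then show ?thesis using assms stop[of y] by simp
next
  case False
  define v where "v = (z - y) / s"
  have z: "y + s * v = z" using False by (simp add: v_def)
  have "\<bar>v\<bar> = \<bar>z - y\<bar> / s" using assms(1) by (simp add: v_def abs_div)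
  then have v: "\<bar>v\<bar> \<le> R" using assms False by (simp add: divide_le_eq)
  have "reach (s + 0) y z (s * speed_cost R + 0)"
    using assms z stop[of z] run_between[of y s v] lagrangian_bounded[OF _ v]
    by (intro run[where v = v]) (auto simp: speed_cost_def)
  then show ?thesis by simp
qed

text \<open>Superlinear growth of the Lagrangian: the gain \<open>K |v|\<close> of a \<open>K\<close>-Lipschitz function along a path
exceeds the running cost by at most a constant.\<close>

lemma reach_drop_all:
  assumes f: "\<And>x y. \<bar>f x - f y\<bar> \<le> K * \<bar>x - y\<bar>" and K: "0 \<le> K"
  shows "reach s y z c \<Longrightarrow> f z - c \<le> f y + 2 * C1 * exp K * s"
proof (induction rule: reach.induct)
  case (run \<delta> y v \<rho> s z c)
  have "f (y + \<delta> * v) - f y \<le> K * \<bar>\<delta> * v\<bar>" using f[of "y + \<delta> * v" y] by simp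
  also have "\<dots> = \<delta> * (K * \<bar>v\<bar>)" using run(1) by (simp add: abs_mult)
  also have "\<dots> \<le> \<delta> * (\<rho> + 2 * C1 * exp K)"
    using run(1) lagrangian_superlinear[OF run(2) _ K, of v \<rho>] run(4)[of 0]
    by (intro mult_left_mono) auto
  finally show ?case using run.IH by (simp add: algebra_simps)
next
  case (push \<delta> y v \<rho> s z c)
  then have "0 \<le> \<delta> * \<rho>" "0 \<le> 2 * C1 * exp K * \<delta>" using ereal_lagrangian_nonneg C1 by auto
  then show ?case using push by (simp add: algebra_simps)
qed auto

lemma reach_truncate:
  assumes f: "\<And>x y. \<bar>f x - f y\<bar> \<le> K * \<bar>x - y\<bar>" and K: "0 \<le> K"
  shows "reach s y z c \<Longrightarrow> 0 \<le> \<tau> \<Longrightarrow> \<tau> \<le> s \<Longrightarrow>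
    \<exists>z' c'. reach (s - \<tau>) y z' c' \<and> f z - c \<le> f z' - c' + 2 * C1 * exp K * \<tau>"
proof (induction arbitrary: \<tau> rule: reach.induct)
  case (stop y)
  then show ?case using reach.stop[of y] by (intro exI[of _ y] exI[of _ 0]) auto
next
  case (run \<delta> y v \<rho> s z c)
  show ?case
  proof (cases "\<tau> \<le> s")
    case True
    then obtain z' c' where "reach (s - \<tau>) (y + \<delta> * v) z' c'"
        "f z - c \<le> f z' - c' + 2 * C1 * exp K * \<tau>"
      using run.IH run.prems by blast
    then show ?thesis
      using reach.run[OF run(1-4), of "s - \<tau>" z' c'] by (intro exI[of _ z'] exI[of _ "\<delta> * \<rho> + c'"]) (auto simp: algebra_simps)
  next
    case False
    define d where "d = \<delta> + s - \<tau>"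
    have s: "0 \<le> s" using reach_bounds[OF run(5)] by simp
    have d: "0 \<le> d" "d \<le> \<delta>" using False run.prems by (auto simp: d_def)
    have l: "K * \<bar>v\<bar> \<le> \<rho> + 2 * C1 * exp K"
      using lagrangian_superlinear[OF run(2) _ K, of v \<rho>] run(4)[of 0] run(1) by simp
    have "reach (d + 0) y (y + d * v) (d * \<rho> + 0)"
      using run d run_between[of y \<delta> v d] by (intro reach.run) (auto intro: reach.stop)
    moreover have "f z - (\<delta> * \<rho> + c) \<le> f (y + d * v) - d * \<rho> + 2 * C1 * exp K * \<tau>"
    proof -
      have "f z - c \<le> f (y + \<delta> * v) + 2 * C1 * exp K * s"
        by (rule reach_drop_all[OF f K run(5)])
      moreover have "f (y + \<delta> * v) - f (y + d * v) \<le> K * \<bar>(\<delta> - d) * v\<bar>"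
        using f[of "y + \<delta> * v" "y + d * v"] by (simp add: algebra_simps)
      moreover have "K * \<bar>(\<delta> - d) * v\<bar> = (\<delta> - d) * (K * \<bar>v\<bar>)" using d by (simp add: abs_mult)
      moreover have "(\<delta> - d) * (K * \<bar>v\<bar>) \<le> (\<delta> - d) * (\<rho> + 2 * C1 * exp K)"
        using d l by (intro mult_left_mono) auto
      moreover have "(\<delta> - d) * (\<rho> + 2 * C1 * exp K) + 2 * C1 * exp K * s = (\<delta> - d) * \<rho> + 2 * C1 * exp K * \<tau>"
        by (simp add: d_def algebra_simps)
      ultimately show ?thesis by (simp add: algebra_simps)
    qed
    ultimately show ?thesis
      by (intro exI[of _ "y + d * v"] exI[of _ "d * \<rho>"]) (simp add: d_def algebra_simps)
  qed
next
  case (push \<delta> y v \<rho> s z c)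
  show ?case
  proof (cases "\<tau> \<le> s")
    case True
    then obtain z' c' where "reach (s - \<tau>) y z' c'"
        "f z - c \<le> f z' - c' + 2 * C1 * exp K * \<tau>"
      using push.IH push.prems by blast
    then show ?thesis
      using reach.push[OF push(1-4), of "s - \<tau>" z' c'] by (intro exI[of _ z'] exI[of _ "\<delta> * \<rho> + c'"]) (auto simp: algebra_simps)
  next
    case False
    define d where "d = \<delta> + s - \<tau>"
    have d: "0 \<le> d" "d \<le> \<delta>" using False push.prems by (auto simp: d_def)
    have "reach (d + 0) y y (d * \<rho> + 0)"
      using push d ab by (intro reach.push) (auto intro: reach.stop)
    moreover have "f z - c \<le> f y + 2 * C1 * exp K * s" by (rule reach_drop_all[OF f K push(5)])
    moreover have "2 * C1 * exp K * s \<le> 2 * C1 * exp K * \<tau>" using False C1 by (intro mult_left_mono) auto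
    moreover have "d * \<rho> \<le> \<delta> * \<rho>" using d ereal_lagrangian_nonneg[OF push(4)] by (intro mult_right_mono)
    ultimately show ?thesis
      by (intro exI[of _ y] exI[of _ "d * \<rho>"]) (simp add: d_def algebra_simps)
  qed
qed

text \<open>The path is run \<open>\<theta>\<close> times faster; the time saved can be spent on another leg.\<close>

lemma reach_compress:
  assumes \<theta>: "1 \<le> \<theta>"
  defines "W \<equiv> 4 * C1 * exp 1 + 4 * C1"
  shows "reach s y z c \<Longrightarrow> reach (s / \<theta>) y z (c + ln \<theta> * (2 * c + W * s))"
proof -
  have eq2: "\<delta> / \<theta> + s / \<theta> = (\<delta> + s) / \<theta>"
      "\<delta> / \<theta> * (\<theta> * (\<rho> + ln \<theta> * (2 * \<rho> + 4 * C1 * exp 1 + 4 * C1))) + (c + ln \<theta> * (2 * c + W * s))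
       = \<delta> * \<rho> + c + ln \<theta> * (2 * (\<delta> * \<rho> + c) + W * (\<delta> + s))" for \<delta> s \<rho> c
  proof -
    have cancel: "\<delta> / \<theta> * (\<theta> * X) = \<delta> * X" for X using \<theta> by simp
    show "\<delta> / \<theta> * (\<theta> * (\<rho> + ln \<theta> * (2 * \<rho> + 4 * C1 * exp 1 + 4 * C1))) + (c + ln \<theta> * (2 * c + W * s))
       = \<delta> * \<rho> + c + ln \<theta> * (2 * (\<delta> * \<rho> + c) + W * (\<delta> + s))"
      unfolding cancel by (simp add: W_def algebra_simps)
  qed (simp add: add_divide_distrib)
  show "reach s y z c \<Longrightarrow> reach (s / \<theta>) y z (c + ln \<theta> * (2 * c + W * s))"
proof (induction rule: reach.induct)
  case (stop y)
  then show ?case using reach.stop[of y] by simp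
next
  case (run \<delta> y v \<rho> s z c)
  have eq: "y + \<delta> / \<theta> * (\<theta> * v) = y + \<delta> * v" using \<theta> by simp
  have "reach (\<delta> / \<theta> + s / \<theta>) y z (\<delta> / \<theta> * (\<theta> * (\<rho> + ln \<theta> * (2 * \<rho> + 4 * C1 * exp 1 + 4 * C1)))
      + (c + ln \<theta> * (2 * c + W * s)))"
  proof (rule reach.run[where v = "\<theta> * v"])
    fix \<tau> assume \<tau>: "0 \<le> \<tau>" "\<tau> \<le> \<delta> / \<theta>"
    then have \<tau>': "0 \<le> \<tau> * \<theta>" "\<tau> * \<theta> \<le> \<delta>" using \<theta> by (auto simp: field_simps)
    have "L (y + (\<tau> * \<theta>) * v) (\<theta> * v) \<le> ereal (\<theta> * (\<rho> + ln \<theta> * (2 * \<rho> + 4 * C1 * exp 1 + 4 * C1)))"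
      by (rule lagrangian_scale[OF run_between[OF run(2,3) \<tau>'] run(4)[OF \<tau>'] \<theta>])
    then show "L (y + \<tau> * (\<theta> * v)) (\<theta> * v) \<le> ereal (\<theta> * (\<rho> + ln \<theta> * (2 * \<rho> + 4 * C1 * exp 1 + 4 * C1)))"
      by (simp add: mult.assoc)
  qed (use run \<theta> eq in auto)
  then show ?case unfolding eq2 .
next
  case (push \<delta> y v \<rho> s z c)
  have y: "y \<in> {a..b}" using push(2) ab by auto
  have "0 \<le> \<theta> * (v * outer_normal a b y)" using mult_nonneg_nonneg[OF _ push(3), of \<theta>] \<theta> by simp
  then have "0 \<le> \<theta> * v * outer_normal a b y" by (simp add: mult.assoc)
  from reach.push[OF _ push(2) this lagrangian_scale[OF y push(4) \<theta>] push.IH, of "\<delta> / \<theta>"] push(1) \<theta>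
  have "reach (\<delta> / \<theta> + s / \<theta>) y z (\<delta> / \<theta> * (\<theta> * (\<rho> + ln \<theta> * (2 * \<rho> + 4 * C1 * exp 1 + 4 * C1)))
      + (c + ln \<theta> * (2 * c + W * s)))" by simp
  then show ?case unfolding eq2 .
qed
qed

end

context reflected_segment begin

text \<open>The induction hypothesis for turning \<open>reach\<close> into a reflected path. It is stronger than membership in
\<open>SP\<close>: Lipschitz paths, bounded Borel controls and finite exceptional sets \<open>N\<close> are all stable under
adding a piece in front, and so is the explicit bound \<open>\<rho>\<close> of the running cost with integral \<open>c\<close>.\<close>

definition path_witness :: "real \<Rightarrow> real \<Rightarrow> real \<Rightarrow> real \<Rightarrow> (real \<Rightarrow> real) \<Rightarrow> (real \<Rightarrow> real) \<Rightarrow> (real \<Rightarrow> real) \<Rightarrow>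
    (real \<Rightarrow> real) \<Rightarrow> real set \<Rightarrow> real \<Rightarrow> bool" where
  "path_witness s y z c \<eta> v l \<rho> N B \<longleftrightarrow>
     \<eta> 0 = y \<and> \<eta> s = z \<and> (\<forall>r\<ge>0. \<eta> r \<in> {a..b}) \<and> 0 \<le> B \<and>
     (\<forall>r q. 0 \<le> r \<longrightarrow> r \<le> q \<longrightarrow> \<bar>\<eta> q - \<eta> r\<bar> \<le> B * (q - r)) \<and>
     v \<in> borel_measurable borel \<and> l \<in> borel_measurable borel \<and>
     (\<forall>r. \<bar>v r\<bar> \<le> B \<and> 0 \<le> l r \<and> l r \<le> B \<and> 0 \<le> \<rho> r) \<and> finite N \<and>
     (\<forall>r>0. r \<notin> N \<longrightarrow> (\<exists>d. (\<eta> has_real_derivative d) (at r) \<and> d + l r * outer_normal a b (\<eta> r) = v r) \<and>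
        (\<eta> r \<in> {a<..<b} \<longrightarrow> l r = 0) \<and> (r < s \<longrightarrow> L (\<eta> r) (v r) \<le> ereal (\<rho> r))) \<and>
     (\<rho> has_integral c) {0..s}"

lemma path_witness_prepend:
  assumes W: "path_witness s y' z c \<eta> v l \<rho> N B" and s: "0 \<le> s"
    and \<delta>: "0 \<le> \<delta>" and y': "y + \<delta> * e = y'" and inside: "\<And>r. 0 \<le> r \<Longrightarrow> r \<le> \<delta> \<Longrightarrow> y + r * e \<in> {a..b}"
    and lc: "0 \<le> lc" "\<And>r. 0 < r \<Longrightarrow> r < \<delta> \<Longrightarrow> e + lc * outer_normal a b (y + r * e) = vc"
       "\<And>r. 0 < r \<Longrightarrow> r < \<delta> \<Longrightarrow> y + r * e \<in> {a<..<b} \<Longrightarrow> lc = 0"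
    and \<rho>c: "0 \<le> \<rho>c" "\<And>r. 0 < r \<Longrightarrow> r < \<delta> \<Longrightarrow> L (y + r * e) vc \<le> ereal \<rho>c"
  shows "path_witness (\<delta> + s) y z (\<delta> * \<rho>c + c)
     (\<lambda>r. if r < \<delta> then y + r * e else \<eta> (r - \<delta>)) (\<lambda>r. if r < \<delta> then vc else v (r - \<delta>))
     (\<lambda>r. if r < \<delta> then lc else l (r - \<delta>)) (\<lambda>r. if r < \<delta> then \<rho>c else \<rho> (r - \<delta>))
     (insert \<delta> ((\<lambda>r. r + \<delta>) ` N)) (B + \<bar>e\<bar> + \<bar>vc\<bar> + lc)"
    (is "path_witness _ _ _ _ ?\<eta> ?v ?l ?\<rho> ?N ?B")
proof -
  note W' = W[unfolded path_witness_def]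
  have B: "0 \<le> B" and e0: "\<eta> 0 = y'" and es: "\<eta> s = z" and er: "\<And>r. 0 \<le> r \<Longrightarrow> \<eta> r \<in> {a..b}"
    and lip: "\<And>r q. 0 \<le> r \<Longrightarrow> r \<le> q \<Longrightarrow> \<bar>\<eta> q - \<eta> r\<bar> \<le> B * (q - r)"
    and meas[measurable]: "v \<in> borel_measurable borel" "l \<in> borel_measurable borel"
    and bd: "\<And>r. \<bar>v r\<bar> \<le> B \<and> 0 \<le> l r \<and> l r \<le> B \<and> 0 \<le> \<rho> r" and fin: "finite N"
    and der: "\<And>r. r > 0 \<Longrightarrow> r \<notin> N \<Longrightarrow> (\<exists>d. (\<eta> has_real_derivative d) (at r) \<and> d + l r * outer_normal a b (\<eta> r) = v r) \<and>
        (\<eta> r \<in> {a<..<b} \<longrightarrow> l r = 0) \<and> (r < s \<longrightarrow> L (\<eta> r) (v r) \<le> ereal (\<rho> r))"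
    and int: "(\<rho> has_integral c) {0..s}"
    using W' by blast+
  have B': "B \<le> ?B" "\<bar>e\<bar> \<le> ?B" using B lc(1) by auto
  have lip': "\<bar>?\<eta> q - ?\<eta> r\<bar> \<le> ?B * (q - r)" if rq: "0 \<le> r" "r \<le> q" for r q
  proof -
    have e_le: "\<bar>e\<bar> * x \<le> ?B * x" if "0 \<le> x" for x using B' that by (intro mult_right_mono) auto
    have B_le: "B * x \<le> ?B * x" if "0 \<le> x" for x using B' that by (intro mult_right_mono) auto
    consider "q < \<delta>" | "r < \<delta>" "\<delta> \<le> q" | "\<delta> \<le> r" by linarith
    then show ?thesis
    proof cases
      case 1
      have "?\<eta> q - ?\<eta> r = e * (q - r)" using 1 rq by (simp add: algebra_simps)
      then have "\<bar>?\<eta> q - ?\<eta> r\<bar> = \<bar>e\<bar> * (q - r)" using rq by (simp add: abs_mult)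
      then show ?thesis using e_le[of "q - r"] rq by simp
    next
      case 2
      have "?\<eta> q - ?\<eta> r = (\<eta> (q - \<delta>) - \<eta> 0) + e * (\<delta> - r)"
        using 2 by (simp add: e0 y'[symmetric] algebra_simps)
      also have "\<bar>\<dots>\<bar> \<le> \<bar>\<eta> (q - \<delta>) - \<eta> 0\<bar> + \<bar>e * (\<delta> - r)\<bar>" by (rule abs_triangle_ineq)
      also have "\<dots> \<le> B * (q - \<delta>) + \<bar>e\<bar> * (\<delta> - r)"
        using lip[of 0 "q - \<delta>"] 2 by (simp add: abs_mult)
      also have "\<dots> \<le> ?B * (q - \<delta>) + ?B * (\<delta> - r)" using e_le[of "\<delta> - r"] B_le[of "q - \<delta>"] 2 by linarith
      finally show ?thesis by (simp add: algebra_simps)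
    next
      case 3
      then have "\<bar>?\<eta> q - ?\<eta> r\<bar> \<le> B * (q - r)" using lip[of "r - \<delta>" "q - \<delta>"] rq by simp
      then show ?thesis using B_le[of "q - r"] rq by linarith
    qed
  qed
  have der': "(\<exists>d. (?\<eta> has_real_derivative d) (at r) \<and> d + ?l r * outer_normal a b (?\<eta> r) = ?v r) \<and>
        (?\<eta> r \<in> {a<..<b} \<longrightarrow> ?l r = 0) \<and> (r < \<delta> + s \<longrightarrow> L (?\<eta> r) (?v r) \<le> ereal (?\<rho> r))"
    if r: "0 < r" "r \<notin> ?N" for r
  proof (cases "r < \<delta>")
    case True
    have "((\<lambda>r. y + r * e) has_real_derivative e) (at r)" by (auto intro!: derivative_eq_intros)
    then have "(?\<eta> has_real_derivative e) (at r)"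
      by (rule has_field_derivative_transform_within_open[of _ _ _ "{..<\<delta>}"]) (use True in auto)
    then show ?thesis using lc(2,3)[OF r(1) True] \<rho>c(2)[OF r(1) True] True by auto
  next
    case False
    then have r': "\<delta> < r" "r - \<delta> \<notin> N" using r by (auto simp: image_iff)
    obtain d where d: "(\<eta> has_real_derivative d) (at (r - \<delta>))"
        "d + l (r - \<delta>) * outer_normal a b (\<eta> (r - \<delta>)) = v (r - \<delta>)"
      using der[of "r - \<delta>"] r' by auto
    have "((\<lambda>r. \<eta> (r - \<delta>)) has_real_derivative d) (at r)"
      using DERIV_shift[of \<eta> d r "- \<delta>"] d(1) by simp
    then have "(?\<eta> has_real_derivative d) (at r)"
      by (rule has_field_derivative_transform_within_open[of _ _ _ "{\<delta><..}"]) (use r' in auto)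
    then show ?thesis using der[of "r - \<delta>"] r' d(2) by auto
  qed
  have int': "(?\<rho> has_integral (\<delta> * \<rho>c + c)) {0..\<delta> + s}"
  proof (rule has_integral_combine[of 0 \<delta>])
    have "((\<lambda>r. \<rho>c) has_integral (\<delta> * \<rho>c)) {0..\<delta>}"
      using has_integral_const_real[of \<rho>c 0 \<delta>] \<delta> by simp
    then show "(?\<rho> has_integral (\<delta> * \<rho>c)) {0..\<delta>}"
      by (rule has_integral_spike_finite[of "{\<delta>}", rotated 2]) auto
    have "((\<lambda>r. \<rho> (r - \<delta>)) has_integral c) {\<delta>..\<delta> + s}"
      using has_integral_shift_real_ivl[OF int, of "- \<delta>"] by (simp add: add.commute)
    then show "(?\<rho> has_integral c) {\<delta>..\<delta> + s}"
      by (rule has_integral_eq[rotated]) auto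
  qed (use \<delta> s in auto)
  have r': "?\<eta> r \<in> {a..b}" if "0 \<le> r" for r
    using inside[of r] er[of "r - \<delta>"] that by auto
  have bd': "\<bar>?v r\<bar> \<le> ?B \<and> 0 \<le> ?l r \<and> ?l r \<le> ?B \<and> 0 \<le> ?\<rho> r" for r
    using bd[of "r - \<delta>"] lc(1) \<rho>c(1) B by auto
  have e0': "?\<eta> 0 = y" "?\<eta> (\<delta> + s) = z" using \<delta> s y' e0 es by auto
  have m': "?v \<in> borel_measurable borel" "?l \<in> borel_measurable borel" by measurable
  have all: "\<forall>r\<ge>0. ?\<eta> r \<in> {a..b}" "\<forall>r q. 0 \<le> r \<longrightarrow> r \<le> q \<longrightarrow> \<bar>?\<eta> q - ?\<eta> r\<bar> \<le> ?B * (q - r)"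
      "\<forall>r. \<bar>?v r\<bar> \<le> ?B \<and> 0 \<le> ?l r \<and> ?l r \<le> ?B \<and> 0 \<le> ?\<rho> r"
      "\<forall>r>0. r \<notin> ?N \<longrightarrow> (\<exists>d. (?\<eta> has_real_derivative d) (at r) \<and> d + ?l r * outer_normal a b (?\<eta> r) = ?v r) \<and>
        (?\<eta> r \<in> {a<..<b} \<longrightarrow> ?l r = 0) \<and> (r < \<delta> + s \<longrightarrow> L (?\<eta> r) (?v r) \<le> ereal (?\<rho> r))"
    using r' lip' bd' der' by blast+
  have B0: "0 \<le> ?B" "finite ?N" using B lc(1) fin by auto
  show ?thesis
    unfolding path_witness_def by (intro conjI) (fact e0' all B0 m' int')+
qed

lemma reach_imp_path:
  "reach s y z c \<Longrightarrow> \<exists>\<eta> v l \<rho> N B. path_witness s y z c \<eta> v l \<rho> N B"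
proof (induction rule: reach.induct)
  case (stop y)
  then have "path_witness 0 y y 0 (\<lambda>_. y) (\<lambda>_. 0) (\<lambda>_. 0) (\<lambda>_. 0) {0} 0"
    unfolding path_witness_def by (auto intro!: exI[of _ 0] derivative_eq_intros)
  then show ?case by blast
next
  case (run \<delta> y v \<rho> s z c)
  then obtain \<eta> v' l \<rho>' N B where W: "path_witness s (y + \<delta> * v) z c \<eta> v' l \<rho>' N B" by blast
  have r: "0 \<le> \<rho>" using ereal_lagrangian_nonneg[of y v \<rho>] run(1) run(4)[of 0] by simp
  from path_witness_prepend[OF W _ run(1) refl, where lc = 0 and vc = v and \<rho>c = \<rho>]
  show ?case using r run reach_bounds[OF run(5)] run_between[OF run(2,3)] by (simp, blast)
next
  case (push \<delta> y v \<rho> s z c)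
  then obtain \<eta> v' l \<rho>' N B where W: "path_witness s y z c \<eta> v' l \<rho>' N B" by blast
  have r: "0 \<le> \<rho>" using ereal_lagrangian_nonneg push(4) .
  have y: "v * outer_normal a b y * outer_normal a b y = v" "a \<le> y" "y \<le> b" "\<not> (a < y \<and> y < b)"
    using push(2) ab by (auto simp: outer_normal_def)
  from path_witness_prepend[OF W _ push(1), where y = y and e = 0 and lc = "v * outer_normal a b y" and vc = v and \<rho>c = \<rho>]
  show ?case using r y push reach_bounds[OF push(5)] by (simp, blast)
qed

text \<open>The class \<open>reach\<close> is part of the class over which the action is minimised. The converse inequality
is the content of \<open>near_reach\<close> and \<open>reach_limit\<close> below.\<close>

lemma reach_imp_action:
  assumes "reach t y z c"
  shows "action_inf \<phi>p \<phi>m a b z y t \<le> ereal c"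
proof -
  obtain \<eta> v l \<rho> N B where W: "path_witness t y z c \<eta> v l \<rho> N B"
    using reach_imp_path[OF assms] by blast
  note W' = W[unfolded path_witness_def]
  have B: "0 \<le> B" and e0: "\<eta> 0 = y" and es: "\<eta> t = z" and er: "\<And>r. 0 \<le> r \<Longrightarrow> \<eta> r \<in> {a..b}"
    and lip: "\<And>r q. 0 \<le> r \<Longrightarrow> r \<le> q \<Longrightarrow> \<bar>\<eta> q - \<eta> r\<bar> \<le> B * (q - r)"
    and meas[measurable]: "v \<in> borel_measurable borel" "l \<in> borel_measurable borel"
    and bd: "\<And>r. \<bar>v r\<bar> \<le> B \<and> 0 \<le> l r \<and> l r \<le> B \<and> 0 \<le> \<rho> r" and fin: "finite N"
    and der: "\<And>r. r > 0 \<Longrightarrow> r \<notin> N \<Longrightarrow> (\<exists>d. (\<eta> has_real_derivative d) (at r) \<and> d + l r * outer_normal a b (\<eta> r) = v r) \<and>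
        (\<eta> r \<in> {a<..<b} \<longrightarrow> l r = 0) \<and> (r < t \<longrightarrow> L (\<eta> r) (v r) \<le> ereal (\<rho> r))"
    and int: "(\<rho> has_integral c) {0..t}"
    using W' by blast+
  have t: "0 \<le> t" using reach_bounds[OF assms] by simp
  have L1: "g \<in> L1_loc" if [measurable]: "g \<in> borel_measurable borel" and g: "\<And>r. \<bar>g r\<bar> \<le> B" for g
    unfolding L1_loc_def set_integrable_def
  proof (intro CollectI allI impI)
    fix T :: real
    have "integrable lborel (\<lambda>r. indicator {0..T} r *\<^sub>R g r)"
      by (rule integrableI_bounded_set[where A = "{0..T}" and B = B])
        (use g in \<open>auto simp: indicator_def emeasure_lborel_Icc_eq\<close>)
    then show "integrable lebesgue (\<lambda>r. indicator {0..T} r *\<^sub>R g r)"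
      by (rule integrable_completion[THEN iffD2, rotated]) measurable
  qed
  have nullN: "AE r in lebesgue. r \<notin> N"
    using fin by (intro AE_not_in) (simp add: negligible_finite flip: negligible_iff_null_sets)
  have "(\<eta>, v, l) \<in> SP a b y"
    unfolding SP_def
  proof (clarsimp, intro conjI)
    show "\<eta> \<in> AC_loc" unfolding AC_loc_def using lip B by (auto intro!: lipschitz_imp_AC[where K = B])
    show "v \<in> L1_loc" "l \<in> L1_loc" using bd by (auto intro!: L1 simp: abs_of_nonneg)
    show "AE s in lebesgue. 0 < s \<longrightarrow> (\<exists>d. (\<eta> has_real_derivative d) (at s) \<and> d + l s * outer_normal a b (\<eta> s) = v s) \<and>
        0 \<le> l s \<and> (a < \<eta> s \<and> \<eta> s < b \<longrightarrow> l s = 0)"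
      using nullN by eventually_elim (use der bd in auto)
  qed (use e0 er in auto)
  then have mem: "(\<eta>, v, l) \<in> {(\<eta>, v, l) \<in> SP a b y. \<eta> t = z}" using es by simp
  have "(\<integral>\<^sup>+ s \<in> {0..t}. e2ennreal (L (\<eta> s) (v s)) \<partial>lebesgue) \<le> (\<integral>\<^sup>+ s. ennreal (\<rho> s) * indicator {0..t} s \<partial>lebesgue)"
  proof (rule nn_integral_mono_AE)
    have "AE s in lebesgue. s \<notin> N \<union> {0, t}"
      using fin by (intro AE_not_in) (simp add: negligible_finite flip: negligible_iff_null_sets)
    then show "AE s in lebesgue. e2ennreal (L (\<eta> s) (v s)) * indicator {0..t} s \<le> ennreal (\<rho> s) * indicator {0..t} s"
    proof eventually_elim
      case (elim s)
      show ?case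
      proof (cases "s \<in> {0..t}")
        case True
        then have "L (\<eta> s) (v s) \<le> ereal (\<rho> s)" using der[of s] elim by auto
        then have "e2ennreal (L (\<eta> s) (v s)) \<le> e2ennreal (ereal (\<rho> s))" by (rule e2ennreal_mono)
        then show ?thesis using True by simp
      qed simp
    qed
  qed
  also have "\<dots> = ennreal c"
    unfolding nn_integral_completion
    using bd int by (intro nn_integral_has_integral_lebesgue') auto
  finally have "enn2ereal (\<integral>\<^sup>+ s \<in> {0..t}. e2ennreal (L (\<eta> s) (v s)) \<partial>lebesgue) \<le> ereal c"
    using reach_bounds[OF assms] by (metis enn2ereal_ennreal less_eq_ennreal.rep_eq)
  then show ?thesis
    unfolding action_inf_def using ab
    by (auto intro!: INF_lower2[OF mem])
qed

end

section \<open>The value function\<close>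

context reflected_segment begin

text \<open>The nonlinear semigroup of the limiting control problem, applied to \<open>f\<close>.\<close>

definition value_fn :: "(real \<Rightarrow> real) \<Rightarrow> real \<Rightarrow> real \<Rightarrow> real" where
  "value_fn f s y = Sup {f z - c | z c. reach s y z c}"

context
  fixes f :: "real \<Rightarrow> real" and K :: real
  assumes f: "\<And>x y. \<bar>f x - f y\<bar> \<le> K * \<bar>x - y\<bar>" and K: "0 \<le> K"
begin

lemma value_fn_ge:
  assumes "reach s y z c"
  shows "f z - c \<le> value_fn f s y"
  unfolding value_fn_def
proof (rule cSup_upper)
  show "bdd_above {f z - c | z c. reach s y z c}"
    unfolding bdd_above_def using reach_drop_all[OF f K] by blast
qed (use assms in blast)

lemma value_fn_le:
  assumes "0 \<le> s" "y \<in> {a..b}" "\<And>z c. reach s y z c \<Longrightarrow> f z - c \<le> B"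
  shows "value_fn f s y \<le> B"
  unfolding value_fn_def
  using reach_straight[of s y y 0] assms by (intro cSup_least) auto

lemma value_fn_zero: "y \<in> {a..b} \<Longrightarrow> f y \<le> value_fn f 0 y"
  using value_fn_ge[OF stop, of y] by simp

lemma value_fn_run:
  assumes "0 \<le> \<delta>" "y \<in> {a..b}" "y + \<delta> * v \<in> {a..b}" "0 \<le> s"
    "\<And>\<tau>. 0 \<le> \<tau> \<Longrightarrow> \<tau> \<le> \<delta> \<Longrightarrow> L (y + \<tau> * v) v \<le> ereal \<rho>"
  shows "value_fn f s (y + \<delta> * v) - \<delta> * \<rho> \<le> value_fn f (\<delta> + s) y"
proof -
  have "value_fn f s (y + \<delta> * v) \<le> value_fn f (\<delta> + s) y + \<delta> * \<rho>"
  proof (rule value_fn_le[OF assms(4,3)])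
    fix z c assume "reach s (y + \<delta> * v) z c"
    from value_fn_ge[OF run[OF assms(1-3,5) this]]
    show "f z - c \<le> value_fn f (\<delta> + s) y + \<delta> * \<rho>" by simp
  qed
  then show ?thesis by simp
qed

lemma value_fn_push:
  assumes "0 \<le> \<delta>" "y \<in> {a, b}" "0 \<le> v * outer_normal a b y" "L y v \<le> ereal \<rho>" "0 \<le> s"
  shows "value_fn f s y - \<delta> * \<rho> \<le> value_fn f (\<delta> + s) y"
proof -
  have "value_fn f s y \<le> value_fn f (\<delta> + s) y + \<delta> * \<rho>"
  proof (rule value_fn_le[OF assms(5)])
    fix z c assume "reach s y z c"
    from value_fn_ge[OF push[OF assms(1-4) this]]
    show "f z - c \<le> value_fn f (\<delta> + s) y + \<delta> * \<rho>" by simp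
  qed (use ab assms(2) in auto)
  then show ?thesis by simp
qed

text \<open>By truncation of a path: dropping the last stretch of duration \<open>\<tau>\<close> loses at most a multiple of \<open>\<tau>\<close>.\<close>

lemma value_fn_time_decrease:
  assumes "0 \<le> \<tau>" "\<tau> \<le> s" "y \<in> {a..b}"
  shows "value_fn f s y \<le> value_fn f (s - \<tau>) y + 2 * C1 * exp K * \<tau>"
proof (rule value_fn_le)
  fix z c assume "reach s y z c"
  from reach_truncate[OF f K this assms(1,2)]
  obtain z' c' where "reach (s - \<tau>) y z' c'" "f z - c \<le> f z' - c' + 2 * C1 * exp K * \<tau>" by blast
  with value_fn_ge[of "s - \<tau>" y z' c']
  show "f z - c \<le> value_fn f (s - \<tau>) y + 2 * C1 * exp K * \<tau>" by simp
qed (use assms in auto)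

lemma value_fn_move:
  assumes "0 \<le> s" "0 \<le> \<tau>" "x \<in> {a..b}" "y \<in> {a..b}" "\<bar>y - x\<bar> \<le> \<tau>"
  shows "value_fn f s y - \<tau> * speed_cost 1 \<le> value_fn f (\<tau> + s) x"
proof -
  have "value_fn f s y \<le> value_fn f (\<tau> + s) x + \<tau> * speed_cost 1"
  proof (rule value_fn_le[OF assms(1,4)])
    fix z c assume "reach s y z c"
    from reach_trans[OF reach_straight[of \<tau> x y 1] this] assms
    have "reach (\<tau> + s) x z (\<tau> * speed_cost 1 + c)" by simp
    from value_fn_ge[OF this]
    show "f z - c \<le> value_fn f (\<tau> + s) x + \<tau> * speed_cost 1" by simp
  qed
  then show ?thesis by simp
qed

definition "lip = K + 2 * C1 * exp K + speed_cost 1"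

lemma lip_ge: "0 \<le> lip" "2 * C1 * exp K \<le> lip" "speed_cost 1 \<le> lip"
  using K C1 speed_cost_nonneg[of 1] by (auto simp: lip_def)

text \<open>Walk from \<open>x\<close> to \<open>y\<close> with speed \<open>1\<close> and then follow a truncated optimal path from \<open>y\<close>. If there is
no time for the walk, both values are close to those of \<open>f\<close>.\<close>

lemma value_fn_space_le:
  assumes "0 \<le> s" "x \<in> {a..b}" "y \<in> {a..b}"
  shows "value_fn f s y \<le> value_fn f s x + lip * \<bar>y - x\<bar>"
proof (cases "\<bar>y - x\<bar> \<le> s")
  case True
  have "value_fn f s y \<le> value_fn f (s - \<bar>y - x\<bar>) y + 2 * C1 * exp K * \<bar>y - x\<bar>"
    using True assms by (intro value_fn_time_decrease) auto
  also have "value_fn f (s - \<bar>y - x\<bar>) y \<le> value_fn f s x + \<bar>y - x\<bar> * speed_cost 1"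
    using value_fn_move[of "s - \<bar>y - x\<bar>" "\<bar>y - x\<bar>" x y] True assms by simp
  also have "value_fn f s x + \<bar>y - x\<bar> * speed_cost 1 + 2 * C1 * exp K * \<bar>y - x\<bar>
      = value_fn f s x + (lip - K) * \<bar>y - x\<bar>"
    by (simp add: lip_def algebra_simps)
  also have "(lip - K) * \<bar>y - x\<bar> \<le> lip * \<bar>y - x\<bar>" using K by (intro mult_right_mono) auto
  finally show ?thesis by simp
next
  case False
  have "value_fn f s y \<le> f y + 2 * C1 * exp K * s"
    using assms reach_drop_all[OF f K] by (intro value_fn_le) auto
  moreover have "f y \<le> f x + K * \<bar>y - x\<bar>" using f[of y x] by simp
  moreover have "f x \<le> value_fn f s x + s * speed_cost 1"
    using value_fn_ge[OF reach_straight[of s x x 1]] assms by simp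
  moreover have "(2 * C1 * exp K + speed_cost 1) * s \<le> (2 * C1 * exp K + speed_cost 1) * \<bar>y - x\<bar>"
    using False C1 speed_cost_nonneg[of 1] by (intro mult_left_mono) auto
  ultimately show ?thesis by (simp add: lip_def algebra_simps)
qed

lemma value_fn_time_lipschitz:
  assumes "0 \<le> s" "0 \<le> s'" "y \<in> {a..b}"
  shows "\<bar>value_fn f s y - value_fn f s' y\<bar> \<le> lip * \<bar>s - s'\<bar>"
proof -
  have *: "\<bar>value_fn f r y - value_fn f t y\<bar> \<le> lip * (t - r)" if "0 \<le> r" "r \<le> t" for r t
  proof -
    have "value_fn f t y \<le> value_fn f r y + 2 * C1 * exp K * (t - r)"
      using value_fn_time_decrease[of "t - r" t y] that assms by simp
    moreover have "value_fn f r y - (t - r) * speed_cost 1 \<le> value_fn f t y"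
      using value_fn_move[of r "t - r" y y] that assms by simp
    moreover have "2 * C1 * exp K * (t - r) \<le> lip * (t - r)" "speed_cost 1 * (t - r) \<le> lip * (t - r)"
      using lip_ge that by (auto intro: mult_right_mono)
    ultimately show ?thesis by (simp add: abs_le_iff mult.commute)
  qed
  show ?thesis
    using *[of s s'] *[of s' s] assms by (cases "s \<le> s'") (auto simp: abs_minus_commute)
qed

lemma value_fn_continuous:
  "continuous_on ({0..t} \<times> {a..b}) (\<lambda>z. value_fn f (fst z) (snd z))"
proof (rule lipschitz_on_continuous_on[where L = "2 * lip"], rule lipschitz_onI)
  fix z w :: "real \<times> real" assume zw: "z \<in> {0..t} \<times> {a..b}" "w \<in> {0..t} \<times> {a..b}"
  obtain s y s' y' where zw_eq: "z = (s, y)" "w = (s', y')" by fastforce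
  have r: "0 \<le> s" "0 \<le> s'" "y \<in> {a..b}" "y' \<in> {a..b}" using zw zw_eq by auto
  have "\<bar>s - s'\<bar> \<le> dist z w" "\<bar>y - y'\<bar> \<le> dist z w"
    using dist_fst_le[of z w] dist_snd_le[of z w] by (auto simp: zw_eq dist_real_def)
  then have "lip * \<bar>s - s'\<bar> \<le> lip * dist z w" "lip * \<bar>y - y'\<bar> \<le> lip * dist z w"
    using lip_ge by (auto intro: mult_left_mono)
  moreover have "\<bar>value_fn f s y - value_fn f s' y\<bar> \<le> lip * \<bar>s - s'\<bar>"
    by (rule value_fn_time_lipschitz) (use r in auto)
  moreover have "\<bar>value_fn f s' y - value_fn f s' y'\<bar> \<le> lip * \<bar>y - y'\<bar>"
    using value_fn_space_le[of s' y y'] value_fn_space_le[of s' y' y] r by (simp add: abs_minus_commute)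
  ultimately show "dist (value_fn f (fst z) (snd z)) (value_fn f (fst w) (snd w)) \<le> 2 * lip * dist z w"
    by (simp add: zw_eq dist_real_def)
qed (use lip_ge in auto)

end
end

section \<open>The Laplace upper bound\<close>

lemma derivative_ge_from_left:
  fixes G :: "real \<Rightarrow> real"
  assumes G: "(G has_real_derivative G') (at s)" and d: "0 < d"
    and ge: "\<And>\<tau>. 0 < \<tau> \<Longrightarrow> \<tau> < d \<Longrightarrow> \<tau> * (m - c * \<tau>) \<le> G s - G (s - \<tau>)"
  shows "m \<le> G'"
proof (rule ccontr)
  assume "\<not> m \<le> G'"
  define F where "F r = G r - m * r - c * (r - s)\<^sup>2" for r
  have "(F has_real_derivative G' - m) (at s)"
    unfolding F_def by (auto intro!: derivative_eq_intros G)
  then obtain e where e: "e > 0" "\<And>k. 0 < k \<Longrightarrow> k < e \<Longrightarrow> F s < F (s - k)"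
    using DERIV_neg_dec_left[of F "G' - m" s] \<open>\<not> m \<le> G'\<close> by auto
  define k where "k = min d e / 2"
  have k: "0 < k" "k < d" "k < e" using d e(1) by (auto simp: k_def)
  have "F (s - k) - F s = G (s - k) - G s + k * (m - c * k)"
    by (simp add: F_def power2_eq_square algebra_simps)
  then show False using e(2)[of k] ge[of k] k by simp
qed

text \<open>What the lattices have to satisfy for the analysis: \<open>lat h S\<close> says that \<open>S\<close> is an admissible state
space with mesh \<open>h\<close>. A jump is suppressed only within distance \<open>2 h\<close> of an end point, and the
intensities at the states are close to those on the limiting segment.\<close>

locale approximating_lattices = reflected_segment +
  fixes u :: "real^2" and pos :: "real^2 \<Rightarrow> real" and \<Phi>p \<Phi>m :: "real^2 \<Rightarrow> real"
    and lat :: "real \<Rightarrow> (real^2) set \<Rightarrow> bool"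
  assumes lat_finite: "lat h S \<Longrightarrow> finite S \<and> 0 < h"
    and pos_step: "pos (x + k *\<^sub>R u) = pos x + k"
    and lat_range: "lat h S \<Longrightarrow> x \<in> S \<Longrightarrow> a - h \<le> pos x \<and> pos x \<le> b + h"
    and lat_hi: "lat h S \<Longrightarrow> x \<in> S \<Longrightarrow> x + h *\<^sub>R u \<notin> S \<Longrightarrow> b - 2 * h \<le> pos x"
    and lat_lo: "lat h S \<Longrightarrow> x \<in> S \<Longrightarrow> x - h *\<^sub>R u \<notin> S \<Longrightarrow> pos x \<le> a + 2 * h"
    and rates: "lat h S \<Longrightarrow> x \<in> S \<Longrightarrow> c0 \<le> \<Phi>p x \<and> \<Phi>p x \<le> C1 \<and> c0 \<le> \<Phi>m x \<and> \<Phi>m x \<le> C1"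
    and rates_close: "0 < e \<Longrightarrow> \<exists>r>0. \<forall>h S x y. lat h S \<longrightarrow> h < r \<longrightarrow> x \<in> S \<longrightarrow> y \<in> {a..b} \<longrightarrow>
        \<bar>pos x - y\<bar> < r \<longrightarrow> \<bar>\<Phi>p x - \<phi>p y\<bar> \<le> e \<and> \<bar>\<Phi>m x - \<phi>m y\<bar> \<le> e"
begin

lemma pos_step': "pos (x - k *\<^sub>R u) = pos x - k"
  using pos_step[of x "-k"] by simp

abbreviation "Q h S \<equiv> reaction_generator S u \<Phi>p \<Phi>m h"

text \<open>The expectation of \<open>exp (f / h)\<close> at time \<open>t\<close>, as a function of the initial state.\<close>

definition mgf :: "real \<Rightarrow> (real^2) set \<Rightarrow> (real \<Rightarrow> real) \<Rightarrow> real \<Rightarrow> real^2 \<Rightarrow> real" where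
  "mgf h S f t = semigroup_of (Q h S) t (\<lambda>x. exp (f (pos x) / h))"

lemma rates_nonneg: "lat h S \<Longrightarrow> x \<in> S \<Longrightarrow> 0 \<le> \<Phi>p x \<and> 0 \<le> \<Phi>m x"
  using rates[of h S x] c0 by auto

lemma mgf_pos: "lat h S \<Longrightarrow> 0 \<le> t \<Longrightarrow> x \<in> S \<Longrightarrow> 0 < mgf h S f t x"
  unfolding mgf_def using lat_finite[of h S] rates_nonneg[of h S] by (intro semigroup_pos) auto

lemma mgf_derivative:
  "lat h S \<Longrightarrow> x \<in> S \<Longrightarrow> ((\<lambda>t. mgf h S f t x) has_real_derivative Q h S (mgf h S f t) x) (at t)"
  unfolding mgf_def using lat_finite[of h S] by (intro reaction_semigroup_has_derivative) auto

text \<open>The chain side of the doubling of variables. At a maximum in \<open>x\<close> the increments of \<open>h ln w\<close> to the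
neighbours are bounded by those of the parabola \<open>\<kappa> (x - y)\<^sup>2\<close>, which turns the generator into the
Hamiltonian at the slope \<open>p\<close>, up to errors of order \<open>e\<close> and \<open>h\<close>. A suppressed upward jump occurs only
if \<open>x\<close> is not much below \<open>y\<close>; then \<open>p\<close> is almost nonnegative, and adding the missing term of the
Hamiltonian lowers the right-hand side by \<open>O(h)\<close> at most.\<close>

lemma chain_viscosity:
  assumes lat: "lat h S" and x: "x \<in> S" and w: "\<And>x. x \<in> S \<Longrightarrow> 0 < w x" and \<kappa>: "0 \<le> \<kappa>"
    and y: "y \<in> {a..b}" and kh: "\<kappa> * h \<le> 1"
    and p: "p = 2 * \<kappa> * (pos x - y)" "\<bar>p\<bar> \<le> P"
    and e: "\<bar>\<Phi>p x - \<phi>p y\<bar> \<le> e" "\<bar>\<Phi>m x - \<phi>m y\<bar> \<le> e"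
    and max: "\<And>x'. x' \<in> S \<Longrightarrow> h * ln (w x') - \<kappa> * (pos x' - y)\<^sup>2 \<le> h * ln (w x) - \<kappa> * (pos x - y)\<^sup>2"
  shows "h * (Q h S w x / w x) \<le> H y p + 2 * e * (exp P + 1) + \<kappa> * h * (C1 * (4 * exp P + 8))"
proof -
  have h: "0 < h" using lat_finite[OF lat] by simp
  have wx: "0 < w x" using w x by simp
  have step: "w x' / w x \<le> exp (\<kappa> * ((pos x' - y)\<^sup>2 - (pos x - y)\<^sup>2) / h)" if "x' \<in> S" for x'
  proof -
    have "h * (ln (w x') - ln (w x)) \<le> \<kappa> * ((pos x' - y)\<^sup>2 - (pos x - y)\<^sup>2)"
      using max[OF that] by (simp add: algebra_simps)
    then have "ln (w x' / w x) \<le> \<kappa> * ((pos x' - y)\<^sup>2 - (pos x - y)\<^sup>2) / h"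
      using h w[OF that] wx by (simp add: ln_div field_simps)
    then have "exp (ln (w x' / w x)) \<le> exp (\<kappa> * ((pos x' - y)\<^sup>2 - (pos x - y)\<^sup>2) / h)" by simp
    then show ?thesis using w[OF that] wx by simp
  qed
  have exponent: "\<kappa> * ((pos x + h - y)\<^sup>2 - (pos x - y)\<^sup>2) / h = p + \<kappa> * h"
     "\<kappa> * ((pos x - h - y)\<^sup>2 - (pos x - y)\<^sup>2) / h = - p + \<kappa> * h"
    using h by (simp_all add: p(1) power2_eq_square field_simps)
  have kh0: "0 \<le> \<kappa> * h" using h \<kappa> by simp
  have small: "exp (\<kappa> * h) \<le> 1 + 2 * (\<kappa> * h)"
  proof -
    have "exp (\<kappa> * h) \<le> 1 + \<kappa> * h + (\<kappa> * h)\<^sup>2" using exp_bound[OF kh0 kh] .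
    also have "(\<kappa> * h)\<^sup>2 \<le> \<kappa> * h" using kh0 kh by (simp add: power2_eq_square mult_left_le)
    finally show ?thesis by simp
  qed
  have e0: "0 \<le> e" using e(1) by simp
  \<comment> \<open>The term of one jump direction, with \<open>q\<close> the slope in that direction.\<close>
  have dir: "\<Phi> * (exp (q + \<kappa> * h) - 1) \<le> \<phi> * (exp q - 1) + e * (exp P + 1) + 2 * (\<kappa> * h) * (C1 * exp P)"
    if "0 \<le> \<Phi>" "\<Phi> \<le> C1" "\<bar>\<Phi> - \<phi>\<bar> \<le> e" "\<bar>q\<bar> \<le> P" for \<Phi> \<phi> q
  proof -
    have q: "exp q \<le> exp P" using that by simp
    have "exp (q + \<kappa> * h) \<le> exp q * (1 + 2 * (\<kappa> * h))" using small by (simp add: exp_add)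
    then have "\<Phi> * (exp (q + \<kappa> * h) - 1) \<le> \<Phi> * (exp q * (1 + 2 * (\<kappa> * h)) - 1)"
      using that by (intro mult_left_mono) auto
    also have "\<dots> = \<Phi> * (exp q - 1) + 2 * (\<kappa> * h) * (\<Phi> * exp q)" by (simp add: algebra_simps)
    also have "\<Phi> * exp q \<le> C1 * exp P" using that q by (intro mult_mono) auto
    then have "2 * (\<kappa> * h) * (\<Phi> * exp q) \<le> 2 * (\<kappa> * h) * (C1 * exp P)" using kh0 by (intro mult_left_mono) auto
    also have "\<Phi> * (exp q - 1) \<le> \<phi> * (exp q - 1) + e * (exp P + 1)"
    proof -
      have "(\<Phi> - \<phi>) * (exp q - 1) \<le> \<bar>\<Phi> - \<phi>\<bar> * \<bar>exp q - 1\<bar>" by (simp flip: abs_mult)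
      also have "\<dots> \<le> e * (exp P + 1)"
      proof (rule mult_mono[OF that(3) _ e0])
        show "\<bar>exp q - 1\<bar> \<le> exp P + 1" using q exp_gt_zero[of q] by linarith
      qed simp
      finally show ?thesis by (simp add: algebra_simps)
    qed
    finally show ?thesis by simp
  qed
  have rx: "0 \<le> \<Phi>p x" "\<Phi>p x \<le> C1" "0 \<le> \<Phi>m x" "\<Phi>m x \<le> C1" using rates[OF lat x] c0 by auto
  \<comment> \<open>Near an end point the term of the outward direction is almost nonnegative, so it may be added.\<close>
  have suppressed: "- (4 * (\<kappa> * h) * C1) \<le> \<Phi> * (exp (q + \<kappa> * h) - 1)" if "- 4 * (\<kappa> * h) \<le> q" "0 \<le> \<Phi>" "\<Phi> \<le> C1" for \<Phi> q
  proof -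
    have "- 4 * (\<kappa> * h) \<le> exp (q + \<kappa> * h) - 1"
      using exp_ge_add_one_self[of "q + \<kappa> * h"] that kh0 by linarith
    then have "\<Phi> * (- 4 * (\<kappa> * h)) \<le> \<Phi> * (exp (q + \<kappa> * h) - 1)" using that by (intro mult_left_mono) auto
    moreover have "\<Phi> * (4 * (\<kappa> * h)) \<le> C1 * (4 * (\<kappa> * h))" using that kh0 by (intro mult_right_mono) auto
    ultimately show ?thesis by (simp add: mult_ac)
  qed
  have k4: "0 \<le> 4 * (\<kappa> * h) * C1" using kh0 C1 by simp
  have side: "i * \<Phi> * (R - 1) \<le> \<Phi> * (exp (q + \<kappa> * h) - 1) + 4 * (\<kappa> * h) * C1"
    if "0 \<le> \<Phi>" "\<Phi> \<le> C1" "i = 1 \<and> R \<le> exp (q + \<kappa> * h) \<or> i = 0 \<and> - 4 * (\<kappa> * h) \<le> q" for i \<Phi> R q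
    using that(3)
  proof
    assume "i = 1 \<and> R \<le> exp (q + \<kappa> * h)"
    then have "i * \<Phi> * (R - 1) \<le> \<Phi> * (exp (q + \<kappa> * h) - 1)" using that(1) by (auto intro: mult_left_mono)
    from add_mono[OF this k4] show ?thesis by simp
  next
    assume i: "i = 0 \<and> - 4 * (\<kappa> * h) \<le> q"
    from suppressed[OF conjunct2[OF i] that(1,2)] i show ?thesis by simp
  qed
  have up: "indicator S (x + h *\<^sub>R u) * \<Phi>p x * (w (x + h *\<^sub>R u) / w x - 1)
      \<le> \<Phi>p x * (exp (p + \<kappa> * h) - 1) + 4 * (\<kappa> * h) * C1"
  proof (rule side[OF rx(1,2)], cases "x + h *\<^sub>R u \<in> S")
    case False
    then have "- 2 * h \<le> pos x - y" using lat_hi[OF lat x] y by simp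
    then have "2 * \<kappa> * (- 2 * h) \<le> 2 * \<kappa> * (pos x - y)" using \<kappa> by (intro mult_left_mono) auto
    then show "indicator S (x + h *\<^sub>R u) = (1::real) \<and> w (x + h *\<^sub>R u) / w x \<le> exp (p + \<kappa> * h)
      \<or> indicator S (x + h *\<^sub>R u) = (0::real) \<and> - 4 * (\<kappa> * h) \<le> p" using False by (simp add: p(1))
  qed (use step[of "x + h *\<^sub>R u"] in \<open>simp add: pos_step exponent\<close>)
  have dn: "indicator S (x - h *\<^sub>R u) * \<Phi>m x * (w (x - h *\<^sub>R u) / w x - 1)
      \<le> \<Phi>m x * (exp (- p + \<kappa> * h) - 1) + 4 * (\<kappa> * h) * C1"
  proof (rule side[OF rx(3,4)], cases "x - h *\<^sub>R u \<in> S")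
    case False
    then have "pos x - y \<le> 2 * h" using lat_lo[OF lat x] y by simp
    then have "2 * \<kappa> * (pos x - y) \<le> 2 * \<kappa> * (2 * h)" using \<kappa> by (intro mult_left_mono) auto
    then show "indicator S (x - h *\<^sub>R u) = (1::real) \<and> w (x - h *\<^sub>R u) / w x \<le> exp (- p + \<kappa> * h)
      \<or> indicator S (x - h *\<^sub>R u) = (0::real) \<and> - 4 * (\<kappa> * h) \<le> - p" using False by (simp add: p(1))
  qed (use step[of "x - h *\<^sub>R u"] in \<open>simp add: pos_step' exponent\<close>)
  have "h * (Q h S w x / w x) = indicator S (x + h *\<^sub>R u) * \<Phi>p x * (w (x + h *\<^sub>R u) / w x - 1)
     + indicator S (x - h *\<^sub>R u) * \<Phi>m x * (w (x - h *\<^sub>R u) / w x - 1)"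
    using h wx by (simp add: reaction_generator_def divide_simps)
  also have "\<dots> \<le> \<Phi>p x * (exp (p + \<kappa> * h) - 1) + \<Phi>m x * (exp (- p + \<kappa> * h) - 1) + 8 * (\<kappa> * h) * C1"
    using up dn by simp
  also have "\<dots> \<le> (\<phi>p y * (exp p - 1) + e * (exp P + 1) + 2 * (\<kappa> * h) * (C1 * exp P))
      + (\<phi>m y * (exp (-p) - 1) + e * (exp P + 1) + 2 * (\<kappa> * h) * (C1 * exp P)) + 8 * (\<kappa> * h) * C1"
  proof -
    have "\<bar>- p\<bar> \<le> P" using p(2) by simp
    from dir[OF rx(1,2) e(1) p(2)] dir[OF rx(3,4) e(2) this] show ?thesis by linarith
  qed
  also have "\<dots> = H y p + 2 * e * (exp P + 1) + \<kappa> * h * (C1 * (4 * exp P + 8))"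
    by (simp add: hamiltonian_def algebra_simps)
  finally show ?thesis .
qed

text \<open>The path side of the doubling of variables. Starting from \<open>y\<close> with the velocity \<open>v\<close> that is optimal for
the slope \<open>p\<close>, dynamic programming over a short time \<open>\<tau>\<close> gives the Hamiltonian at \<open>(y, p)\<close>. If \<open>v\<close>
points out of the segment at an end point, the path is pushed instead; then the term \<open>p v\<close> is missing,
but there \<open>x\<close> exceeds the end point by at most \<open>h\<close>, and so \<open>p v\<close> is bounded by a multiple of \<open>h\<close>.\<close>

lemma value_viscosity:
  assumes f: "\<And>x y. \<bar>f x - f y\<bar> \<le> K * \<bar>x - y\<bar>" and K: "0 \<le> K"
    and s: "0 < s" "s \<le> t" and y: "y \<in> {a..b}" and \<kappa>: "0 \<le> \<kappa>"
    and X: "a - h \<le> X" "X \<le> b + h" and h: "0 \<le> h"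
    and p: "p = 2 * \<kappa> * (X - y)" "\<bar>p\<bar> \<le> P"
    and G: "(G has_real_derivative G') (at s)"
    and max: "\<And>s' y'. 0 \<le> s' \<Longrightarrow> s' \<le> t \<Longrightarrow> y' \<in> {a..b} \<Longrightarrow>
       G s' - value_fn f s' y' - \<kappa> * (X - y')\<^sup>2 - \<epsilon> * s' \<le> G s - value_fn f s y - \<kappa> * (X - y)\<^sup>2 - \<epsilon> * s"
  shows "\<epsilon> + H y p - \<kappa> * h * (2 * C1 * exp P) \<le> G'"
proof (rule field_le_epsilon)
  fix e :: real assume e: "0 < e"
  have pos: "0 < \<phi>p y" "0 < \<phi>m y" using \<phi>_pos[OF y] by auto
  define \<mu>p \<mu>m where "\<mu>p = \<phi>p y * exp p" and "\<mu>m = \<phi>m y * exp (-p)"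
  define v where "v = \<mu>p - \<mu>m"
  have \<mu>: "0 < \<mu>p" "0 < \<mu>m" using pos by (auto simp: \<mu>p_def \<mu>m_def)
  have v_le: "\<bar>v\<bar> \<le> C1 * exp P"
  proof -
    have "\<mu>p \<le> C1 * exp P" "\<mu>m \<le> C1 * exp P"
      unfolding \<mu>p_def \<mu>m_def using \<phi>[OF y] pos p(2) by (auto intro!: mult_mono)
    then show ?thesis using \<mu> by (simp add: v_def abs_le_iff)
  qed
  have Lyv: "L y v = ereal (p * v - H y p)" "tilt_cost \<mu>p (\<phi>p y) + tilt_cost \<mu>m (\<phi>m y) = p * v - H y p"
    using lagrangian_eq[of \<phi>p y \<phi>m p v] pos by (auto simp: v_def \<mu>p_def \<mu>m_def)
  have kh: "0 \<le> \<kappa> * h * (2 * C1 * exp P)" using \<kappa> h C1 by simp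
  show "\<epsilon> + H y p - \<kappa> * h * (2 * C1 * exp P) \<le> G' + e"
  proof (cases "(y = b \<and> 0 < v) \<or> (y = a \<and> v < 0)")
    case True
    have "\<epsilon> - (p * v - H y p) \<le> G'"
    proof (rule derivative_ge_from_left[OF G s(1), where c = 0])
      fix \<tau> assume \<tau>: "0 < \<tau>" "\<tau> < s"
      have "value_fn f (s - \<tau>) y - \<tau> * (p * v - H y p) \<le> value_fn f (\<tau> + (s - \<tau>)) y"
        by (rule value_fn_push[OF f K, where v = v]) (use True Lyv(1) \<tau> ab in \<open>auto simp: outer_normal_def\<close>)
      moreover have "G (s - \<tau>) - value_fn f (s - \<tau>) y - \<epsilon> * (s - \<tau>) \<le> G s - value_fn f s y - \<epsilon> * s"
        using max[of "s - \<tau>" y] \<tau> s y by simp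
      ultimately show "\<tau> * (\<epsilon> - (p * v - H y p) - 0 * \<tau>) \<le> G s - G (s - \<tau>)"
        by (simp add: algebra_simps)
    qed
    moreover have "p * v \<le> \<kappa> * h * (2 * C1 * exp P)"
    proof -
      have "p * sgn v \<le> 2 * \<kappa> * h"
      proof (cases "y = b \<and> 0 < v")
        case T: True
        have "2 * \<kappa> * (X - y) \<le> 2 * \<kappa> * h" using X \<kappa> T by (intro mult_left_mono) auto
        then show ?thesis using T p(1) by simp
      next
        case F: False
        then have T: "y = a" "v < 0" using True by auto
        have "2 * \<kappa> * (y - X) \<le> 2 * \<kappa> * h" using X \<kappa> T by (intro mult_left_mono) auto
        then show ?thesis using T p(1) by (simp add: algebra_simps)
      qed
      then have "p * sgn v * \<bar>v\<bar> \<le> 2 * \<kappa> * h * \<bar>v\<bar>" by (rule mult_right_mono) simp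
      also have "\<dots> \<le> 2 * \<kappa> * h * (C1 * exp P)" using v_le \<kappa> h by (intro mult_left_mono) auto
      also have "p * sgn v * \<bar>v\<bar> = p * v" by (simp add: sgn_mult_abs mult.assoc)
      finally show ?thesis by (simp add: mult_ac)
    qed
    ultimately show ?thesis using e by simp
  next
    case inner: False
    \<comment> \<open>The path can move with velocity \<open>v\<close> for a short time, at a running cost close to that at \<open>y\<close>.\<close>
    define M where "M = 1 + \<mu>p / c0 + (1 + \<mu>m / c0)"
    have M: "0 < M" using \<mu> c0 by (simp add: M_def add_pos_pos)
    have eM: "0 < e / M" using e M by simp
    obtain r1 where r1: "r1 > 0" "\<And>y'. y' \<in> {a..b} \<Longrightarrow> \<bar>y' - y\<bar> < r1 \<Longrightarrow> \<bar>\<phi>p y' - \<phi>p y\<bar> < e / M"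
      using cont(1) eM y unfolding continuous_on_iff dist_real_def by blast
    obtain r2 where r2: "r2 > 0" "\<And>y'. y' \<in> {a..b} \<Longrightarrow> \<bar>y' - y\<bar> < r2 \<Longrightarrow> \<bar>\<phi>m y' - \<phi>m y\<bar> < e / M"
      using cont(2) eM y unfolding continuous_on_iff dist_real_def by blast
    define room where "room = (if v > 0 then (b - y) / v else if v < 0 then (a - y) / v else 1)"
    have room: "0 < room" using inner y by (auto simp: room_def divide_neg_neg)
    define d where "d = Min {room, s, min r1 r2 / (\<bar>v\<bar> + 1)}"
    have d: "0 < d" "d \<le> room" "d \<le> s" "d \<le> min r1 r2 / (\<bar>v\<bar> + 1)"
      using room s r1(1) r2(1) by (auto simp: d_def)
    have "y + room * v \<in> {a..b}" using y ab by (auto simp: room_def)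
    then have stay: "y + \<tau> * v \<in> {a..b}" if "0 \<le> \<tau>" "\<tau> \<le> d" for \<tau>
      using run_between[OF y, of room v \<tau>] that d by simp
    have cost: "L (y + \<tau> * v) v \<le> ereal (p * v - H y p + e)" if \<tau>: "0 \<le> \<tau>" "\<tau> < d" for \<tau>
    proof -
      define y' where "y' = y + \<tau> * v"
      have y': "y' \<in> {a..b}" using stay[of \<tau>] \<tau> by (simp add: y'_def)
      have "\<bar>y' - y\<bar> = \<tau> * \<bar>v\<bar>" using \<tau> by (simp add: y'_def abs_mult)
      also have "\<dots> \<le> \<tau> * (\<bar>v\<bar> + 1)" using \<tau> by (intro mult_left_mono) auto
      also have "\<dots> < d * (\<bar>v\<bar> + 1)" using \<tau> by (intro mult_strict_right_mono) auto
      also have "\<dots> \<le> min r1 r2" using d(4) by (simp add: field_simps)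
      finally have "\<bar>y' - y\<bar> < r1" "\<bar>y' - y\<bar> < r2" by auto
      then have cl: "\<bar>\<phi>p y' - \<phi>p y\<bar> \<le> e / M" "\<bar>\<phi>m y' - \<phi>m y\<bar> \<le> e / M"
        using r1(2)[OF y'] r2(2)[OF y'] by auto
      have "tilt_cost \<mu>p (\<phi>p y') \<le> tilt_cost \<mu>p (\<phi>p y) + e / M * (1 + \<mu>p / c0)"
           "tilt_cost \<mu>m (\<phi>m y') \<le> tilt_cost \<mu>m (\<phi>m y) + e / M * (1 + \<mu>m / c0)"
        using \<mu> c0 \<phi>[OF y] \<phi>[OF y'] cl by (intro tilt_cost_diff; simp)+
      moreover have "e / M * (1 + \<mu>p / c0) + e / M * (1 + \<mu>m / c0) = e"
      proof -
        have "e / M * (1 + \<mu>p / c0) + e / M * (1 + \<mu>m / c0) = e / M * M"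
          by (simp only: M_def distrib_left)
        then show ?thesis using M by simp
      qed
      ultimately have "tilt_cost \<mu>p (\<phi>p y') + tilt_cost \<mu>m (\<phi>m y') \<le> p * v - H y p + e"
        using Lyv(2) by linarith
      moreover have "L y' v \<le> ereal (tilt_cost \<mu>p (\<phi>p y') + tilt_cost \<mu>m (\<phi>m y'))"
        using \<mu> \<phi>_pos[OF y'] by (intro lagrangian_le_tilt_cost) (auto simp: v_def)
      ultimately show ?thesis by (auto simp: y'_def intro: order_trans)
    qed
    have "\<epsilon> - (p * v - H y p + e) + p * v \<le> G'"
    proof (rule derivative_ge_from_left[OF G d(1), where c = "\<kappa> * v\<^sup>2"])
      fix \<tau> assume \<tau>: "0 < \<tau>" "\<tau> < d"
      have "value_fn f (s - \<tau>) (y + \<tau> * v) - \<tau> * (p * v - H y p + e) \<le> value_fn f (\<tau> + (s - \<tau>)) y"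
        using \<tau> d y stay[of \<tau>] cost by (intro value_fn_run[OF f K]) auto
      moreover have "G (s - \<tau>) - value_fn f (s - \<tau>) (y + \<tau> * v) - \<kappa> * (X - (y + \<tau> * v))\<^sup>2 - \<epsilon> * (s - \<tau>)
          \<le> G s - value_fn f s y - \<kappa> * (X - y)\<^sup>2 - \<epsilon> * s"
        using max[of "s - \<tau>" "y + \<tau> * v"] \<tau> s d stay[of \<tau>] by simp
      ultimately show "\<tau> * (\<epsilon> - (p * v - H y p + e) + p * v - \<kappa> * v\<^sup>2 * \<tau>) \<le> G s - G (s - \<tau>)"
        by (simp add: p(1) power2_eq_square algebra_simps)
    qed
    then show ?thesis using kh by linarith
  qed
qed

text \<open>If the maximum of the doubled function were attained at a positive time, \<open>value_viscosity\<close> and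
\<open>chain_viscosity\<close> would contradict each other by the margin \<open>e0\<close>. The Lipschitz bound \<open>\<Lambda>\<close> of the value
function keeps the slope \<open>p\<close> bounded by \<open>P\<close> independently of \<open>\<kappa>\<close> and makes \<open>|x - y|\<close> at most
\<open>\<Lambda> / \<kappa> + h\<close>; therefore \<open>\<kappa>\<close> is chosen before \<open>h\<close>.\<close>

theorem laplace_upper_bound:
  assumes f: "\<And>x y. \<bar>f x - f y\<bar> \<le> K * \<bar>x - y\<bar>" and K: "0 \<le> K"
    and t: "0 \<le> t" and \<epsilon>: "0 < \<epsilon>" and zero: "0 \<in> {a..b}"
  shows "\<exists>r>0. \<forall>h S x. lat h S \<longrightarrow> h < r \<longrightarrow> x \<in> S \<longrightarrow> \<bar>pos x\<bar> < r \<longrightarrow>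
    h * ln (mgf h S f t x) \<le> value_fn f t 0 + \<epsilon>"
proof -
  define \<Lambda> where "\<Lambda> = lip K"
  have \<Lambda>: "0 \<le> \<Lambda>" unfolding \<Lambda>_def by (rule lip_ge[OF f K])
  define e0 where "e0 = \<epsilon> / (4 * (t + 1))"
  have e0: "0 < e0" "e0 * t \<le> \<epsilon> / 4"
  proof -
    show "0 < e0" using \<epsilon> t by (simp add: e0_def)
    have "e0 * t \<le> e0 * (t + 1)" using \<open>0 < e0\<close> by simp
    also have "\<dots> = \<epsilon> / 4" using t by (simp add: e0_def field_simps)
    finally show "e0 * t \<le> \<epsilon> / 4" .
  qed
  define P where "P = 4 * \<Lambda> + 1"
  define e1 where "e1 = e0 / (8 * (exp P + 1))"
  have e1: "0 < e1" "2 * e1 * (exp P + 1) = e0 / 4"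
  proof -
    define E where "E = exp P + 1"
    have "0 < E" by (simp add: E_def add_pos_pos)
    have e1E: "e1 = e0 / (8 * E)" by (simp add: e1_def E_def)
    have "0 < e1" "2 * e1 * E = e0 / 4" unfolding e1E using e0(1) \<open>0 < E\<close> by simp_all
    then show "0 < e1" "2 * e1 * (exp P + 1) = e0 / 4" by (auto simp: E_def)
  qed
  obtain r1 where r1: "r1 > 0" "\<And>h S x y. lat h S \<Longrightarrow> h < r1 \<Longrightarrow> x \<in> S \<Longrightarrow> y \<in> {a..b} \<Longrightarrow>
        \<bar>pos x - y\<bar> < r1 \<Longrightarrow> \<bar>\<Phi>p x - \<phi>p y\<bar> \<le> e1 \<and> \<bar>\<Phi>m x - \<phi>m y\<bar> \<le> e1"
    using rates_close[OF e1(1)] by blast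
  define \<kappa> where "\<kappa> = 1 + 2 * \<Lambda> / r1 + K\<^sup>2 / \<epsilon>"
  have q: "0 \<le> 2 * \<Lambda> / r1" "0 \<le> K\<^sup>2 / \<epsilon>" using \<Lambda> r1(1) \<epsilon> by auto
  have \<kappa>: "1 \<le> \<kappa>" "\<Lambda> / \<kappa> \<le> r1 / 2" "K\<^sup>2 \<le> \<kappa> * \<epsilon>"
  proof -
    show 1: "1 \<le> \<kappa>" using q by (simp add: \<kappa>_def)
    have "2 * \<Lambda> / r1 \<le> \<kappa>" using q by (simp add: \<kappa>_def)
    then show "\<Lambda> / \<kappa> \<le> r1 / 2" using r1(1) 1 by (simp add: field_simps)
    have "K\<^sup>2 / \<epsilon> \<le> \<kappa>" using q by (simp add: \<kappa>_def)
    then show "K\<^sup>2 \<le> \<kappa> * \<epsilon>" using \<epsilon> by (simp add: field_simps)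
  qed
  define W where "W = C1 * (6 * exp P + 8)"
  have W: "0 < W" using C1 by (simp add: W_def add_pos_pos)
  define r where "r = Min {r1 / 2, 1 / (2 * \<kappa>), e0 / (2 * \<kappa> * W), 1, \<epsilon> / (4 * \<kappa>)}"
  have r: "0 < r" "r \<le> r1 / 2" "r \<le> 1 / (2 * \<kappa>)" "r \<le> e0 / (2 * \<kappa> * W)" "r \<le> 1" "r \<le> \<epsilon> / (4 * \<kappa>)"
    using r1(1) \<kappa> e0 W \<epsilon> by (auto simp: r_def)
  have "h * ln (mgf h S f t x0) \<le> value_fn f t 0 + \<epsilon>"
    if lat: "lat h S" and hr: "h < r" and x0: "x0 \<in> S" "\<bar>pos x0\<bar> < r" for h S x0
  proof -
    have fin: "finite S" and h: "0 < h" using lat_finite[OF lat] by auto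
    have \<kappa>h: "2 * \<kappa> * h \<le> 1" "\<kappa> * h * W < e0 / 2"
    proof -
      have "h * (2 * \<kappa>) < r * (2 * \<kappa>)" using hr \<kappa>(1) by simp
      also have "\<dots> \<le> 1" using r(3) \<kappa>(1) by (simp add: field_simps)
      finally show "2 * \<kappa> * h \<le> 1" by (simp add: mult_ac)
      have "h * (2 * \<kappa> * W) < r * (2 * \<kappa> * W)" using hr \<kappa>(1) W by simp
      also have "\<dots> \<le> e0" using r(4) \<kappa>(1) W by (simp add: field_simps)
      finally show "\<kappa> * h * W < e0 / 2" by (simp add: mult_ac)
    qed
    define \<Theta> where "\<Theta> x s y = h * ln (mgf h S f s x) - value_fn f s y - \<kappa> * (pos x - y)\<^sup>2 - e0 * s" for x s y
    have cont_g: "continuous_on {0..t} (\<lambda>s. h * ln (mgf h S f s x))" if "x \<in> S" for x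
    proof -
      have "continuous_on {0..t} (\<lambda>s. mgf h S f s x)"
        by (rule DERIV_continuous_on[OF has_field_derivative_at_within[OF mgf_derivative[OF lat that]]])
      then show ?thesis
        using mgf_pos[OF lat _ that, of _ f] by (intro continuous_intros) force+
    qed
    have "\<exists>z\<in>{0..t} \<times> {a..b}. \<forall>w\<in>{0..t} \<times> {a..b}. \<Theta> x (fst w) (snd w) \<le> \<Theta> x (fst z) (snd z)"
      if "x \<in> S" for x
    proof (rule continuous_attains_sup)
      show "compact ({0..t} \<times> {a..b})" by (intro compact_Times) auto
      show "{0..t} \<times> {a..b} \<noteq> {}" using t ab by auto
      have cg: "continuous_on ({0..t} \<times> {a..b}) (\<lambda>z. h * ln (mgf h S f (fst z) x))"
        by (rule continuous_on_compose2[OF cont_g[OF that], of _ fst]) (auto intro: continuous_intros)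
      show "continuous_on ({0..t} \<times> {a..b}) (\<lambda>z. \<Theta> x (fst z) (snd z))"
        unfolding \<Theta>_def
        by (intro continuous_on_diff cg value_fn_continuous[OF f K]) (intro continuous_intros)+
    qed
    then obtain Z where Z: "\<And>x. x \<in> S \<Longrightarrow> Z x \<in> {0..t} \<times> {a..b}"
        "\<And>x w. x \<in> S \<Longrightarrow> w \<in> {0..t} \<times> {a..b} \<Longrightarrow> \<Theta> x (fst w) (snd w) \<le> \<Theta> x (fst (Z x)) (snd (Z x))"
      by metis
    obtain x where x: "x \<in> S" "\<And>x'. x' \<in> S \<Longrightarrow> \<Theta> x' (fst (Z x')) (snd (Z x')) \<le> \<Theta> x (fst (Z x)) (snd (Z x))"
    proof -
      let ?V = "(\<lambda>x. \<Theta> x (fst (Z x)) (snd (Z x))) ` S"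
      have "Max ?V \<in> ?V" using fin x0 by (intro Max_in) auto
      then obtain x where x: "x \<in> S" "Max ?V = \<Theta> x (fst (Z x)) (snd (Z x))" by auto
      have "\<Theta> x' (fst (Z x')) (snd (Z x')) \<le> Max ?V" if "x' \<in> S" for x'
        using fin that by (intro Max_ge) auto
      then show ?thesis using that x by metis
    qed
    define s y where "s = fst (Z x)" and "y = snd (Z x)"
    have s: "0 \<le> s" "s \<le> t" and y: "y \<in> {a..b}" using Z(1)[OF x(1)] by (auto simp: s_def y_def)
    have max: "\<Theta> x' s' y' \<le> \<Theta> x s y" if "x' \<in> S" "0 \<le> s'" "s' \<le> t" "y' \<in> {a..b}" for x' s' y'
      using Z(2)[OF that(1), of "(s', y')"] x(2)[OF that(1)] that by (auto simp: s_def y_def)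
    have X: "a - h \<le> pos x" "pos x \<le> b + h" using lat_range[OF lat x(1)] by auto
    define d where "d = \<bar>pos x - y\<bar>"
    have d: "d \<le> \<Lambda> / \<kappa> + h"
    proof -
      \<comment> \<open>The state may lie outside the segment by up to \<open>h\<close>, hence the projection \<open>X'\<close> onto it.\<close>
      define X' where "X' = max a (min b (pos x))"
      have X': "X' \<in> {a..b}" "\<bar>pos x - X'\<bar> \<le> h" using X ab h by (auto simp: X'_def)
      have "\<Theta> x s X' \<le> \<Theta> x s y" by (rule max) (use x s X' in auto)
      moreover have "value_fn f s X' \<le> value_fn f s y + \<Lambda> * \<bar>X' - y\<bar>"
        unfolding \<Lambda>_def by (rule value_fn_space_le[OF f K s(1) y X'(1)])
      moreover have "\<Lambda> * \<bar>X' - y\<bar> \<le> \<Lambda> * (d + h)"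
        using X'(2) \<Lambda> by (intro mult_left_mono) (auto simp: d_def)
      moreover have "\<kappa> * (pos x - X')\<^sup>2 \<le> \<kappa> * h\<^sup>2"
        using X'(2) h \<kappa>(1) by (intro mult_left_mono) (auto simp: abs_le_square_iff[symmetric])
      moreover have "(pos x - y)\<^sup>2 = d\<^sup>2" by (simp add: d_def)
      ultimately have "\<kappa> * d\<^sup>2 \<le> \<Lambda> * (d + h) + \<kappa> * h\<^sup>2" by (simp add: \<Theta>_def)
      then have "\<kappa> * (d - h) * (d + h) \<le> \<Lambda> * (d + h)" by (simp add: power2_eq_square algebra_simps)
      moreover have "0 < d + h" using h by (simp add: d_def)
      ultimately have "\<kappa> * (d - h) \<le> \<Lambda>" by simp
      then show ?thesis using \<kappa>(1) by (simp add: field_simps)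
    qed
    then have d_r1: "d < r1" "h < r1" using \<kappa>(2) hr r by linarith+
    have "\<Theta> x s y \<le> \<epsilon> / 4"
    proof (cases "s = 0")
      case True
      have "mgf h S f 0 x = exp (f (pos x) / h)" by (simp add: mgf_def semigroup_zero)
      then have "\<Theta> x s y \<le> f (pos x) - f y - \<kappa> * d\<^sup>2"
        using True h value_fn_zero[OF f K y] by (simp add: \<Theta>_def d_def)
      also have "\<dots> \<le> K * d - \<kappa> * d\<^sup>2" using f[of "pos x" y] by (simp add: d_def)
      also have "\<dots> \<le> K\<^sup>2 / (4 * \<kappa>)"
      proof -
        have "0 \<le> (2 * \<kappa> * d - K)\<^sup>2" by simp
        then have "4 * \<kappa> * (K * d - \<kappa> * d\<^sup>2) \<le> K\<^sup>2" by (simp add: power2_eq_square algebra_simps)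
        then show ?thesis using \<kappa>(1) by (simp add: pos_le_divide_eq mult.commute)
      qed
      also have "\<dots> \<le> \<epsilon> / 4" using \<kappa> by (simp add: field_simps)
      finally show ?thesis .
    next
      case False
      define p where "p = 2 * \<kappa> * (pos x - y)"
      have P: "\<bar>p\<bar> \<le> P"
      proof -
        have "\<bar>p\<bar> = 2 * (\<kappa> * d)" using \<kappa>(1) by (simp add: p_def d_def abs_mult)
        also have "\<kappa> * d \<le> \<kappa> * (\<Lambda> / \<kappa> + h)" using d \<kappa>(1) by (intro mult_left_mono) auto
        also have "\<kappa> * (\<Lambda> / \<kappa> + h) = \<Lambda> + \<kappa> * h" using \<kappa>(1) by (simp add: field_simps)
        finally show ?thesis using \<kappa>h(1) \<Lambda> by (simp add: P_def)
      qed
      define G' where "G' = h * (Q h S (mgf h S f s) x / mgf h S f s x)"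
      have G: "((\<lambda>s. h * ln (mgf h S f s x)) has_real_derivative G') (at s)"
        using mgf_pos[OF lat s(1) x(1), of f]
        by (auto intro!: derivative_eq_intros mgf_derivative[OF lat x(1)] simp: G'_def)
      have "e0 + H y p - \<kappa> * h * (2 * C1 * exp P) \<le> G'"
      proof (rule value_viscosity[OF f K _ s(2) y _ X _ p_def P G])
        show "h * ln (mgf h S f s' x) - value_fn f s' y' - \<kappa> * (pos x - y')\<^sup>2 - e0 * s'
          \<le> h * ln (mgf h S f s x) - value_fn f s y - \<kappa> * (pos x - y)\<^sup>2 - e0 * s"
          if "0 \<le> s'" "s' \<le> t" "y' \<in> {a..b}" for s' y'
          using max[OF x(1) that] by (simp add: \<Theta>_def)
      qed (use False s \<kappa>(1) h in auto)
      also have "G' \<le> H y p + 2 * e1 * (exp P + 1) + \<kappa> * h * (C1 * (4 * exp P + 8))"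
        unfolding G'_def
      proof (rule chain_viscosity[OF lat x(1) _ _ y _ p_def P])
        show "\<bar>\<Phi>p x - \<phi>p y\<bar> \<le> e1" "\<bar>\<Phi>m x - \<phi>m y\<bar> \<le> e1"
          using r1(2)[OF lat d_r1(2) x(1) y] d_r1(1) by (auto simp: d_def)
        show "h * ln (mgf h S f s x') - \<kappa> * (pos x' - y)\<^sup>2 \<le> h * ln (mgf h S f s x) - \<kappa> * (pos x - y)\<^sup>2"
          if "x' \<in> S" for x'
          using max[OF that s y] by (simp add: \<Theta>_def)
      qed (use mgf_pos[OF lat s(1)] \<kappa>(1) \<kappa>h h in auto)
      finally have "e0 \<le> e0 / 4 + \<kappa> * h * (C1 * (4 * exp P + 8)) + \<kappa> * h * (2 * C1 * exp P)"
        using e1(2) by simp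
      also have "\<dots> = e0 / 4 + \<kappa> * h * W" by (simp add: W_def algebra_simps)
      finally show ?thesis using \<kappa>h(2) e0(1) by simp
    qed
    moreover have "\<Theta> x0 t 0 \<le> \<Theta> x s y" by (rule max) (use x0 t zero in auto)
    moreover have "\<kappa> * (pos x0)\<^sup>2 \<le> \<epsilon> / 4"
    proof -
      have "(pos x0)\<^sup>2 = \<bar>pos x0\<bar> * \<bar>pos x0\<bar>" by (simp add: power2_eq_square)
      also have "\<dots> \<le> r * 1" using x0(2) r by (intro mult_mono) auto
      finally have "\<kappa> * (pos x0)\<^sup>2 \<le> \<kappa> * r" using \<kappa>(1) by (intro mult_left_mono) auto
      also have "\<dots> \<le> \<epsilon> / 4" using r(6) \<kappa>(1) by (simp add: field_simps)
      finally show ?thesis .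
    qed
    ultimately show ?thesis using e0(2) \<epsilon> by (simp add: \<Theta>_def)
  qed
  then show ?thesis using r(1) by blast
qed

end

section \<open>The Laplace lower bound\<close>

context reflected_segment begin

lemma hamiltonian_diff:
  assumes y: "y \<in> {a..b}" "y' \<in> {a..b}" and e: "\<bar>\<phi>p y - \<phi>p y'\<bar> \<le> e" "\<bar>\<phi>m y - \<phi>m y'\<bar> \<le> e"
  shows "H y p \<le> H y' p + e * (2 + (\<phi>p y' * exp p + \<phi>m y' * exp (-p)) / c0)"
proof -
  have *: "(f - f') * (exp q - 1) \<le> e * (1 + f' * exp q / c0)" if "\<bar>f - f'\<bar> \<le> e" "c0 \<le> f'" for f f' q
  proof -
    have "(f - f') * (exp q - 1) \<le> \<bar>f - f'\<bar> * \<bar>exp q - 1\<bar>" by (simp flip: abs_mult)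
    also have "\<dots> \<le> e * (1 + exp q)"
    proof (rule mult_mono)
      show "\<bar>exp q - 1\<bar> \<le> 1 + exp q" using exp_gt_zero[of q] by linarith
    qed (use that in auto)
    also have "\<dots> \<le> e * (1 + f' * exp q / c0)"
    proof (rule mult_left_mono)
      have "c0 * exp q \<le> f' * exp q" using that by simp
      then show "1 + exp q \<le> 1 + f' * exp q / c0" using c0 by (simp add: field_simps)
    qed (use that in auto)
    finally show ?thesis .
  qed
  have "(\<phi>p y - \<phi>p y') * (exp p - 1) \<le> e * (1 + \<phi>p y' * exp p / c0)"
       "(\<phi>m y - \<phi>m y') * (exp (-p) - 1) \<le> e * (1 + \<phi>m y' * exp (-p) / c0)"
    using *[OF e(1), of p] *[OF e(2), of "-p"] \<phi>[OF y(2)] by auto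
  then show ?thesis by (simp add: hamiltonian_def algebra_simps add_divide_distrib)
qed

text \<open>The action of a path dominates the sum of \<open>p v - H\<close> over the pieces of a partition, for any choice of
one slope \<open>p k\<close> on each piece. With the slope that is optimal for the average velocity this serves as
Jensen's inequality. An upper integral of a possibly nonmeasurable function need not be additive, so one
integrable minorant \<open>F\<close> on all of \<open>[0, t]\<close> is compared with it.\<close>

lemma energy_lower_bound:
  assumes v: "set_integrable lebesgue {0..t} v" and \<eta>: "continuous_on {0..t} \<eta>" "\<And>s. 0 \<le> s \<Longrightarrow> \<eta> s \<in> {a..b}"
    and N: "0 < N" and \<delta>: "0 < \<delta>" "real N * \<delta> = t"
    and C: "0 \<le> C" "(\<integral>\<^sup>+ s \<in> {0..t}. e2ennreal (L (\<eta> s) (v s)) \<partial>lebesgue) \<le> ennreal C"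
  shows "(\<Sum>k<N. integral {real k * \<delta>..(real k + 1) * \<delta>} (\<lambda>s. p k * v s - H (\<eta> s) (p k))) \<le> C"
proof -
  define q where "q k s = p k * v s - H (\<eta> s) (p k)" for k s
  define J where "J k = {real k * \<delta><..(real k + 1) * \<delta>}" for k
  have Jsub: "J k \<subseteq> {0..t}" "{real k * \<delta>..(real k + 1) * \<delta>} \<subseteq> {0..t}" if "k < N" for k
  proof -
    have "(real k + 1) * \<delta> \<le> real N * \<delta>" using that \<delta>(1) by (intro mult_right_mono) auto
    moreover have "0 \<le> real k * \<delta>" using \<delta>(1) by simp
    ultimately show "J k \<subseteq> {0..t}" "{real k * \<delta>..(real k + 1) * \<delta>} \<subseteq> {0..t}" using \<delta>(2) by (auto simp: J_def)
  qed
  have Hc: "continuous_on {0..t} (\<lambda>s. H (\<eta> s) (p k))" for k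
    unfolding hamiltonian_def
    by (intro continuous_intros continuous_on_compose2[OF cont(1) \<eta>(1)] continuous_on_compose2[OF cont(2) \<eta>(1)])
      (use \<eta>(2) in auto)
  have q: "set_integrable lebesgue {0..t} (q k)" for k
    unfolding q_def
    by (intro set_integral_diff set_integrable_mult_right v absolutely_integrable_continuous_real Hc)
  have qJ: "set_integrable lebesgue (J k) (q k)" if "k < N" for k
    by (rule set_integrable_subset[OF q _ Jsub(1)[OF that]]) (simp add: J_def)
  have qI: "(LINT s:J k|lebesgue. q k s) = integral {real k * \<delta>..(real k + 1) * \<delta>} (q k)" if "k < N" for k
  proof -
    have "(LINT s:J k|lebesgue. q k s) = integral (J k) (q k)"
      by (rule set_lebesgue_integral_eq_integral[OF qJ[OF that]])
    also have "\<dots> = integral {real k * \<delta>..(real k + 1) * \<delta>} (q k)"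
      by (rule integral_spike_set; rule negligible_subset[OF negligible_sing[of "real k * \<delta>"]])
        (use \<delta>(1) in \<open>auto simp: J_def\<close>)
    finally show ?thesis .
  qed
  define F where "F s = (\<Sum>k<N. indicator (J k) s *\<^sub>R q k s)" for s
  have "(\<integral>\<^sup>+ s. ennreal (F s) \<partial>lebesgue) \<le> ennreal C"
  proof (rule order_trans[OF _ C(2)], rule nn_integral_mono)
    fix s
    show "ennreal (F s) \<le> e2ennreal (L (\<eta> s) (v s)) * indicator {0..t} s"
    proof (cases "\<exists>k<N. s \<in> J k")
      case True
      then obtain k where k: "k < N" "s \<in> J k" by blast
      have "s \<notin> J j" if "j \<noteq> k" for j
      proof
        assume "s \<in> J j"
        then have "real j * \<delta> < (real k + 1) * \<delta>" "real k * \<delta> < (real j + 1) * \<delta>" using k(2) by (auto simp: J_def)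
        then have "real j < real k + 1" "real k < real j + 1" using \<delta>(1) by auto
        then show False using that by linarith
      qed
      then have "F s = (\<Sum>j<N. if j = k then q k s else 0)"
        unfolding F_def using k by (intro sum.cong) auto
      then have "F s = q k s" using k by simp
      moreover have "ereal (q k s) \<le> L (\<eta> s) (v s)" unfolding q_def by (rule lagrangian_ge)
      then have "ennreal (q k s) \<le> e2ennreal (L (\<eta> s) (v s))"
        using e2ennreal_mono by fastforce
      moreover have "s \<in> {0..t}" using Jsub(1)[OF k(1)] k(2) by blast
      ultimately show ?thesis by simp
    next
      case False
      then have "F s = 0" unfolding F_def by (intro sum.neutral) auto
      then show ?thesis by simp
    qed
  qed
  then have "integral\<^sup>L lebesgue F \<le> C" using C(1) by (intro integral_real_bounded)
  moreover have "integral\<^sup>L lebesgue F = (\<Sum>k<N. LINT s:J k|lebesgue. q k s)"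
    unfolding F_def set_lebesgue_integral_def
    by (rule Bochner_Integration.integral_sum) (use qJ in \<open>auto simp: set_integrable_def\<close>)
  moreover have "\<dots> = (\<Sum>k<N. integral {real k * \<delta>..(real k + 1) * \<delta>} (q k))"
    using qI by (intro sum.cong) auto
  ultimately show ?thesis by (simp add: q_def[abs_def])
qed

end

context approximating_lattices begin

text \<open>One step of the lower bound, backwards in time from a piece that ends in \<open>e1\<close> to its start \<open>e0\<close>. The
rates \<open>\<mu>p\<close>, \<open>\<mu>m\<close> are constant; \<open>\<rho>\<close> is the part of their drift that the reflection cancels. The
coefficient of the quadratic grows at rate \<open>D m\<close> in order to absorb the change of the cost with the
distance from the path, and \<open>\<gamma>\<close> collects everything else.\<close>

lemma lower_step:
  assumes lat: "lat h S" and \<mu>: "0 < \<mu>p" "0 < \<mu>m"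
    and e: "e0 \<in> {a..b}" "e1 \<in> {a..b}" "\<bar>e1 - e0\<bar> \<le> w"
    and \<delta>: "0 < \<delta>" and \<rho>: "\<rho> = (\<mu>p - \<mu>m) - (e1 - e0) / \<delta>"
    and hi: "0 < \<rho> \<Longrightarrow> b - e0 \<le> w \<and> b - e1 \<le> w" and lo: "\<rho> < 0 \<Longrightarrow> e0 - a \<le> w \<and> e1 - a \<le> w"
    and D: "0 \<le> D" "0 \<le> \<epsilon>"
    and near: "\<And>x \<xi>. x \<in> S \<Longrightarrow> \<bar>\<xi> - e0\<bar> \<le> w \<Longrightarrow>
       \<bar>\<Phi>p x - \<phi>p e0\<bar> \<le> \<epsilon> + D * (pos x - \<xi>)\<^sup>2 \<and> \<bar>\<Phi>m x - \<phi>m e0\<bar> \<le> \<epsilon> + D * (pos x - \<xi>)\<^sup>2"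
    and m: "m = 2 + (\<mu>p + \<mu>m) / c0" and \<kappa>: "0 \<le> \<kappa>" "\<kappa> + \<delta> * D * m \<le> \<kappa>max"
    and \<gamma>: "\<gamma> = tilt_cost \<mu>p (\<phi>p e0) + tilt_cost \<mu>m (\<phi>m e0) + \<epsilon> * m + 4 * \<kappa>max * h * (\<mu>p + \<mu>m) + 2 * \<kappa>max * (w + h) * \<bar>\<rho>\<bar>"
    and s1: "0 \<le> s1"
    and start: "\<And>x. x \<in> S \<Longrightarrow> exp ((- \<kappa> * (pos x - e1)\<^sup>2 - c) / h) \<le> mgf h S f s1 x"
    and x: "x \<in> S"
  shows "exp ((- (\<kappa> + \<delta> * D * m) * (pos x - e0)\<^sup>2 - (c + \<delta> * \<gamma>)) / h) \<le> mgf h S f (s1 + \<delta>) x"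
proof -
  have fin: "finite S" and h: "0 < h" using lat_finite[OF lat] by auto
  have m0: "0 \<le> m" using \<mu> c0 by (simp add: m)
  define \<xi> where "\<xi> s = e1 + (e0 - e1) * ((s - s1) / \<delta>)" for s
  define K where "K s = \<kappa> + (s - s1) * D * m" for s
  define W where "W s x = - K s * (pos x - \<xi> s)\<^sup>2 - (c + (s - s1) * \<gamma>)" for s x
  define W' where "W' s x = - (D * m) * (pos x - \<xi> s)\<^sup>2 + 2 * K s * (pos x - \<xi> s) * ((e0 - e1) / \<delta>) - \<gamma>" for s x
  have W_der: "((\<lambda>s. W s x) has_real_derivative W' s x) (at s within A)" for s x A
    unfolding W_def W'_def K_def \<xi>_def using \<delta>
    by (auto intro!: derivative_eq_intros simp: power2_eq_square field_simps)
  have K: "0 \<le> K s" "K s \<le> \<kappa>max" if "s1 \<le> s" "s \<le> s1 + \<delta>" for s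
  proof -
    have "0 \<le> (s - s1) * (D * m)" "(s - s1) * (D * m) \<le> \<delta> * (D * m)"
      using that D m0 by (auto intro: mult_right_mono)
    then show "0 \<le> K s" "K s \<le> \<kappa>max" using \<kappa> by (auto simp: K_def mult.assoc)
  qed
  have \<xi>: "\<bar>\<xi> s - e0\<bar> \<le> w" "min e0 e1 \<le> \<xi> s" "\<xi> s \<le> max e0 e1" if "s1 \<le> s" "s \<le> s1 + \<delta>" for s
  proof -
    define \<theta> where "\<theta> = (s - s1) / \<delta>"
    have \<theta>: "0 \<le> \<theta>" "\<theta> \<le> 1" using that \<delta> by (auto simp: \<theta>_def)
    have x: "\<xi> s = (1 - \<theta>) * e1 + \<theta> * e0" unfolding \<xi>_def \<theta>_def[symmetric] by (simp add: algebra_simps)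
    have "\<xi> s - e0 = (1 - \<theta>) * (e1 - e0)" by (simp add: x algebra_simps)
    then have "\<bar>\<xi> s - e0\<bar> = (1 - \<theta>) * \<bar>e1 - e0\<bar>" using \<theta> by (simp add: abs_mult)
    also have "\<dots> \<le> 1 * \<bar>e1 - e0\<bar>" using \<theta> by (intro mult_right_mono) auto
    finally show "\<bar>\<xi> s - e0\<bar> \<le> w" using e(3) by simp
    have "(1 - \<theta>) * min e0 e1 \<le> (1 - \<theta>) * e1" "\<theta> * min e0 e1 \<le> \<theta> * e0"
         "(1 - \<theta>) * e1 \<le> (1 - \<theta>) * max e0 e1" "\<theta> * e0 \<le> \<theta> * max e0 e1"
      using \<theta> by (auto intro!: mult_left_mono)
    moreover have "(1 - \<theta>) * z + \<theta> * z = z" for z by (simp add: algebra_simps)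
    ultimately show "min e0 e1 \<le> \<xi> s" "\<xi> s \<le> max e0 e1" unfolding x by (metis add_mono)+
  qed
  have key: "W' s x \<le> indicator S (x + h *\<^sub>R u) * \<Phi>p x * (exp ((W s (x + h *\<^sub>R u) - W s x) / h) - 1)
      + indicator S (x - h *\<^sub>R u) * \<Phi>m x * (exp ((W s (x - h *\<^sub>R u) - W s x) / h) - 1)"
    if s: "s1 \<le> s" "s \<le> s1 + \<delta>" and x: "x \<in> S" for s x
  proof -
    define d where "d = pos x - \<xi> s"
    define \<kappa>' where "\<kappa>' = K s"
    have \<kappa>': "0 \<le> \<kappa>'" "\<kappa>' \<le> \<kappa>max" using K[OF s] by (auto simp: \<kappa>'_def)
    have rx: "c0 \<le> \<Phi>p x" "c0 \<le> \<Phi>m x" "0 < \<Phi>p x" "0 < \<Phi>m x" using rates[OF lat x] c0 by auto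
    have X: "a - h \<le> pos x" "pos x \<le> b + h" using lat_range[OF lat x] by auto
    have \<xi>ab: "\<xi> s \<in> {a..b}" using \<xi>[OF s] e by auto
    have zu: "(W s (x + h *\<^sub>R u) - W s x) / h = - \<kappa>' * (2 * d + h)"
      using h by (simp add: W_def pos_step d_def \<kappa>'_def power2_eq_square field_simps)
    have zd: "(W s (x - h *\<^sub>R u) - W s x) / h = - \<kappa>' * (- 2 * d + h)"
      using h by (simp add: W_def pos_step' d_def \<kappa>'_def power2_eq_square field_simps)
    have kh: "0 \<le> 3 * (\<kappa>' * h)" using \<kappa>' h by simp
    have side: "\<mu> * z - tilt_cost \<mu> \<Phi> - \<mu> * (3 * (\<kappa>' * h)) \<le> i * \<Phi> * (exp z - 1)"
      if "0 < \<mu>" "0 < \<Phi>" "i = 1 \<or> i = 0 \<and> z \<le> 3 * (\<kappa>' * h)" for \<mu> \<Phi> z i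
      using that(3)
    proof
      assume "i = 1"
      have "0 \<le> \<mu> * (3 * (\<kappa>' * h))" using that kh by simp
      from diff_mono[OF tilt_cost_young[OF that(1,2), of z] this] show ?thesis using \<open>i = 1\<close> by simp
    next
      assume i: "i = 0 \<and> z \<le> 3 * (\<kappa>' * h)"
      then have "\<mu> * z \<le> \<mu> * (3 * (\<kappa>' * h))" using that(1) by (intro mult_left_mono) auto
      then show ?thesis using i tilt_cost_nonneg[OF that(1,2)] by simp
    qed
    have suppressed: "- \<kappa>' * (y + h) \<le> 3 * (\<kappa>' * h)" if "- 4 * h \<le> y" for y
    proof -
      have "\<kappa>' * (- (y + h)) \<le> \<kappa>' * (3 * h)" using \<kappa>' that by (intro mult_left_mono) auto
      then show ?thesis by (simp add: algebra_simps)
    qed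
    have up: "\<mu>p * (- \<kappa>' * (2 * d + h)) - tilt_cost \<mu>p (\<Phi>p x) - \<mu>p * (3 * (\<kappa>' * h))
       \<le> indicator S (x + h *\<^sub>R u) * \<Phi>p x * (exp (- \<kappa>' * (2 * d + h)) - 1)"
    proof (rule side[OF \<mu>(1) rx(3)], cases "x + h *\<^sub>R u \<in> S")
      case False
      then have "- 4 * h \<le> 2 * d" using lat_hi[OF lat x] \<xi>ab by (auto simp: d_def)
      from suppressed[OF this] show "indicator S (x + h *\<^sub>R u) = (1::real)
        \<or> indicator S (x + h *\<^sub>R u) = (0::real) \<and> - \<kappa>' * (2 * d + h) \<le> 3 * (\<kappa>' * h)" using False by simp
    qed simp
    have dn: "\<mu>m * (- \<kappa>' * (- 2 * d + h)) - tilt_cost \<mu>m (\<Phi>m x) - \<mu>m * (3 * (\<kappa>' * h))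
       \<le> indicator S (x - h *\<^sub>R u) * \<Phi>m x * (exp (- \<kappa>' * (- 2 * d + h)) - 1)"
    proof (rule side[OF \<mu>(2) rx(4)], cases "x - h *\<^sub>R u \<in> S")
      case False
      then have "- 4 * h \<le> - 2 * d" using lat_lo[OF lat x] \<xi>ab by (auto simp: d_def)
      from suppressed[OF this] show "indicator S (x - h *\<^sub>R u) = (1::real)
        \<or> indicator S (x - h *\<^sub>R u) = (0::real) \<and> - \<kappa>' * (- 2 * d + h) \<le> 3 * (\<kappa>' * h)" using False by simp
    qed simp
    have near': "\<bar>\<Phi>p x - \<phi>p e0\<bar> \<le> \<epsilon> + D * d\<^sup>2" "\<bar>\<Phi>m x - \<phi>m e0\<bar> \<le> \<epsilon> + D * d\<^sup>2"
      using near[OF x \<xi>(1)[OF s]] by (auto simp: d_def)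
    have "tilt_cost \<mu>p (\<Phi>p x) \<le> tilt_cost \<mu>p (\<phi>p e0) + (\<epsilon> + D * d\<^sup>2) * (1 + \<mu>p / c0)"
         "tilt_cost \<mu>m (\<Phi>m x) \<le> tilt_cost \<mu>m (\<phi>m e0) + (\<epsilon> + D * d\<^sup>2) * (1 + \<mu>m / c0)"
      using \<mu> c0 rx \<phi>[OF e(1)] near' by (intro tilt_cost_diff; simp)+
    moreover have "(\<epsilon> + D * d\<^sup>2) * (1 + \<mu>p / c0) + (\<epsilon> + D * d\<^sup>2) * (1 + \<mu>m / c0) = (\<epsilon> + D * d\<^sup>2) * m"
      by (simp add: m add_divide_distrib distrib_left)
    ultimately have cost: "tilt_cost \<mu>p (\<Phi>p x) + tilt_cost \<mu>m (\<Phi>m x)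
        \<le> tilt_cost \<mu>p (\<phi>p e0) + tilt_cost \<mu>m (\<phi>m e0) + (\<epsilon> + D * d\<^sup>2) * m" by linarith
    \<comment> \<open>A positive \<open>\<rho>\<close> occurs only near \<open>b\<close>, where no state lies much above the path; likewise near \<open>a\<close>.\<close>
    have refl: "2 * \<kappa>' * (d * \<rho>) \<le> 2 * \<kappa>max * (w + h) * \<bar>\<rho>\<bar>"
    proof -
      have w0: "0 \<le> w" using e(3) by linarith
      have "d * \<rho> \<le> (w + h) * \<bar>\<rho>\<bar>"
      proof (cases \<rho> "0 :: real" rule: linorder_cases)
        case less
        then have "- d \<le> w + h" using lo X \<xi>(3)[OF s] by (auto simp: d_def)
        then have "- d * \<bar>\<rho>\<bar> \<le> (w + h) * \<bar>\<rho>\<bar>" by (rule mult_right_mono) simp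
        then show ?thesis using less by simp
      next
        case greater
        then have "d \<le> w + h" using hi X \<xi>(2)[OF s] by (auto simp: d_def)
        then have "d * \<bar>\<rho>\<bar> \<le> (w + h) * \<bar>\<rho>\<bar>" by (rule mult_right_mono) simp
        then show ?thesis using greater by simp
      qed simp
      then have "\<kappa>' * (d * \<rho>) \<le> \<kappa>' * ((w + h) * \<bar>\<rho>\<bar>)" using \<kappa>' by (intro mult_left_mono) auto
      also have "\<dots> \<le> \<kappa>max * ((w + h) * \<bar>\<rho>\<bar>)" using \<kappa>' w0 h by (intro mult_right_mono) auto
      finally show ?thesis by simp
    qed
    have jumps: "4 * (\<kappa>' * h) * (\<mu>p + \<mu>m) \<le> 4 * \<kappa>max * h * (\<mu>p + \<mu>m)"
      using \<kappa>' h \<mu> by (intro mult_right_mono) auto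
    have vel: "(e0 - e1) / \<delta> = \<rho> - (\<mu>p - \<mu>m)"
    proof -
      have "(e0 - e1) / \<delta> = - ((e1 - e0) / \<delta>)" by (simp add: diff_divide_distrib)
      then show ?thesis using \<rho> by linarith
    qed
    have "W' s x = - (D * m) * d\<^sup>2 + 2 * \<kappa>' * (d * \<rho>) - 2 * \<kappa>' * d * (\<mu>p - \<mu>m) - \<gamma>"
      unfolding W'_def vel by (simp add: d_def \<kappa>'_def algebra_simps)
    also have "\<dots> \<le> - (D * m) * d\<^sup>2 - 2 * \<kappa>' * d * (\<mu>p - \<mu>m)
        - (tilt_cost \<mu>p (\<phi>p e0) + tilt_cost \<mu>m (\<phi>m e0) + \<epsilon> * m) - 4 * (\<kappa>' * h) * (\<mu>p + \<mu>m)"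
      using refl jumps by (simp add: \<gamma>)
    also have "\<dots> \<le> - 2 * \<kappa>' * d * (\<mu>p - \<mu>m) - (tilt_cost \<mu>p (\<Phi>p x) + tilt_cost \<mu>m (\<Phi>m x)) - 4 * (\<kappa>' * h) * (\<mu>p + \<mu>m)"
      using cost by (simp add: algebra_simps)
    also have "\<dots> = (\<mu>p * (- \<kappa>' * (2 * d + h)) - tilt_cost \<mu>p (\<Phi>p x) - \<mu>p * (3 * (\<kappa>' * h)))
        + (\<mu>m * (- \<kappa>' * (- 2 * d + h)) - tilt_cost \<mu>m (\<Phi>m x) - \<mu>m * (3 * (\<kappa>' * h)))"
      by (simp add: algebra_simps)
    finally show ?thesis using up dn unfolding zu zd by linarith
  qed
  have "exp (W (s1 + \<delta>) x / h) \<le> mgf h S f (s1 + \<delta>) x"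
    unfolding mgf_def
  proof (rule semigroup_ge_subsolution[OF fin h rates_nonneg[OF lat], where w = "\<lambda>s x. exp (W s x / h)"
        and w' = "\<lambda>s x. exp (W s x / h) * (W' s x / h)"])
    show "s1 \<le> s1 + \<delta>" using \<delta> by simp
    show "((\<lambda>s. exp (W s x / h)) has_real_derivative exp (W s x / h) * (W' s x / h)) (at s within {s1..s1 + \<delta>})" for s x
      using h by (auto intro!: derivative_eq_intros W_der)
    show "exp (W s x / h) * (W' s x / h) \<le> Q h S (\<lambda>x. exp (W s x / h)) x"
      if "s1 \<le> s" "s \<le> s1 + \<delta>" "x \<in> S" for s x
    proof -
      define E where "E = exp (W s x / h)"
      have E: "exp (W s y / h) - E = E * (exp ((W s y - W s x) / h) - 1)" for y
        by (simp add: E_def algebra_simps diff_divide_distrib flip: exp_add)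
      have "Q h S (\<lambda>x. exp (W s x / h)) x
         = 1 / h * indicator S (x + h *\<^sub>R u) * \<Phi>p x * (exp (W s (x + h *\<^sub>R u) / h) - E)
         + 1 / h * indicator S (x - h *\<^sub>R u) * \<Phi>m x * (exp (W s (x - h *\<^sub>R u) / h) - E)"
        by (simp add: reaction_generator_def E_def)
      also have "\<dots> = E / h * (indicator S (x + h *\<^sub>R u) * \<Phi>p x * (exp ((W s (x + h *\<^sub>R u) - W s x) / h) - 1)
         + indicator S (x - h *\<^sub>R u) * \<Phi>m x * (exp ((W s (x - h *\<^sub>R u) - W s x) / h) - 1))"
        unfolding E by (simp add: algebra_simps)
      also have "\<dots> \<ge> E / h * W' s x"
        using key[OF that] h by (intro mult_left_mono) (auto simp: E_def)
      finally show ?thesis by (simp add: E_def)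
    qed
    show "exp (W s1 x / h) \<le> semigroup_of (Q h S) s1 (\<lambda>x. exp (f (pos x) / h)) x" if "x \<in> S" for x
      using start[OF that] by (simp add: W_def K_def \<xi>_def mgf_def)
  qed (use x in auto)
  then show ?thesis using \<delta> by (simp add: W_def K_def \<xi>_def)
qed

end

context approximating_lattices begin

text \<open>A piece on which the reflection has a net effect touches the corresponding end point. Since the pieces
are short, this confines the whole piece to a neighbourhood of that end point.\<close>

lemma reflection_sign:
  assumes int: "((\<lambda>s. m s * outer_normal a b (\<eta> s)) has_integral I) {r..q}" and m: "\<And>s. 0 \<le> m s"
  shows "0 < I \<Longrightarrow> \<exists>s\<in>{r..q}. \<eta> s = b" "I < 0 \<Longrightarrow> \<exists>s\<in>{r..q}. \<eta> s = a"
proof -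
  show "\<exists>s\<in>{r..q}. \<eta> s = b" if "0 < I"
  proof (rule ccontr)
    assume "\<not> ?thesis"
    then have "I \<le> 0"
      using m by (intro has_integral_le[OF int has_integral_0]) (auto simp: outer_normal_def)
    then show False using that by simp
  qed
  show "\<exists>s\<in>{r..q}. \<eta> s = a" if "I < 0"
  proof (rule ccontr)
    assume "\<not> ?thesis"
    then have "0 \<le> I"
      using m by (intro has_integral_le[OF has_integral_0 int]) (auto simp: outer_normal_def)
    then show False using that by simp
  qed
qed

text \<open>\<open>lower_step\<close> is iterated over a partition of \<open>[0, t]\<close>. The order of choices is: the accuracy \<open>\<epsilon>1\<close> of
the intensities, which determines \<open>D\<close> and \<open>\<kappa>max\<close>; then the oscillation \<open>w\<close> of the path on a piece;
and finally \<open>h\<close>. The sums over the pieces are bounded by integrals along the path that depend on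
none of these choices.\<close>

lemma lower_bound_quadratic:
  assumes SP: "(\<eta>, v, l) \<in> SP a b 0" and t: "0 < t" and C: "0 \<le> C"
    and energy: "(\<integral>\<^sup>+ s \<in> {0..t}. e2ennreal (L (\<eta> s) (v s)) \<partial>lebesgue) \<le> ennreal C"
    and \<kappa>0: "0 \<le> \<kappa>0" and \<epsilon>: "0 < \<epsilon>"
    and f: "\<And>z. - \<kappa>0 * (z - \<eta> t)\<^sup>2 - c1 \<le> f z"
  shows "\<exists>r>0. \<forall>h S x. lat h S \<longrightarrow> h < r \<longrightarrow> x \<in> S \<longrightarrow> \<bar>pos x\<bar> < r \<longrightarrow>
    - (C + c1 + \<epsilon>) \<le> h * ln (mgf h S f t x)"
proof -
  obtain m where dec: "set_integrable lebesgue {0..t} v \<and> m integrable_on {0..t} \<and> (\<forall>s. 0 \<le> m s) \<and>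
      continuous_on {0..t} \<eta> \<and> (\<forall>s\<ge>0. \<eta> s \<in> {a..b}) \<and> \<eta> 0 = 0 \<and>
      (\<forall>r q. 0 \<le> r \<longrightarrow> r \<le> q \<longrightarrow> q \<le> t \<longrightarrow>
        ((\<lambda>s. m s * outer_normal a b (\<eta> s)) has_integral (integral {r..q} v - (\<eta> q - \<eta> r))) {r..q})"
    using SP_decompose[OF SP t] .
  have v: "set_integrable lebesgue {0..t} v" and m: "m integrable_on {0..t}" "\<And>s. 0 \<le> m s"
    and \<eta>: "continuous_on {0..t} \<eta>" "\<And>s. 0 \<le> s \<Longrightarrow> \<eta> s \<in> {a..b}" "\<eta> 0 = 0"
    and reflect: "\<And>r q. 0 \<le> r \<Longrightarrow> r \<le> q \<Longrightarrow> q \<le> t \<Longrightarrow>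
      ((\<lambda>s. m s * outer_normal a b (\<eta> s)) has_integral (integral {r..q} v - (\<eta> q - \<eta> r))) {r..q}"
    using dec by blast+
  have v': "v integrable_on {0..t}" using v by (rule set_lebesgue_integral_eq_integral)
  have av: "(\<lambda>s. \<bar>v s\<bar>) integrable_on {0..t}"
    using set_lebesgue_integral_eq_integral(1)[OF set_integrable_abs[OF v]] .
  define V \<Lambda> where "V = integral {0..t} (\<lambda>s. \<bar>v s\<bar>)" and "\<Lambda> = integral {0..t} m"
  have V: "0 \<le> V" "0 \<le> \<Lambda>" using av m by (auto simp: V_def \<Lambda>_def intro!: Henstock_Kurzweil_Integration.integral_nonneg)
  define V1 Vm where "V1 = V + 2 * C1 * t" and "Vm = 2 * t + V1 / c0"
  have V1: "0 \<le> V1" "0 \<le> Vm" using V C1 t c0 by (auto simp: V1_def Vm_def)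
  define \<epsilon>1 where "\<epsilon>1 = \<epsilon> / (5 * (Vm + 1))"
  have \<epsilon>1: "0 < \<epsilon>1" "\<epsilon>1 * Vm \<le> \<epsilon> / 5"
  proof -
    show "0 < \<epsilon>1" using \<epsilon> V1 by (simp add: \<epsilon>1_def)
    have "\<epsilon>1 * Vm \<le> \<epsilon>1 * (Vm + 1)" using \<open>0 < \<epsilon>1\<close> by simp
    also have "\<dots> = \<epsilon> / 5" using V1 by (simp add: \<epsilon>1_def field_simps)
    finally show "\<epsilon>1 * Vm \<le> \<epsilon> / 5" .
  qed
  obtain r1 where r1: "r1 > 0" "\<And>h S x y. lat h S \<Longrightarrow> h < r1 \<Longrightarrow> x \<in> S \<Longrightarrow> y \<in> {a..b} \<Longrightarrow>
        \<bar>pos x - y\<bar> < r1 \<Longrightarrow> \<bar>\<Phi>p x - \<phi>p y\<bar> \<le> \<epsilon>1 \<and> \<bar>\<Phi>m x - \<phi>m y\<bar> \<le> \<epsilon>1"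
    using rates_close[OF \<epsilon>1(1)] by blast
  \<comment> \<open>States farther than \<open>r1 / 2\<close> from the path are paid for by the quadratic: there \<open>D d\<^sup>2 \<ge> C1\<close>.\<close>
  define D where "D = 4 * C1 / r1\<^sup>2"
  have D: "0 \<le> D" using C1 by (simp add: D_def)
  define \<kappa>max where "\<kappa>max = \<kappa>0 + D * Vm"
  have \<kappa>max: "0 \<le> \<kappa>max" "\<kappa>0 \<le> \<kappa>max" using \<kappa>0 D V1 by (auto simp: \<kappa>max_def)
  define W1 where "W1 = 2 * \<kappa>max * \<Lambda>"
  have W1: "0 \<le> W1" using \<kappa>max V by (simp add: W1_def)
  define w where "w = min (r1 / 3) (\<epsilon> / (5 * (W1 + 1)))"
  have w: "0 < w" "w < r1 / 2" "w * W1 \<le> \<epsilon> / 5"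
  proof -
    show "0 < w" using r1(1) \<epsilon> W1 by (simp add: w_def)
    have "w \<le> r1 / 3" unfolding w_def by (rule min.cobounded1)
    also have "\<dots> < r1 / 2" using r1(1) by simp
    finally show "w < r1 / 2" .
    have "w * W1 \<le> w * (W1 + 1)" using \<open>0 < w\<close> by simp
    also have "\<dots> \<le> \<epsilon> / (5 * (W1 + 1)) * (W1 + 1)" using W1 by (intro mult_right_mono) (auto simp: w_def)
    also have "\<dots> = \<epsilon> / 5" using W1 by (simp add: field_simps)
    finally show "w * W1 \<le> \<epsilon> / 5" .
  qed
  \<comment> \<open>On each piece of a fine uniform partition, the path and the intensities along it oscillate little.\<close>
  have uc: "\<exists>d>0. \<forall>s\<in>{0..t}. \<forall>s'\<in>{0..t}. \<bar>s' - s\<bar> < d \<longrightarrow> \<bar>g s' - g s\<bar> < e"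
    if "continuous_on {0..t} g" "0 < e" for g :: "real \<Rightarrow> real" and e
    using compact_uniformly_continuous[OF that(1)] that(2)
    unfolding uniformly_continuous_on_def dist_real_def by simp
  have c\<phi>: "continuous_on {0..t} (\<lambda>s. \<phi>p (\<eta> s))" "continuous_on {0..t} (\<lambda>s. \<phi>m (\<eta> s))"
    using \<eta>(2) by (auto intro!: continuous_on_compose2[OF cont(1) \<eta>(1)] continuous_on_compose2[OF cont(2) \<eta>(1)])
  obtain d1 where d1: "d1 > 0" "\<And>s s'. s \<in> {0..t} \<Longrightarrow> s' \<in> {0..t} \<Longrightarrow> \<bar>s' - s\<bar> < d1 \<Longrightarrow> \<bar>\<eta> s' - \<eta> s\<bar> < w"
    using uc[OF \<eta>(1) w(1)] by blast
  obtain d2 where d2: "d2 > 0" "\<And>s s'. s \<in> {0..t} \<Longrightarrow> s' \<in> {0..t} \<Longrightarrow> \<bar>s' - s\<bar> < d2 \<Longrightarrow> \<bar>\<phi>p (\<eta> s') - \<phi>p (\<eta> s)\<bar> < \<epsilon>1"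
    using uc[OF c\<phi>(1) \<epsilon>1(1)] by blast
  obtain d3 where d3: "d3 > 0" "\<And>s s'. s \<in> {0..t} \<Longrightarrow> s' \<in> {0..t} \<Longrightarrow> \<bar>s' - s\<bar> < d3 \<Longrightarrow> \<bar>\<phi>m (\<eta> s') - \<phi>m (\<eta> s)\<bar> < \<epsilon>1"
    using uc[OF c\<phi>(2) \<epsilon>1(1)] by blast
  define d where "d = min d1 (min d2 d3)"
  have d: "0 < d" using d1 d2 d3 by (simp add: d_def)
  obtain N :: nat where N: "t / d < real N" using reals_Archimedean2 by blast
  have "0 < t / d" using t d by simp
  then have N0: "0 < N" using N by (metis less_trans of_nat_0_less_iff)
  define \<delta> where "\<delta> = t / real N"
  have \<delta>: "0 < \<delta>" "real N * \<delta> = t" "\<delta> < d"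
    using t N0 N d by (auto simp: \<delta>_def field_simps)
  define I where "I k = {real k * \<delta>..(real k + 1) * \<delta>}" for k
  have I: "I k \<subseteq> {0..t}" "0 \<le> real k * \<delta>" "real k * \<delta> \<le> (real k + 1) * \<delta>" "(real k + 1) * \<delta> \<le> t" if "k < N" for k
  proof -
    have "(real k + 1) * \<delta> \<le> real N * \<delta>" using that \<delta>(1) by (intro mult_right_mono) auto
    then show "(real k + 1) * \<delta> \<le> t" using \<delta>(2) by simp
    then show "I k \<subseteq> {0..t}" "0 \<le> real k * \<delta>" "real k * \<delta> \<le> (real k + 1) * \<delta>"
      using \<delta>(1) by (auto simp: I_def algebra_simps)
  qed
  define e where "e k = \<eta> (real k * \<delta>)" for k
  have e_mem: "e k \<in> {a..b}" for k using \<eta>(2) \<delta>(1) by (simp add: e_def)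
  have near: "\<bar>\<eta> s - \<eta> s'\<bar> < w" "\<bar>\<phi>p (\<eta> s) - \<phi>p (\<eta> s')\<bar> < \<epsilon>1" "\<bar>\<phi>m (\<eta> s) - \<phi>m (\<eta> s')\<bar> < \<epsilon>1"
    if "k < N" "s \<in> I k" "s' \<in> I k" for k s s'
  proof -
    have st: "s \<in> {0..t}" "s' \<in> {0..t}" using I(1)[OF that(1)] that by auto
    have "\<bar>s - s'\<bar> \<le> \<delta>" using that(2,3) by (auto simp: I_def algebra_simps abs_le_iff)
    then have "\<bar>s - s'\<bar> < d1" "\<bar>s - s'\<bar> < d2" "\<bar>s - s'\<bar> < d3" using \<delta>(3) by (auto simp: d_def)
    then show "\<bar>\<eta> s - \<eta> s'\<bar> < w" "\<bar>\<phi>p (\<eta> s) - \<phi>p (\<eta> s')\<bar> < \<epsilon>1" "\<bar>\<phi>m (\<eta> s) - \<phi>m (\<eta> s')\<bar> < \<epsilon>1"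
      using d1(2)[OF st(2,1)] d2(2)[OF st(2,1)] d3(2)[OF st(2,1)] by auto
  qed
  have ends: "real k * \<delta> \<in> I k" "real (Suc k) * \<delta> \<in> I k" for k
    using \<delta>(1) by (auto simp: I_def algebra_simps)
  define vb where "vb k = integral (I k) v / \<delta>" for k
  have "\<exists>p. \<phi>p (e k) * exp p - \<phi>m (e k) * exp (-p) = vb k \<and>
      \<phi>p (e k) * exp p + \<phi>m (e k) * exp (-p) \<le> \<bar>vb k\<bar> + \<phi>p (e k) + \<phi>m (e k)" for k
    using optimal_tilt[of "\<phi>p (e k)" "\<phi>m (e k)" "vb k"] \<phi>_pos[OF e_mem[of k]] by metis
  then obtain p where p: "\<And>k. \<phi>p (e k) * exp (p k) - \<phi>m (e k) * exp (- p k) = vb k"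
      "\<And>k. \<phi>p (e k) * exp (p k) + \<phi>m (e k) * exp (- p k) \<le> \<bar>vb k\<bar> + \<phi>p (e k) + \<phi>m (e k)" by metis
  define \<mu>p \<mu>m where "\<mu>p k = \<phi>p (e k) * exp (p k)" and "\<mu>m k = \<phi>m (e k) * exp (- p k)" for k
  have \<mu>: "0 < \<mu>p k" "0 < \<mu>m k" for k using \<phi>_pos[OF e_mem[of k]] by (auto simp: \<mu>p_def \<mu>m_def)
  define M where "M k = 2 + (\<mu>p k + \<mu>m k) / c0" for k
  have M0: "0 \<le> M k" for k using \<mu>[of k] c0 by (simp add: M_def)
  define \<rho> where "\<rho> k = (\<mu>p k - \<mu>m k) - (e (Suc k) - e k) / \<delta>" for k
  have IS: "I k = {real k * \<delta>..real (Suc k) * \<delta>}" for k by (simp add: I_def add.commute)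
  have sumI: "(\<Sum>k<N. integral (I k) g) = integral {0..t} g" if "g integrable_on {0..t}" for g :: "real \<Rightarrow> real"
    using sum_integral_pieces[of g N \<delta>] that \<delta> by (simp add: I_def)
  have subint: "g integrable_on I k" if "g integrable_on {0..t}" "k < N" for g :: "real \<Rightarrow> real" and k
    using integrable_on_subinterval[OF that(1), of "real k * \<delta>" "(real k + 1) * \<delta>"] I(1)[OF that(2)] by (simp add: I_def)
  have refl: "((\<lambda>s. m s * outer_normal a b (\<eta> s)) has_integral (\<delta> * \<rho> k)) (I k)" if "k < N" for k
  proof -
    have "\<delta> * \<rho> k = integral (I k) v - (\<eta> (real (Suc k) * \<delta>) - \<eta> (real k * \<delta>))"
      using \<delta>(1) p(1)[of k] by (simp add: \<rho>_def \<mu>p_def \<mu>m_def vb_def e_def field_simps)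
    then show ?thesis
      using reflect[of "real k * \<delta>" "real (Suc k) * \<delta>"] I[OF that] by (simp add: I_def add.commute)
  qed
  have \<rho>_le: "\<delta> * \<bar>\<rho> k\<bar> \<le> integral (I k) m" if "k < N" for k
  proof -
    have mi: "(m has_integral integral (I k) m) (I k)" using subint[OF m(1) that] by (rule integrable_integral)
    have "\<delta> * \<rho> k \<le> integral (I k) m"
      using m(2) by (intro has_integral_le[OF refl[OF that] mi]) (auto simp: outer_normal_def)
    moreover have "- integral (I k) m \<le> \<delta> * \<rho> k"
      using m(2) by (intro has_integral_le[OF has_integral_neg[OF mi] refl[OF that]]) (auto simp: outer_normal_def)
    ultimately have "\<bar>\<delta> * \<rho> k\<bar> \<le> integral (I k) m" by (simp add: abs_le_iff)
    then show ?thesis using \<delta>(1) by (simp add: abs_mult)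
  qed
  have \<mu>_le: "\<delta> * (\<mu>p k + \<mu>m k) \<le> integral (I k) (\<lambda>s. \<bar>v s\<bar>) + 2 * C1 * \<delta>" if "k < N" for k
  proof -
    have "\<bar>integral (I k) v\<bar> \<le> integral (I k) (\<lambda>s. \<bar>v s\<bar>)"
      using integral_norm_bound_integral[OF subint[OF v' that] subint[OF av that]] by simp
    moreover have "\<delta> * \<bar>vb k\<bar> = \<bar>integral (I k) v\<bar>" using \<delta>(1) by (simp add: vb_def abs_div)
    moreover have "\<delta> * (\<mu>p k + \<mu>m k) \<le> \<delta> * (\<bar>vb k\<bar> + C1 + C1)"
      using p(2)[of k] \<phi>[OF e_mem[of k]] \<delta>(1) by (intro mult_left_mono) (auto simp: \<mu>p_def \<mu>m_def)
    ultimately show ?thesis by (simp add: algebra_simps)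
  qed
  have sum_\<mu>: "(\<Sum>k<N. \<delta> * (\<mu>p k + \<mu>m k)) \<le> V1"
  proof -
    have "(\<Sum>k<N. \<delta> * (\<mu>p k + \<mu>m k)) \<le> (\<Sum>k<N. integral (I k) (\<lambda>s. \<bar>v s\<bar>) + 2 * C1 * \<delta>)"
      by (intro sum_mono) (use \<mu>_le in auto)
    also have "\<dots> = V + 2 * C1 * (real N * \<delta>)" by (simp add: sum.distrib sumI[OF av] V_def)
    finally show ?thesis by (simp add: V1_def \<delta>(2))
  qed
  have sum_M: "(\<Sum>k<N. \<delta> * M k) \<le> Vm"
  proof -
    have "(\<Sum>k<N. \<delta> * M k) = (\<Sum>k<N. 2 * \<delta> + \<delta> * (\<mu>p k + \<mu>m k) / c0)"
      by (intro sum.cong) (auto simp: M_def algebra_simps)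
    also have "\<dots> = 2 * (real N * \<delta>) + (\<Sum>k<N. \<delta> * (\<mu>p k + \<mu>m k)) / c0"
      by (simp add: sum.distrib sum_divide_distrib)
    also have "\<dots> \<le> Vm" using sum_\<mu> c0 \<delta>(2) by (simp add: Vm_def divide_right_mono)
    finally show ?thesis .
  qed
  have sum_\<rho>: "(\<Sum>k<N. \<delta> * \<bar>\<rho> k\<bar>) \<le> \<Lambda>"
  proof -
    have "(\<Sum>k<N. \<delta> * \<bar>\<rho> k\<bar>) \<le> (\<Sum>k<N. integral (I k) m)" by (intro sum_mono) (use \<rho>_le in auto)
    then show ?thesis by (simp add: sumI[OF m(1)] \<Lambda>_def)
  qed
  define T where "T k = tilt_cost (\<mu>p k) (\<phi>p (e k)) + tilt_cost (\<mu>m k) (\<phi>m (e k))" for k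
  have T_le: "\<delta> * T k \<le> integral (I k) (\<lambda>s. p k * v s - H (\<eta> s) (p k)) + \<epsilon>1 * (\<delta> * M k)" if k: "k < N" for k
  proof -
    have T: "T k = p k * vb k - H (e k) (p k)"
      using lagrangian_eq(2)[of \<phi>p "e k" \<phi>m "p k" "vb k"] \<phi>_pos[OF e_mem[of k]] p(1)[of k] by (simp add: T_def \<mu>p_def \<mu>m_def)
    have Hle: "H (\<eta> s) (p k) \<le> H (e k) (p k) + \<epsilon>1 * M k" if s: "s \<in> I k" for s
    proof -
      have "0 \<le> s" using I(1)[OF k] s by auto
      then have "H (\<eta> s) (p k) \<le> H (e k) (p k) + \<epsilon>1 * (2 + (\<phi>p (e k) * exp (p k) + \<phi>m (e k) * exp (- p k)) / c0)"
        using near(2,3)[OF k s ends(1)] \<eta>(2)[of s] e_mem[of k]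
        by (intro hamiltonian_diff) (auto simp: e_def less_imp_le)
      then show ?thesis by (simp add: M_def \<mu>p_def \<mu>m_def)
    qed
    have "continuous_on {0..t} (\<lambda>s. H (\<eta> s) (p k))"
      unfolding hamiltonian_def using c\<phi> by (intro continuous_intros)
    then have Hint: "(\<lambda>s. H (\<eta> s) (p k)) integrable_on I k"
      by (intro subint[OF _ k] integrable_continuous_real)
    have lenI: "integral (I k) (\<lambda>s. c) = \<delta> * c" for c :: real
      using I(3)[OF k] by (simp add: I_def algebra_simps)
    have "integral (I k) (\<lambda>s. H (\<eta> s) (p k)) \<le> integral (I k) (\<lambda>s. H (e k) (p k) + \<epsilon>1 * M k)"
      by (rule integral_le[OF Hint]) (use Hle in \<open>auto simp: I_def\<close>)
    also have "\<dots> = \<delta> * (H (e k) (p k) + \<epsilon>1 * M k)" by (rule lenI)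
    finally have "integral (I k) (\<lambda>s. H (\<eta> s) (p k)) \<le> \<delta> * (H (e k) (p k) + \<epsilon>1 * M k)" .
    moreover have "integral (I k) (\<lambda>s. p k * v s - H (\<eta> s) (p k)) = p k * integral (I k) v - integral (I k) (\<lambda>s. H (\<eta> s) (p k))"
      using integrable_cmul[OF subint[OF v' k], of "p k"] Hint
      by (subst Henstock_Kurzweil_Integration.integral_diff) auto
    moreover have "integral (I k) v = \<delta> * vb k" using \<delta>(1) by (simp add: vb_def)
    ultimately show ?thesis by (simp add: T algebra_simps)
  qed
  have sum_T: "(\<Sum>k<N. \<delta> * T k) \<le> C + \<epsilon>1 * Vm"
  proof -
    have "(\<Sum>k<N. \<delta> * T k) \<le> (\<Sum>k<N. integral (I k) (\<lambda>s. p k * v s - H (\<eta> s) (p k)) + \<epsilon>1 * (\<delta> * M k))"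
      by (intro sum_mono) (use T_le in auto)
    also have "\<dots> = (\<Sum>k<N. integral (I k) (\<lambda>s. p k * v s - H (\<eta> s) (p k))) + \<epsilon>1 * (\<Sum>k<N. \<delta> * M k)"
      by (simp add: sum.distrib sum_distrib_left)
    also have "\<dots> \<le> C + \<epsilon>1 * Vm"
      using energy_lower_bound[OF v \<eta>(1,2) N0 \<delta>(1,2) C energy, of p] sum_M \<epsilon>1(1)
      by (intro add_mono mult_left_mono) (auto simp: I_def)
    finally show ?thesis .
  qed
  have hi: "b - e k \<le> w \<and> b - e (Suc k) \<le> w" if k: "k < N" "0 < \<rho> k" for k
  proof -
    obtain s where "s \<in> I k" "\<eta> s = b"
      using reflection_sign(1)[OF refl[OF k(1), unfolded I_def] m(2)] k(2) \<delta>(1) by (auto simp: I_def)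
    then show ?thesis using near(1)[OF k(1) _ ends(1)[of k], of s] near(1)[OF k(1) _ ends(2)[of k], of s]
      by (auto simp: e_def)
  qed
  have lo: "e k - a \<le> w \<and> e (Suc k) - a \<le> w" if k: "k < N" "\<rho> k < 0" for k
  proof -
    have "\<delta> * \<rho> k < 0" using k \<delta>(1) by (simp add: mult_pos_neg)
    then obtain s where "s \<in> I k" "\<eta> s = a"
      using reflection_sign(2)[OF refl[OF k(1), unfolded I_def] m(2)] by (auto simp: I_def)
    then show ?thesis using near(1)[OF k(1) _ ends(1)[of k], of s] near(1)[OF k(1) _ ends(2)[of k], of s]
      by (auto simp: e_def)
  qed
  define W2 where "W2 = 4 * \<kappa>max * V1 + W1"
  have W2: "0 \<le> W2" using \<kappa>max V1 W1 by (simp add: W2_def)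
  define r where "r = Min {r1, \<epsilon> / (5 * (W2 + 1)), 1, \<epsilon> / (5 * (\<kappa>max + 1))}"
  have r: "0 < r" "r \<le> r1" "r \<le> \<epsilon> / (5 * (W2 + 1))" "r \<le> 1" "r \<le> \<epsilon> / (5 * (\<kappa>max + 1))"
    using r1(1) \<epsilon> W2 \<kappa>max by (auto simp: r_def)
  have "- (C + c1 + \<epsilon>) \<le> h * ln (mgf h S f t x)"
    if lat: "lat h S" and hr: "h < r" and x: "x \<in> S" "\<bar>pos x\<bar> < r" for h S x
  proof -
    have h: "0 < h" using lat_finite[OF lat] by simp
    define \<gamma> where "\<gamma> k = T k + \<epsilon>1 * M k + 4 * \<kappa>max * h * (\<mu>p k + \<mu>m k) + 2 * \<kappa>max * (w + h) * \<bar>\<rho> k\<bar>" for k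
    define \<kappa> where "\<kappa> k = \<kappa>0 + (\<Sum>i=k..<N. \<delta> * D * M i)" for k
    define c where "c k = c1 + (\<Sum>i=k..<N. \<delta> * \<gamma> i)" for k
    have \<kappa>: "0 \<le> \<kappa> k" "\<kappa> k \<le> \<kappa>max" for k
    proof -
      show "0 \<le> \<kappa> k" unfolding \<kappa>_def using \<kappa>0 \<delta>(1) D M0 by (intro add_nonneg_nonneg sum_nonneg) auto
      have "(\<Sum>i=k..<N. \<delta> * D * M i) \<le> (\<Sum>i<N. \<delta> * D * M i)"
        using \<delta>(1) D M0 by (intro sum_mono2) auto
      also have "\<dots> = D * (\<Sum>i<N. \<delta> * M i)" by (simp add: sum_distrib_left mult_ac)
      also have "\<dots> \<le> D * Vm" using sum_M D by (intro mult_left_mono) auto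
      finally show "\<kappa> k \<le> \<kappa>max" by (simp add: \<kappa>_def \<kappa>max_def)
    qed
    have close: "\<bar>\<Phi>p x - \<phi>p (e k)\<bar> \<le> \<epsilon>1 + D * (pos x - \<xi>)\<^sup>2 \<and> \<bar>\<Phi>m x - \<phi>m (e k)\<bar> \<le> \<epsilon>1 + D * (pos x - \<xi>)\<^sup>2"
      if x: "x \<in> S" and \<xi>: "\<bar>\<xi> - e k\<bar> \<le> w" for x \<xi> k
    proof (cases "\<bar>pos x - \<xi>\<bar> < r1 / 2")
      case True
      then have "\<bar>pos x - e k\<bar> < r1" using \<xi> w(2) by linarith
      then have "\<bar>\<Phi>p x - \<phi>p (e k)\<bar> \<le> \<epsilon>1 \<and> \<bar>\<Phi>m x - \<phi>m (e k)\<bar> \<le> \<epsilon>1"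
        using r1(2)[OF lat _ x e_mem[of k]] hr r(2) by simp
      moreover have "0 \<le> D * (pos x - \<xi>)\<^sup>2" using D by simp
      ultimately show ?thesis by linarith
    next
      case False
      then have "(r1 / 2)\<^sup>2 \<le> \<bar>pos x - \<xi>\<bar>\<^sup>2" using r1(1) by (intro power_mono) auto
      then have "D * (r1 / 2)\<^sup>2 \<le> D * (pos x - \<xi>)\<^sup>2" using D by (intro mult_left_mono) auto
      moreover have "D * (r1 / 2)\<^sup>2 = C1" using r1(1) by (simp add: D_def power2_eq_square)
      ultimately show ?thesis using rates[OF lat x] \<phi>[OF e_mem[of k]] c0 \<epsilon>1(1) by (simp add: abs_le_iff)
    qed
    have steps: "j \<le> N \<Longrightarrow> \<forall>x\<in>S. exp ((- \<kappa> (N - j) * (pos x - e (N - j))\<^sup>2 - c (N - j)) / h) \<le> mgf h S f (real j * \<delta>) x" for j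
    proof (induction j)
      case 0
      have "(- \<kappa>0 * (pos x - \<eta> t)\<^sup>2 - c1) / h \<le> f (pos x) / h" for x
        using f[of "pos x"] h by (intro divide_right_mono) auto
      then show ?case using \<delta>(2) by (simp add: \<kappa>_def c_def e_def mgf_def semigroup_zero)
    next
      case (Suc j)
      define k where "k = N - Suc j"
      have k: "k < N" "N - j = Suc k" using Suc.prems by (auto simp: k_def)
      have \<kappa>_eq: "\<kappa> k = \<kappa> (Suc k) + \<delta> * D * M k" "c k = c (Suc k) + \<delta> * \<gamma> k"
        using k by (simp_all add: \<kappa>_def c_def sum.atLeast_Suc_lessThan)
      have "exp ((- \<kappa> k * (pos x - e k)\<^sup>2 - c k) / h) \<le> mgf h S f (real j * \<delta> + \<delta>) x" if x: "x \<in> S" for x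
        unfolding \<kappa>_eq
      proof (rule lower_step[OF lat \<mu>(1,2) e_mem e_mem _ \<delta>(1) \<rho>_def _ _ D _ close M_def])
        show "\<bar>e (Suc k) - e k\<bar> \<le> w" using near(1)[OF k(1) ends(2,1)] by (simp add: e_def)
        show "0 < \<rho> k \<Longrightarrow> b - e k \<le> w \<and> b - e (Suc k) \<le> w" using hi[OF k(1)] by simp
        show "\<rho> k < 0 \<Longrightarrow> e k - a \<le> w \<and> e (Suc k) - a \<le> w" using lo[OF k(1)] by simp
        show "\<kappa> (Suc k) + \<delta> * D * M k \<le> \<kappa>max" using \<kappa>(2)[of k] \<kappa>_eq by simp
        show "\<gamma> k = tilt_cost (\<mu>p k) (\<phi>p (e k)) + tilt_cost (\<mu>m k) (\<phi>m (e k)) + \<epsilon>1 * M k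
          + 4 * \<kappa>max * h * (\<mu>p k + \<mu>m k) + 2 * \<kappa>max * (w + h) * \<bar>\<rho> k\<bar>" by (simp add: \<gamma>_def T_def)
        show "exp ((- \<kappa> (Suc k) * (pos x - e (Suc k))\<^sup>2 - c (Suc k)) / h) \<le> mgf h S f (real j * \<delta>) x" if "x \<in> S" for x
          using Suc.IH Suc.prems that k(2) by simp
      qed (use x \<epsilon>1 \<kappa> \<delta>(1) in auto)
      then show ?case by (simp add: k_def algebra_simps)
    qed
    have "c 0 \<le> c1 + C + \<epsilon>1 * Vm + \<epsilon>1 * Vm + h * W2 + w * W1"
    proof -
      have "c 0 = c1 + (\<Sum>k<N. \<delta> * T k) + \<epsilon>1 * (\<Sum>k<N. \<delta> * M k) + 4 * \<kappa>max * h * (\<Sum>k<N. \<delta> * (\<mu>p k + \<mu>m k))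
          + 2 * \<kappa>max * (w + h) * (\<Sum>k<N. \<delta> * \<bar>\<rho> k\<bar>)"
        unfolding c_def atLeast0LessThan
        by (simp add: \<gamma>_def sum.distrib sum_distrib_left algebra_simps)
      also have "\<dots> \<le> c1 + (C + \<epsilon>1 * Vm) + \<epsilon>1 * Vm + 4 * \<kappa>max * h * V1 + 2 * \<kappa>max * (w + h) * \<Lambda>"
        using sum_T sum_M sum_\<mu> sum_\<rho> \<epsilon>1(1) \<kappa>max(1) h w(1)
        by (intro add_mono mult_left_mono) auto
      also have "\<dots> = c1 + C + \<epsilon>1 * Vm + \<epsilon>1 * Vm + h * W2 + w * W1"
        by (simp add: W2_def W1_def algebra_simps)
      finally show ?thesis .
    qed
    moreover have "h * W2 \<le> \<epsilon> / 5"
    proof -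
      have "h * W2 \<le> \<epsilon> / (5 * (W2 + 1)) * (W2 + 1)" using hr r(3) W2 h by (intro mult_mono) auto
      also have "\<dots> = \<epsilon> / 5" using W2 by (simp add: field_simps)
      finally show ?thesis .
    qed
    moreover have "\<kappa> 0 * (pos x)\<^sup>2 \<le> \<epsilon> / 5"
    proof -
      have "(pos x)\<^sup>2 = \<bar>pos x\<bar> * \<bar>pos x\<bar>" by (simp add: power2_eq_square)
      also have "\<dots> \<le> \<epsilon> / (5 * (\<kappa>max + 1)) * 1" using x(2) r by (intro mult_mono) auto
      finally have "\<kappa> 0 * (pos x)\<^sup>2 \<le> (\<kappa>max + 1) * (\<epsilon> / (5 * (\<kappa>max + 1)))"
        using \<kappa>[of 0] by (intro mult_mono) auto
      also have "\<dots> = \<epsilon> / 5" using \<kappa>max by (simp add: field_simps)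
      finally show ?thesis .
    qed
    ultimately have "- (C + c1 + \<epsilon>) \<le> - \<kappa> 0 * (pos x)\<^sup>2 - c 0" using \<epsilon>1(2) w(3) by linarith
    also have "\<dots> = h * ((- \<kappa> 0 * (pos x)\<^sup>2 - c 0) / h)" using h by simp
    also have "\<dots> \<le> h * ln (mgf h S f t x)"
    proof (intro mult_left_mono)
      have "exp ((- \<kappa> 0 * (pos x)\<^sup>2 - c 0) / h) \<le> mgf h S f t x"
        using steps[of N] x(1) \<delta>(2) \<eta>(3) by (simp add: e_def)
      then show "(- \<kappa> 0 * (pos x)\<^sup>2 - c 0) / h \<le> ln (mgf h S f t x)"
        using mgf_pos[OF lat less_imp_le[OF t] x(1)] by (simp add: ln_ge_iff)
    qed (use h in simp)
    finally show ?thesis .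
  qed
  then show ?thesis using r(1) by blast
qed

theorem laplace_lower_bound:
  assumes SP: "(\<eta>, v, l) \<in> SP a b 0" and t: "0 < t" and C: "0 \<le> C"
    and energy: "(\<integral>\<^sup>+ s \<in> {0..t}. e2ennreal (L (\<eta> s) (v s)) \<partial>lebesgue) \<le> ennreal C"
    and f: "\<And>x y. \<bar>f x - f y\<bar> \<le> K * \<bar>x - y\<bar>" and \<epsilon>: "0 < \<epsilon>"
  shows "\<exists>r>0. \<forall>h S x. lat h S \<longrightarrow> h < r \<longrightarrow> x \<in> S \<longrightarrow> \<bar>pos x\<bar> < r \<longrightarrow>
    f (\<eta> t) - C - \<epsilon> \<le> h * ln (mgf h S f t x)"
proof -
  have "- (K\<^sup>2 / (2 * \<epsilon>)) * (z - \<eta> t)\<^sup>2 - (\<epsilon> / 2 - f (\<eta> t)) \<le> f z" for z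
  proof -
    define d where "d = \<bar>z - \<eta> t\<bar>"
    have "0 \<le> (K * d - \<epsilon>)\<^sup>2" by simp
    then have "2 * \<epsilon> * (K * d) \<le> K\<^sup>2 * d\<^sup>2 + \<epsilon>\<^sup>2" by (simp add: power2_eq_square algebra_simps)
    then have "K * d \<le> (K\<^sup>2 * d\<^sup>2 + \<epsilon>\<^sup>2) / (2 * \<epsilon>)" using \<epsilon> by (simp add: pos_le_divide_eq mult.commute)
    also have "\<dots> = K\<^sup>2 / (2 * \<epsilon>) * (z - \<eta> t)\<^sup>2 + \<epsilon> / 2"
      using \<epsilon> by (simp add: d_def power2_eq_square field_simps)
    finally have "K * d \<le> K\<^sup>2 / (2 * \<epsilon>) * (z - \<eta> t)\<^sup>2 + \<epsilon> / 2" .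
    moreover have "f (\<eta> t) - f z \<le> K * d" using f[of "\<eta> t" z] by (simp add: d_def abs_minus_commute)
    ultimately show ?thesis by simp
  qed
  from lower_bound_quadratic[OF SP t C energy _ _ this, of "\<epsilon> / 2"] \<epsilon>
  show ?thesis by (simp add: algebra_simps)
qed

end

section \<open>The rate function and the probabilities of sets of positions\<close>

lemma lipschitz_scaled:
  assumes "0 \<le> K" "\<bar>g x - g y\<bar> \<le> \<bar>x - y\<bar>"
  shows "\<bar>- K * g x - - K * g y\<bar> \<le> K * \<bar>x - (y :: real)\<bar>"
proof -
  have "\<bar>- K * g x - - K * g y\<bar> = K * \<bar>g x - g y\<bar>"
    using assms(1) by (simp add: abs_mult abs_minus_commute flip: right_diff_distrib)
  then show ?thesis using assms by (simp add: mult_left_mono)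
qed

text \<open>A family of initial states \<open>xh h\<close> and weights \<open>\<pi> h\<close> which represent the law of the chain at time \<open>t\<close>.\<close>

locale approximating_chains = approximating_lattices +
  fixes Sh :: "real \<Rightarrow> (real^2) set" and xh :: "real \<Rightarrow> real^2" and t :: real
    and \<pi> :: "real \<Rightarrow> real^2 \<Rightarrow> real"
  assumes lat_eventually: "eventually (\<lambda>h. lat h (Sh h) \<and> xh h \<in> Sh h) (at_right 0)"
    and pos_xh: "((\<lambda>h. pos (xh h)) \<longlongrightarrow> 0) (at_right 0)"
    and zero: "0 \<in> {a..b}" and t: "0 < t"
    and \<pi>_nonneg: "0 \<le> \<pi> h x"
    and \<pi>_semigroup: "eventually (\<lambda>h. \<forall>F. semigroup_of (Q h (Sh h)) t F (xh h) = (\<Sum>x\<in>Sh h. F x * \<pi> h x)) (at_right 0)"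
    and \<pi>_sum: "eventually (\<lambda>h. (\<Sum>x\<in>Sh h. \<pi> h x) = 1) (at_right 0)"
begin

abbreviation "rate z \<equiv> action_inf \<phi>p \<phi>m a b z 0 t"

lemma eventually_in_lattice:
  assumes "\<exists>r>0. \<forall>h S x. lat h S \<longrightarrow> h < r \<longrightarrow> x \<in> S \<longrightarrow> \<bar>pos x\<bar> < r \<longrightarrow> P h S x"
  shows "eventually (\<lambda>h. P h (Sh h) (xh h)) (at_right 0)"
proof -
  obtain r where r: "r > 0" "\<And>h S x. lat h S \<Longrightarrow> h < r \<Longrightarrow> x \<in> S \<Longrightarrow> \<bar>pos x\<bar> < r \<Longrightarrow> P h S x"
    using assms by blast
  have "eventually (\<lambda>h. \<bar>pos (xh h)\<bar> < r) (at_right 0)"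
    using tendstoD[OF pos_xh r(1)] by (simp add: dist_real_def)
  moreover have "eventually (\<lambda>h. h < r) (at_right (0::real))"
    using r(1) by (auto simp: eventually_at_right_field)
  ultimately show ?thesis using lat_eventually by eventually_elim (use r(2) in auto)
qed

lemma mgf_eq_sum: "eventually (\<lambda>h. \<forall>f. mgf h (Sh h) f t (xh h) = (\<Sum>x\<in>Sh h. exp (f (pos x) / h) * \<pi> h x)) (at_right 0)"
  using \<pi>_semigroup by eventually_elim (simp add: mgf_def)

text \<open>The two Laplace bounds for the same chains show that an arbitrary reflected path is no better than
paths with finitely many linear pieces. This replaces an approximation of the path itself.\<close>

lemma value_fn_ge_path:
  assumes SP: "(\<eta>, v, l) \<in> SP a b 0" and C: "0 \<le> C"
    and energy: "(\<integral>\<^sup>+ s \<in> {0..t}. e2ennreal (L (\<eta> s) (v s)) \<partial>lebesgue) \<le> ennreal C"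
    and f: "\<And>x y. \<bar>f x - f y\<bar> \<le> K * \<bar>x - y\<bar>" and K: "0 \<le> K"
  shows "f (\<eta> t) - C \<le> value_fn f t 0"
proof (rule field_le_epsilon)
  fix e :: real assume e: "0 < e"
  then have e2: "0 < e / 2" by simp
  have "eventually (\<lambda>h. f (\<eta> t) - C \<le> value_fn f t 0 + e) (at_right (0::real))"
    using eventually_in_lattice[OF laplace_upper_bound[OF f K less_imp_le[OF t] e2 zero]]
      eventually_in_lattice[OF laplace_lower_bound[OF SP t C energy f e2]]
    by eventually_elim simp
  then show "f (\<eta> t) - C \<le> value_fn f t 0 + e" by (simp add: trivial_limit_at_right_real)
qed

lemma rate_path:
  assumes "rate z \<le> ereal c" "0 < e"
  obtains \<eta> v l where "(\<eta>, v, l) \<in> SP a b 0" "\<eta> t = z"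
    "(\<integral>\<^sup>+ s \<in> {0..t}. e2ennreal (L (\<eta> s) (v s)) \<partial>lebesgue) \<le> ennreal (c + e)" "0 \<le> c + e"
proof -
  have "\<not> (a = 0 \<and> b = 0)" using ab by auto
  then have "(INF (\<eta>, v, l) \<in> {(\<eta>, v, l) \<in> SP a b 0. \<eta> t = z}.
        enn2ereal (\<integral>\<^sup>+ s \<in> {0..t}. e2ennreal (L (\<eta> s) (v s)) \<partial>lebesgue)) < ereal (c + e)"
    using assms by (auto simp: action_inf_def intro: le_less_trans)
  then obtain \<eta> v l where p: "(\<eta>, v, l) \<in> SP a b 0" "\<eta> t = z"
      "enn2ereal (\<integral>\<^sup>+ s \<in> {0..t}. e2ennreal (L (\<eta> s) (v s)) \<partial>lebesgue) < ereal (c + e)"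
    unfolding INF_less_iff by auto
  have "0 \<le> enn2ereal (\<integral>\<^sup>+ s \<in> {0..t}. e2ennreal (L (\<eta> s) (v s)) \<partial>lebesgue)" by simp
  then have "0 < ereal (c + e)" using p(3) by (rule le_less_trans)
  then have ce: "0 \<le> c + e" by simp
  have "(\<integral>\<^sup>+ s \<in> {0..t}. e2ennreal (L (\<eta> s) (v s)) \<partial>lebesgue) \<le> ennreal (c + e)"
    unfolding less_eq_ennreal.rep_eq using p(3) ce by (simp add: enn2ereal_ennreal less_imp_le)
  then show ?thesis using that p(1,2) ce by blast
qed

text \<open>Apply \<open>value_fn_ge_path\<close> to \<open>f(x) = - K |x - z|\<close> with a large \<open>K\<close>: a nearly optimal path for this
\<open>f\<close> has to end close to \<open>z\<close>.\<close>

lemma near_reach: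
  assumes I: "rate z \<le> ereal c" and e: "0 < e" and r: "0 < r"
  shows "\<exists>z' c'. reach t 0 z' c' \<and> \<bar>z' - z\<bar> \<le> r \<and> c' \<le> c + e"
proof -
  obtain \<eta> v l where p: "(\<eta>, v, l) \<in> SP a b 0" "\<eta> t = z"
    "(\<integral>\<^sup>+ s \<in> {0..t}. e2ennreal (L (\<eta> s) (v s)) \<partial>lebesgue) \<le> ennreal (c + e / 2)" "0 \<le> c + e / 2"
    using rate_path[OF I half_gt_zero[OF e]] .
  define K where "K = (c + e) / r"
  have K: "0 \<le> K" using p(4) e r by (simp add: K_def)
  define f where "f x = - K * \<bar>x - z\<bar>" for x
  have f: "\<bar>f x - f y\<bar> \<le> K * \<bar>x - y\<bar>" for x y
    unfolding f_def by (rule lipschitz_scaled[OF K]) linarith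
  have "f (\<eta> t) - (c + e / 2) \<le> value_fn f t 0" by (rule value_fn_ge_path[OF p(1,4,3) f K])
  then have "\<not> value_fn f t 0 \<le> - (c + e)" using e p(2) by (simp add: f_def)
  then obtain z' c' where zc: "reach t 0 z' c'" "- (c + e) < f z' - c'"
    using value_fn_le[of f K t 0 "- (c + e)", OF f K] t zero by force
  have "0 \<le> c'" using reach_bounds[OF zc(1)] by simp
  then have "K * \<bar>z' - z\<bar> \<le> c + e" "c' \<le> c + e"
    using zc(2) mult_nonneg_nonneg[OF K abs_ge_zero[of "z' - z"]] by (auto simp: f_def)
  moreover have "\<bar>z' - z\<bar> \<le> r"
  proof -
    have "0 < c + e" using p(4) e by simp
    moreover have "(c + e) * \<bar>z' - z\<bar> \<le> (c + e) * r"
      using \<open>K * \<bar>z' - z\<bar> \<le> c + e\<close> r by (simp add: K_def pos_divide_le_eq)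
    ultimately show ?thesis by simp
  qed
  ultimately show ?thesis using zc(1) by blast
qed

text \<open>A path that ends near \<open>z\<close> is compressed by the factor \<open>1 + \<sigma>\<close>, and the time \<open>\<tau>\<close> gained is used to walk
to \<open>z\<close> with speed at most \<open>1\<close>.\<close>

lemma reach_limit:
  assumes near: "\<And>r. 0 < r \<Longrightarrow> \<exists>z' c'. reach t 0 z' c' \<and> \<bar>z' - z\<bar> \<le> r \<and> c' \<le> c"
    and z: "z \<in> {a..b}" and e: "0 < e"
  shows "\<exists>c'. reach t 0 z c' \<and> c' \<le> c + e"
proof -
  define W where "W = 4 * C1 * exp 1 + 4 * C1"
  have W: "0 \<le> W" using C1 by (simp add: W_def)
  obtain z0 c2 where "reach t 0 z0 c2" "c2 \<le> c" using near[of 1] by auto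
  then have c: "0 \<le> c" using reach_bounds by fastforce
  define B where "B = 2 * c + W * t + t * speed_cost 1"
  have B: "0 \<le> B" using c W t speed_cost_nonneg[of 1] by (simp add: B_def)
  define \<sigma> where "\<sigma> = e / (B + 1)"
  have \<sigma>: "0 < \<sigma>" "\<sigma> * B \<le> e" using e B by (auto simp: \<sigma>_def field_simps)
  define \<tau> where "\<tau> = t * \<sigma> / (1 + \<sigma>)"
  have \<tau>: "0 < \<tau>" "\<tau> \<le> t * \<sigma>" "t / (1 + \<sigma>) + \<tau> = t"
  proof -
    show "0 < \<tau>" using t \<sigma> by (simp add: \<tau>_def)
    show "\<tau> \<le> t * \<sigma>" using t \<sigma> by (simp add: \<tau>_def divide_le_eq)
    have "t / (1 + \<sigma>) + \<tau> = t * (1 + \<sigma>) / (1 + \<sigma>)" by (simp add: \<tau>_def distrib_left add_divide_distrib)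
    then show "t / (1 + \<sigma>) + \<tau> = t" using \<sigma> by simp
  qed
  obtain z' c' where zc: "reach t 0 z' c'" "\<bar>z' - z\<bar> \<le> \<tau>" "c' \<le> c" using near[OF \<tau>(1)] by blast
  have c': "0 \<le> c'" "z' \<in> {a..b}" using reach_bounds[OF zc(1)] by auto
  have "reach (t / (1 + \<sigma>)) 0 z' (c' + ln (1 + \<sigma>) * (2 * c' + W * t))"
    using reach_compress[OF _ zc(1), of "1 + \<sigma>"] \<sigma> by (simp add: W_def)
  moreover have "reach \<tau> z' z (\<tau> * speed_cost 1)"
    using \<tau>(1) c' z zc(2) by (intro reach_straight) (auto simp: abs_minus_commute)
  ultimately have "reach t 0 z (c' + ln (1 + \<sigma>) * (2 * c' + W * t) + \<tau> * speed_cost 1)"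
    using reach_trans[of "t / (1 + \<sigma>)" 0 z' _ \<tau> z] \<tau>(3) by metis
  moreover have "c' + ln (1 + \<sigma>) * (2 * c' + W * t) + \<tau> * speed_cost 1 \<le> c + e"
  proof -
    have "ln (1 + \<sigma>) \<le> \<sigma>" using \<sigma> by (simp add: ln_add_one_self_le_self)
    then have "ln (1 + \<sigma>) * (2 * c' + W * t) \<le> \<sigma> * (2 * c + W * t)"
      using zc(3) c' W t \<sigma> by (intro mult_mono) auto
    moreover have "\<tau> * speed_cost 1 \<le> t * \<sigma> * speed_cost 1"
      using \<tau>(2) speed_cost_nonneg by (intro mult_right_mono)
    moreover have "\<sigma> * (2 * c + W * t) + t * \<sigma> * speed_cost 1 = \<sigma> * B" by (simp add: B_def algebra_simps)
    ultimately show ?thesis using \<sigma>(2) zc(3) by linarith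
  qed
  ultimately show ?thesis by blast
qed

lemma rate_sublevel_closed: "closed {z \<in> {a..b}. rate z \<le> ereal c}"
proof -
  have *: "z \<in> {z \<in> {a..b}. rate z \<le> ereal c}" if z: "\<And>r. 0 < r \<Longrightarrow> \<exists>y\<in>{z \<in> {a..b}. rate z \<le> ereal c}. dist y z < r" for z
  proof -
    have "z \<in> {a..b}"
      using z closed_approachable[of "{a..b}" z] by fastforce
    moreover have "rate z \<le> ereal c"
    proof (rule ereal_le_epsilon2)
      fix e :: real assume e: "0 < e"
      have "\<exists>z' c'. reach t 0 z' c' \<and> \<bar>z' - z\<bar> \<le> r \<and> c' \<le> c + e / 2" if r: "0 < r" for r
      proof -
        obtain y where y: "rate y \<le> ereal c" "dist y z < r / 2" using z[of "r / 2"] r by auto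
        then obtain z' c' where "reach t 0 z' c'" "\<bar>z' - y\<bar> \<le> r / 2" "c' \<le> c + e / 2"
          using near_reach[of y c "e / 2" "r / 2"] e r by auto
        moreover from this(2) y(2) have "\<bar>z' - z\<bar> \<le> r" unfolding dist_real_def by linarith
        ultimately show ?thesis by blast
      qed
      from reach_limit[OF this \<open>z \<in> {a..b}\<close> half_gt_zero[OF e]]
      obtain c' where "reach t 0 z c'" "c' \<le> c + e" by auto
      then show "rate z \<le> ereal c + ereal e" using reach_imp_action[of t 0 z c'] by (auto intro: order_trans)
    qed
    ultimately show ?thesis by simp
  qed
  show ?thesis
    unfolding closure_subset_eq[symmetric]
  proof
    fix z assume "z \<in> closure {z \<in> {a..b}. rate z \<le> ereal c}"
    then show "z \<in> {z \<in> {a..b}. rate z \<le> ereal c}"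
      unfolding closure_approachable by (intro *) blast
  qed
qed

text \<open>The sublevel set of \<open>\<alpha>\<close> has a positive distance \<open>\<rho>\<close> from \<open>Z\<close>. For \<open>f = - (\<alpha> / \<rho>) infdist(., Z)\<close> the
value function is at most \<open>- \<alpha>\<close>, while \<open>f\<close> is nearly \<open>0\<close> on the states in question.\<close>

lemma upper_bound_closed:
  assumes Z: "closed Z" "Z \<subseteq> {a..b}" "Z \<noteq> {}" and \<alpha>: "0 < \<alpha>" and I: "\<And>z. z \<in> Z \<Longrightarrow> ereal \<alpha> < rate z"
    and A: "\<And>h. A h \<subseteq> Sh h" and near: "\<And>r. 0 < r \<Longrightarrow> eventually (\<lambda>h. \<forall>x\<in>A h. infdist (pos x) Z \<le> r) (at_right 0)"
    and e: "0 < e"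
  shows "eventually (\<lambda>h. (\<Sum>x\<in>A h. \<pi> h x) \<le> exp ((- \<alpha> + e) / h)) (at_right 0)"
proof -
  define B where "B = {z \<in> {a..b}. rate z \<le> ereal \<alpha>}"
  have "compact Z" using Z(1,2) compact_Icc by (meson bounded_subset compact_eq_bounded_closed compact_imp_bounded)
  moreover have "closed B" unfolding B_def by (rule rate_sublevel_closed)
  moreover have "Z \<inter> B = {}" using I by (auto simp: B_def not_le[symmetric])
  ultimately obtain \<rho> where \<rho>: "\<rho> > 0" "\<And>z y. z \<in> Z \<Longrightarrow> y \<in> B \<Longrightarrow> \<rho> \<le> dist z y"
    using separate_compact_closed by metis
  define K where "K = \<alpha> / \<rho>"
  have K: "0 < K" using \<alpha> \<rho> by (simp add: K_def)
  define f where "f z = - K * infdist z Z" for z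
  have f: "\<bar>f x - f y\<bar> \<le> K * \<bar>x - y\<bar>" for x y
    unfolding f_def using infdist_triangle_abs[of x Z y]
    by (intro lipschitz_scaled less_imp_le[OF K]) (simp add: dist_real_def)
  have U: "value_fn f t 0 \<le> - \<alpha>"
  proof (rule value_fn_le[OF f less_imp_le[OF K]])
    fix z c assume zc: "reach t 0 z c"
    have Ic: "rate z \<le> ereal c" by (rule reach_imp_action[OF zc])
    show "f z - c \<le> - \<alpha>"
    proof (cases "rate z \<le> ereal \<alpha>")
      case True
      then have "z \<in> B" using reach_bounds[OF zc] by (simp add: B_def)
      then have "\<rho> \<le> infdist z Z"
        using \<rho>(2) Z(3) by (simp add: infdist_def dist_commute cINF_greatest)
      then have "K * \<rho> \<le> K * infdist z Z" using K by simp
      moreover have "K * \<rho> = \<alpha>" using \<rho>(1) by (simp add: K_def)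
      ultimately show ?thesis using reach_bounds[OF zc] by (simp add: f_def)
    next
      case False
      then have "\<alpha> < c" using Ic by (metis ereal_less_eq(3) not_le order_trans)
      moreover have "f z \<le> 0" using K infdist_nonneg[of z Z] by (simp add: f_def)
      ultimately show ?thesis by simp
    qed
  qed (use t zero in auto)
  define r where "r = e / (2 * K)"
  have r: "0 < r" using e K by (simp add: r_def)
  have e2: "0 < e / 2" using e by simp
  have pos_h: "eventually (\<lambda>h. (0::real) < h) (at_right 0)" by (simp add: eventually_at_right_less)
  show ?thesis
    using eventually_in_lattice[OF laplace_upper_bound[OF f less_imp_le[OF K] less_imp_le[OF t] e2 zero]]
      near[OF r] mgf_eq_sum lat_eventually pos_h
  proof eventually_elim
    case (elim h)
    have fin: "finite (Sh h)" using lat_finite elim(4) by blast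
    let ?m = "mgf h (Sh h) f t (xh h)"
    have m: "0 < ?m" using mgf_pos elim(4) t by simp
    have "exp (- (e / 2) / h) * (\<Sum>x\<in>A h. \<pi> h x) = (\<Sum>x\<in>A h. exp (- (e / 2) / h) * \<pi> h x)"
      by (simp add: sum_distrib_left)
    also have "\<dots> \<le> (\<Sum>x\<in>A h. exp (f (pos x) / h) * \<pi> h x)"
    proof (intro sum_mono mult_right_mono \<pi>_nonneg)
      fix x assume "x \<in> A h"
      then have "K * infdist (pos x) Z \<le> K * r" using elim(2) K by simp
      also have "K * r = e / 2" using K by (simp add: r_def)
      finally have "- (e / 2) \<le> f (pos x)" by (simp add: f_def)
      then show "exp (- (e / 2) / h) \<le> exp (f (pos x) / h)"
        unfolding exp_le_cancel_iff using elim(5) by (intro divide_right_mono) auto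
    qed
    also have "\<dots> \<le> (\<Sum>x\<in>Sh h. exp (f (pos x) / h) * \<pi> h x)"
      using fin A \<pi>_nonneg by (intro sum_mono2) auto
    also have "\<dots> = ?m" using elim(3) by simp
    also have "\<dots> = exp (ln ?m)" using m by simp
    also have "\<dots> \<le> exp ((- \<alpha> + e / 2) / h)"
      using elim(1,5) U by (simp add: field_simps)
    finally have "(\<Sum>x\<in>A h. \<pi> h x) \<le> exp ((- \<alpha> + e / 2) / h) / exp (- (e / 2) / h)"
      by (simp add: pos_le_divide_eq mult.commute)
    also have "\<dots> = exp ((- \<alpha> + e) / h)"
    proof -
      have "- \<alpha> + e / 2 - (- (e / 2)) = - \<alpha> + e" by linarith
      then show ?thesis by (simp only: exp_diff[symmetric] diff_divide_distrib[symmetric])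
    qed
    finally show ?case .
  qed
qed

text \<open>For \<open>f(x) = - K |x - z|\<close> with \<open>K r = c + e + 1\<close> the states outside the ball contribute at most
\<open>exp (- (c + e + 1) / h)\<close>, which is negligible.\<close>

lemma lower_bound_ball:
  assumes I: "rate z \<le> ereal c" and e: "0 < e" and r: "0 < r"
  shows "eventually (\<lambda>h. exp (- (c + e) / h) \<le> (\<Sum>x\<in>{x \<in> Sh h. \<bar>pos x - z\<bar> < r}. \<pi> h x)) (at_right 0)"
proof -
  have e4: "0 < e / 4" using e by simp
  obtain \<eta> v l where p: "(\<eta>, v, l) \<in> SP a b 0" "\<eta> t = z"
    "(\<integral>\<^sup>+ s \<in> {0..t}. e2ennreal (L (\<eta> s) (v s)) \<partial>lebesgue) \<le> ennreal (c + e / 4)" "0 \<le> c + e / 4"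
    using rate_path[OF I e4] .
  \<comment> \<open>The surplus \<open>1\<close> makes the contribution of the states outside the ball negligible.\<close>
  define K where "K = (c + e + 1) / r"
  have K: "0 \<le> K" using p(4) e r by (simp add: K_def)
  define f where "f x = - K * \<bar>x - z\<bar>" for x
  have f: "\<bar>f x - f y\<bar> \<le> K * \<bar>x - y\<bar>" for x y
    unfolding f_def by (rule lipschitz_scaled[OF K]) linarith
  have small: "eventually (\<lambda>h. 0 < h \<and> h < e / 4 \<and> h < 1) (at_right (0::real))"
    using e by (auto simp: eventually_at_right_field intro!: exI[of _ "min 1 (e / 4)"])
  show ?thesis
    using eventually_in_lattice[OF laplace_lower_bound[OF p(1) t p(4,3) f e4]] mgf_eq_sum lat_eventually \<pi>_sum small
  proof eventually_elim
    case (elim h)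
    have fin: "finite (Sh h)" using lat_finite elim(3) by blast
    have h: "0 < h" "h < e / 4" "h < 1" using elim(5) by auto
    let ?m = "mgf h (Sh h) f t (xh h)" and ?A = "{x \<in> Sh h. \<bar>pos x - z\<bar> < r}"
    have m: "0 < ?m" using mgf_pos elim(3) t by simp
    have "f (\<eta> t) = 0" by (simp add: f_def p(2))
    then have "- (c + e / 2) \<le> ln ?m * h" using elim(1) by (simp add: mult.commute)
    then have "- (c + e / 2) / h \<le> ln ?m" unfolding pos_divide_le_eq[OF h(1)] .
    then have lower: "exp (- (c + e / 2) / h) \<le> ?m" using m by (simp add: ln_ge_iff)
    define g where "g x = exp (f (pos x) / h) * \<pi> h x" for x
    have "?m = sum g (Sh h)" using elim(2) by (simp add: g_def)
    also have "\<dots> = sum g (Sh h - ?A) + sum g ?A" by (rule sum.subset_diff) (use fin in auto)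
    finally have "?m = (\<Sum>x\<in>?A. exp (f (pos x) / h) * \<pi> h x) + (\<Sum>x\<in>Sh h - ?A. exp (f (pos x) / h) * \<pi> h x)"
      by (simp add: g_def)
    also have "\<dots> \<le> (\<Sum>x\<in>?A. \<pi> h x) + exp (- (c + e + 1) / h)"
    proof (rule add_mono)
      have "exp (f (pos x) / h) \<le> 1" for x using K h by (simp add: f_def divide_nonpos_pos)
      then show "(\<Sum>x\<in>?A. exp (f (pos x) / h) * \<pi> h x) \<le> (\<Sum>x\<in>?A. \<pi> h x)"
        using \<pi>_nonneg by (intro sum_mono mult_left_le_one_le) auto
      have "(\<Sum>x\<in>Sh h - ?A. exp (f (pos x) / h) * \<pi> h x) \<le> (\<Sum>x\<in>Sh h - ?A. exp (- (c + e + 1) / h) * \<pi> h x)"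
      proof (intro sum_mono mult_right_mono \<pi>_nonneg)
        fix x assume "x \<in> Sh h - ?A"
        then have "K * r \<le> K * \<bar>pos x - z\<bar>" using K by (intro mult_left_mono) auto
        then have "f (pos x) \<le> - (c + e + 1)" using r by (simp add: f_def K_def)
        then show "exp (f (pos x) / h) \<le> exp (- (c + e + 1) / h)"
          unfolding exp_le_cancel_iff using h by (intro divide_right_mono) auto
      qed
      also have "\<dots> = exp (- (c + e + 1) / h) * (\<Sum>x\<in>Sh h - ?A. \<pi> h x)" by (simp add: sum_distrib_left)
      also have "\<dots> \<le> exp (- (c + e + 1) / h) * (\<Sum>x\<in>Sh h. \<pi> h x)"
        using fin \<pi>_nonneg by (intro mult_left_mono sum_mono2) auto
      also have "\<dots> = exp (- (c + e + 1) / h)" using elim(4) by simp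
      finally show "(\<Sum>x\<in>Sh h - ?A. exp (f (pos x) / h) * \<pi> h x) \<le> exp (- (c + e + 1) / h)" .
    qed
    finally have "exp (- (c + e / 2) / h) - exp (- (c + e + 1) / h) \<le> (\<Sum>x\<in>?A. \<pi> h x)" using lower by simp
    moreover have "2 * exp (- (c + e) / h) \<le> exp (- (c + e / 2) / h)"
    proof -
      have "2 \<le> exp (e / (2 * h))"
      proof -
        have "1 \<le> e / (2 * h)" using h by (simp add: field_simps)
        then show ?thesis using exp_ge_add_one_self[of "e / (2 * h)"] by linarith
      qed
      then have "2 * exp (- (c + e) / h) \<le> exp (e / (2 * h)) * exp (- (c + e) / h)" by simp
      also have "\<dots> = exp (- (c + e / 2) / h)" using h by (simp add: field_simps flip: exp_add)
      finally show ?thesis .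
    qed
    moreover have "exp (- (c + e + 1) / h) \<le> exp (- (c + e) / h)"
      using h by (simp add: divide_right_mono)
    ultimately show ?case by linarith
  qed
qed

end

section \<open>Large deviation principles in the plane\<close>

lemma action_inf_nonneg: "0 \<le> action_inf \<phi>p \<phi>m a b y \<alpha> t"
  unfolding action_inf_def by (auto intro!: INF_greatest)

lemma measure_distr_finite_range:
  assumes M: "prob_space M" and X: "X \<in> borel_measurable M" and fin: "finite S"
    and S: "\<And>\<omega>. \<omega> \<in> space M \<Longrightarrow> X \<omega> \<in> S" and F: "F \<in> sets (borel :: (real^2) measure)"
  shows "measure (distr M borel X) F = (\<Sum>x\<in>S \<inter> F. measure M {\<omega> \<in> space M. X \<omega> = x})"
proof -
  interpret prob_space M by fact
  have "measure (distr M borel X) F = measure M (X -` F \<inter> space M)"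
    by (rule measure_distr[OF X F])
  also have "X -` F \<inter> space M = (\<Union>x\<in>S \<inter> F. {\<omega> \<in> space M. X \<omega> = x})" using S by auto
  also have "measure M \<dots> = (\<Sum>x\<in>S \<inter> F. measure M {\<omega> \<in> space M. X \<omega> = x})"
  proof (rule finite_measure_finite_Union)
    have "{\<omega> \<in> space M. X \<omega> = x} = X -` {x} \<inter> space M" for x by auto
    then have "{\<omega> \<in> space M. X \<omega> = x} \<in> sets M" for x using measurable_sets[OF X, of "{x}"] by simp
    then show "(\<lambda>x. {\<omega> \<in> space M. X \<omega> = x}) ` (S \<inter> F) \<subseteq> sets M" by auto
  qed (use fin in \<open>auto simp: disjoint_family_on_def\<close>)
  finally show ?thesis .
qed

lemma ereal_le_uminusI:
  assumes "\<And>\<alpha>::real. ereal \<alpha> < I \<Longrightarrow> l \<le> - ereal \<alpha>"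
  shows "l \<le> - (I :: ereal)"
proof (rule ccontr)
  assume "\<not> l \<le> - I"
  then have "- l < I" by (simp add: ereal_uminus_less_reorder not_le)
  then obtain \<alpha> where "- l < ereal \<alpha>" "ereal \<alpha> < I" using ereal_dense2 by blast
  then have "- ereal \<alpha> < l" "l \<le> - ereal \<alpha>"
    using assms[of \<alpha>] ereal_uminus_less_reorder[of l "ereal \<alpha>"] by auto
  then show False by simp
qed

lemma ln_ext_le: "0 \<le> p \<Longrightarrow> p \<le> exp (c / h) \<Longrightarrow> 0 < h \<Longrightarrow> ereal h * ln_ext p \<le> ereal c"
proof (cases "p = 0")
  case False
  assume "0 \<le> p" "p \<le> exp (c / h)" "0 < h"
  then have "ln p \<le> c / h" using False by (metis exp_ln exp_le_cancel_iff less_eq_real_def)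
  then show ?thesis using \<open>0 < h\<close> False by (simp add: ln_ext_def field_simps)
qed (simp add: ln_ext_def)

lemma ln_ext_ge: "exp (c / h) \<le> p \<Longrightarrow> 0 < h \<Longrightarrow> ereal c \<le> ereal h * ln_ext p"
proof -
  assume p: "exp (c / h) \<le> p" and h: "0 < h"
  have p0: "0 < p" using p exp_gt_zero[of "c / h"] by linarith
  then have "c / h \<le> ln p" using p by (simp add: ln_ge_iff)
  then show ?thesis using p0 h by (simp add: ln_ext_def field_simps)
qed

text \<open>Concentration at the single point \<open>x0\<close>, without any condition on the speed at which it happens, because
every neighbourhood has full measure for small \<open>h\<close>.\<close>

lemma degenerate_principle:
  fixes J :: "'a::metric_space \<Rightarrow> ereal"
  assumes D: "closed D" "x0 \<in> D"
    and J: "\<And>y. y \<in> D \<Longrightarrow> J y = (if y = x0 then 0 else \<infinity>)"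
    and \<mu>: "eventually (\<lambda>h. prob_space (\<mu> h) \<and> sets (\<mu> h) = sets borel \<and> measure (\<mu> h) D = 1) (at_right 0)"
    and conc: "\<And>T. open T \<Longrightarrow> x0 \<in> T \<Longrightarrow> eventually (\<lambda>h. measure (\<mu> h) T = 1) (at_right 0)"
  shows "good_rate_function D J \<and> satisfies_LDP D \<mu> J"
proof
  have sub: "{y \<in> D. J y \<le> ereal c} = (if 0 \<le> c then {x0} else {})" for c
    using D(2) J by (auto split: if_splits)
  show "good_rate_function D J"
    unfolding good_rate_function_def sub using J D by (auto intro!: closed_subset)
  show "satisfies_LDP D \<mu> J"
    unfolding satisfies_LDP_def
  proof (intro conjI allI impI)
    fix F assume F: "closedin (top_of_set D) F"
    then have FD: "F \<subseteq> D" "closed F" using D(1) by (auto simp: closedin_closed_eq)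
    show "Limsup (at_right 0) (\<lambda>h. ereal h * ln_ext (measure (\<mu> h) F)) \<le> - (INF y\<in>F. J y)"
    proof (cases "x0 \<in> F")
      case True
      have "(INF y\<in>F. J y) \<le> 0" using INF_lower[OF True, of J] J[of x0] D(2) by simp
      then have "0 \<le> - (INF y\<in>F. J y)" by (simp add: ereal_0_le_uminus_iff)
      moreover have "Limsup (at_right 0) (\<lambda>h. ereal h * ln_ext (measure (\<mu> h) F)) \<le> ereal 0"
      proof (rule Limsup_bounded)
        show "eventually (\<lambda>h. ereal h * ln_ext (measure (\<mu> h) F) \<le> ereal 0) (at_right 0)"
          using \<mu> eventually_at_right_less[of 0]
        proof eventually_elim
          case (elim h)
          then show ?case by (intro ln_ext_le) (auto intro: prob_space.prob_le_1)
        qed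
      qed
      ultimately show ?thesis unfolding zero_ereal_def[symmetric] by (rule order_trans[rotated])
    next
      case False
      have out: "eventually (\<lambda>h. measure (\<mu> h) (- F) = 1) (at_right 0)"
        by (rule conc) (use FD False in auto)
      have "Limsup (at_right 0) (\<lambda>h. ereal h * ln_ext (measure (\<mu> h) F)) \<le> -\<infinity>"
      proof (rule Limsup_bounded)
        show "eventually (\<lambda>h. ereal h * ln_ext (measure (\<mu> h) F) \<le> -\<infinity>) (at_right 0)"
          using \<mu> out eventually_at_right_less[of "0::real"]
        proof eventually_elim
          case (elim h)
          interpret prob_space "\<mu> h" using elim(1) by simp
          have sp: "space (\<mu> h) = UNIV" using sets_eq_imp_space_eq[of "\<mu> h" borel] elim(1) by simp
          have "F \<in> sets (\<mu> h)" using FD(2) elim(1) by simp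
          then have "prob (space (\<mu> h) - F) = 1 - prob F" by (rule prob_compl)
          then have "prob F = 0" using elim(2) sp by (simp add: Compl_eq_Diff_UNIV)
          then show ?case using elim by (simp add: ln_ext_def)
        qed
      qed
      then show ?thesis by simp
    qed
  next
    fix G assume G: "openin (top_of_set D) G"
    then obtain T where T: "open T" "G = D \<inter> T" by (auto simp: openin_open)
    show "- (INF y\<in>G. J y) \<le> Liminf (at_right 0) (\<lambda>h. ereal h * ln_ext (measure (\<mu> h) G))"
    proof (cases "x0 \<in> G")
      case True
      have inT: "eventually (\<lambda>h. measure (\<mu> h) T = 1) (at_right 0)"
        by (rule conc) (use T True in auto)
      have "0 \<le> (INF y\<in>G. J y)" using T J by (intro INF_greatest) auto
      then have "- (INF y\<in>G. J y) \<le> ereal 0" by (simp add: ereal_uminus_le_0_iff zero_ereal_def[symmetric])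
      also have "\<dots> \<le> Liminf (at_right 0) (\<lambda>h. ereal h * ln_ext (measure (\<mu> h) G))"
      proof (rule Liminf_bounded)
        show "eventually (\<lambda>h. ereal 0 \<le> ereal h * ln_ext (measure (\<mu> h) G)) (at_right 0)"
          using \<mu> inT eventually_at_right_less[of "0::real"]
        proof eventually_elim
          case (elim h)
          interpret prob_space "\<mu> h" using elim(1) by simp
          have ev: "D \<in> sets (\<mu> h)" "T \<in> sets (\<mu> h)" using elim(1) D(1) T(1) by auto
          have "AE x in \<mu> h. x \<in> D" "AE x in \<mu> h. x \<in> T"
            using prob_eq_1[OF ev(1)] prob_eq_1[OF ev(2)] elim(1,2) by auto
          then have "AE x in \<mu> h. x \<in> D \<inter> T" by eventually_elim simp
          then have "prob (D \<inter> T) = 1" using ev by (simp add: prob_eq_1 sets.Int)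
          then show ?case using elim T by (intro ln_ext_ge) auto
        qed
      qed
      finally show ?thesis .
    next
      case False
      then have "(INF y\<in>G. J y) = \<infinity>" using T J by (intro antisym[OF _ INF_greatest]) auto
      then show ?thesis by simp
    qed
  qed
qed

text \<open>The situation of the theorem with a general compact convex set \<open>D\<close> and orthogonal vectors \<open>u\<close>, \<open>w\<close>.\<close>

locale reaction_family =
  fixes D :: "(real^2) set" and u w x0 :: "real^2" and \<Phi>p \<Phi>m :: "real^2 \<Rightarrow> real" and c0 h0 :: real
    and \<omega>0 \<beta> r :: "real \<Rightarrow> real" and k0 :: "real \<Rightarrow> int" and xh :: "real \<Rightarrow> real^2"
    and M :: "real \<Rightarrow> 'w measure" and X :: "real \<Rightarrow> real \<Rightarrow> 'w \<Rightarrow> real^2"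
  assumes D: "compact D" "convex D" and u: "u \<noteq> 0" and orth: "w \<bullet> u = 0"
    and c0: "c0 > 0" and cont: "continuous_on D \<Phi>p" "continuous_on D \<Phi>m"
    and ge: "\<And>x. x \<in> D \<Longrightarrow> \<Phi>p x \<ge> c0 \<and> \<Phi>m x \<ge> c0"
    and x0: "x0 \<in> D" and modulus: "segment_modulus D x0 u w \<omega>0" and h0: "h0 > 0"
    and xh: "\<And>h. 0 < h \<Longrightarrow> h < h0 \<Longrightarrow>
        xh h = x0 + \<beta> h *\<^sub>R w + (r h + of_int (k0 h) * h) *\<^sub>R u \<and> xh h \<in> D"
    and \<beta>: "\<And>h. 0 < h \<Longrightarrow> h < h0 \<Longrightarrow> max (\<omega>0 \<bar>\<beta> h\<bar>) \<bar>\<beta> h\<bar> \<le> h"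
    and r_lim: "(r \<longlongrightarrow> 0) (at_right 0)"
    and \<alpha>0_lim: "((\<lambda>h. of_int (k0 h) * h) \<longlongrightarrow> (0::real)) (at_right 0)"
    and process: "\<And>h. 0 < h \<Longrightarrow> h < h0 \<Longrightarrow>
        markov_chain_on (M h) (X h) (lattice_states D x0 u w (\<beta> h) (r h) h)
          (reaction_generator (lattice_states D x0 u w (\<beta> h) (r h) h) u \<Phi>p \<Phi>m h) (xh h)"
begin

definition pos :: "real^2 \<Rightarrow> real" where "pos x = ((x - x0) \<bullet> u) / (norm u)\<^sup>2"

abbreviation "a \<equiv> seg_lo D x0 u w 0"
abbreviation "b \<equiv> seg_hi D x0 u w 0"
abbreviation "S0 \<equiv> segment D x0 u w 0"
definition "Sh h = lattice_states D x0 u w (\<beta> h) (r h) h"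

lemma pos_affine: "pos (x0 + \<gamma> *\<^sub>R w + \<alpha> *\<^sub>R u) = \<alpha>"
  using u orth by (simp add: pos_def inner_add_left power2_norm_eq_inner)

lemma pos_step: "pos (x + k *\<^sub>R u) = pos x + k"
  using u by (simp add: pos_def inner_add_left inner_diff_left power2_norm_eq_inner add_divide_distrib diff_divide_distrib)

lemma in_segment_iff:
  assumes "segment D x0 u w \<gamma> \<noteq> {}"
  shows "x0 + \<gamma> *\<^sub>R w + \<alpha> *\<^sub>R u \<in> D \<longleftrightarrow> seg_lo D x0 u w \<gamma> \<le> \<alpha> \<and> \<alpha> \<le> seg_hi D x0 u w \<gamma>"
proof -
  have "x0 + \<gamma> *\<^sub>R w + \<alpha> *\<^sub>R u \<in> D \<longleftrightarrow> x0 + \<gamma> *\<^sub>R w + \<alpha> *\<^sub>R u \<in> segment D x0 u w \<gamma>"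
    by (auto simp: segment_def)
  also have "\<dots> \<longleftrightarrow> seg_lo D x0 u w \<gamma> \<le> \<alpha> \<and> \<alpha> \<le> seg_hi D x0 u w \<gamma>"
    unfolding segment_eq[OF D u assms] using u by auto
  finally show ?thesis .
qed

lemma S0_eq: "S0 = (\<lambda>\<alpha>. x0 + \<alpha> *\<^sub>R u) ` {a..b}" and zero_mem: "a \<le> 0" "0 \<le> b"
proof -
  have "x0 \<in> S0" using x0 by (auto simp: segment_def intro!: exI[of _ 0])
  then have ne: "S0 \<noteq> {}" by auto
  show "S0 = (\<lambda>\<alpha>. x0 + \<alpha> *\<^sub>R u) ` {a..b}" using segment_eq[OF D u ne] by auto
  show "a \<le> 0" "0 \<le> b" using in_segment_iff[OF ne, of 0] x0 by auto
qed

lemma S0_mem: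
  assumes "\<alpha> \<in> {a..b}"
  shows "x0 + \<alpha> *\<^sub>R u \<in> D"
proof -
  have "x0 + \<alpha> *\<^sub>R u \<in> S0" unfolding S0_eq using assms by blast
  then show ?thesis by (simp add: segment_def)
qed

lemma pos_S0: "y \<in> S0 \<Longrightarrow> pos y \<in> {a..b} \<and> y = x0 + pos y *\<^sub>R u"
  unfolding S0_eq using pos_affine[of 0] by auto

definition lat :: "real \<Rightarrow> (real^2) set \<Rightarrow> bool" where
  "lat h S \<longleftrightarrow> 0 < h \<and> finite S \<and> (\<exists>\<beta> r. \<bar>\<beta>\<bar> \<le> h \<and> S = lattice_states D x0 u w \<beta> r h \<and>
     (segment D x0 u w \<beta> \<noteq> {} \<longrightarrow> \<bar>seg_lo D x0 u w \<beta> - a\<bar> \<le> h \<and> \<bar>seg_hi D x0 u w \<beta> - b\<bar> \<le> h))"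

text \<open>The end points of the segment that carries the lattice differ from \<open>a\<close> and \<open>b\<close> by at most \<open>h\<close>, and an
extreme lattice point is within \<open>h\<close> of its end point; this explains the \<open>2 h\<close>.\<close>

lemma lat_coordinates:
  assumes "lat h S" "x \<in> S"
  shows "x \<in> D" "\<exists>\<beta>. \<bar>\<beta>\<bar> \<le> h \<and> x = x0 + \<beta> *\<^sub>R w + pos x *\<^sub>R u" "a - h \<le> pos x \<and> pos x \<le> b + h"
    "x + h *\<^sub>R u \<notin> S \<Longrightarrow> b - 2 * h \<le> pos x" "x - h *\<^sub>R u \<notin> S \<Longrightarrow> pos x \<le> a + 2 * h"
proof -
  obtain \<beta> r where br: "\<bar>\<beta>\<bar> \<le> h" "S = lattice_states D x0 u w \<beta> r h"
     "segment D x0 u w \<beta> \<noteq> {} \<longrightarrow> \<bar>seg_lo D x0 u w \<beta> - a\<bar> \<le> h \<and> \<bar>seg_hi D x0 u w \<beta> - b\<bar> \<le> h"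
    using assms(1) by (auto simp: lat_def)
  obtain k :: int where k: "x = x0 + \<beta> *\<^sub>R w + (r + of_int k * h) *\<^sub>R u" "x \<in> D"
    using assms(2) br(2) by (auto simp: lattice_states_def)
  have px: "pos x = r + of_int k * h" unfolding k(1) by (rule pos_affine)
  have x: "x = x0 + \<beta> *\<^sub>R w + pos x *\<^sub>R u" using k(1) px by simp
  show "x \<in> D" by fact
  show "\<exists>\<beta>. \<bar>\<beta>\<bar> \<le> h \<and> x = x0 + \<beta> *\<^sub>R w + pos x *\<^sub>R u" using x br(1) by blast
  have ne: "segment D x0 u w \<beta> \<noteq> {}" using x k(2) by (auto simp: segment_def)
  have lohi: "seg_lo D x0 u w \<beta> \<le> pos x" "pos x \<le> seg_hi D x0 u w \<beta>" using in_segment_iff[OF ne, of "pos x"] x k(2) by auto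
  have near: "\<bar>seg_lo D x0 u w \<beta> - a\<bar> \<le> h" "\<bar>seg_hi D x0 u w \<beta> - b\<bar> \<le> h" using br(3) ne by auto
  show "a - h \<le> pos x \<and> pos x \<le> b + h" using lohi near by linarith
  have up: "x + h *\<^sub>R u = x0 + \<beta> *\<^sub>R w + (pos x + h) *\<^sub>R u" "x - h *\<^sub>R u = x0 + \<beta> *\<^sub>R w + (pos x - h) *\<^sub>R u"
    by (subst x, simp add: algebra_simps)+
  have h: "0 < h" using assms(1) by (simp add: lat_def)
  have mem: "x0 + \<beta> *\<^sub>R w + (r + of_int j * h) *\<^sub>R u \<in> S" if "x0 + \<beta> *\<^sub>R w + (r + of_int j * h) *\<^sub>R u \<in> D" for j :: int
    using that br(2) by (auto simp: lattice_states_def)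
  show "b - 2 * h \<le> pos x" if "x + h *\<^sub>R u \<notin> S"
  proof -
    have "pos x + h = r + of_int (k + 1) * h" using px by (simp add: algebra_simps)
    then have "x0 + \<beta> *\<^sub>R w + (pos x + h) *\<^sub>R u \<notin> D" using that mem[of "k + 1"] up by auto
    then show ?thesis using in_segment_iff[OF ne, of "pos x + h"] lohi near h by auto
  qed
  show "pos x \<le> a + 2 * h" if "x - h *\<^sub>R u \<notin> S"
  proof -
    have "pos x - h = r + of_int (k - 1) * h" using px by (simp add: algebra_simps)
    then have "x0 + \<beta> *\<^sub>R w + (pos x - h) *\<^sub>R u \<notin> D" using that mem[of "k - 1"] up by auto
    then show ?thesis using in_segment_iff[OF ne, of "pos x - h"] lohi near h by auto
  qed
qed

lemma lat_dist:
  assumes "lat h S" "x \<in> S"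
  shows "dist x (x0 + y *\<^sub>R u) \<le> h * norm w + \<bar>pos x - y\<bar> * norm u"
proof -
  obtain \<beta> where b: "\<bar>\<beta>\<bar> \<le> h" "x = x0 + \<beta> *\<^sub>R w + pos x *\<^sub>R u" using lat_coordinates(2)[OF assms] by blast
  have "x - (x0 + y *\<^sub>R u) = \<beta> *\<^sub>R w + (pos x - y) *\<^sub>R u"
    by (subst b(2)) (simp add: algebra_simps)
  then have "dist x (x0 + y *\<^sub>R u) \<le> \<bar>\<beta>\<bar> * norm w + \<bar>pos x - y\<bar> * norm u"
    unfolding dist_norm by (metis norm_scaleR norm_triangle_ineq)
  also have "\<dots> \<le> h * norm w + \<bar>pos x - y\<bar> * norm u" using b(1) by (intro add_mono mult_right_mono) auto
  finally show ?thesis .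
qed

lemma lat_close:
  assumes "0 < \<rho>"
  obtains d where "0 < d" "\<And>h S x y. lat h S \<Longrightarrow> h < d \<Longrightarrow> x \<in> S \<Longrightarrow> \<bar>pos x - y\<bar> < d \<Longrightarrow> dist x (x0 + y *\<^sub>R u) < \<rho>"
proof -
  have nu: "0 < norm w + norm u + 1" by (simp add: add_nonneg_pos)
  define d where "d = \<rho> / (norm w + norm u + 1)"
  have d: "0 < d" using assms nu by (simp add: d_def)
  have "dist x (x0 + y *\<^sub>R u) < \<rho>" if l: "lat h S" "x \<in> S" and "h < d" "\<bar>pos x - y\<bar> < d" for h S x y
  proof -
    have "dist x (x0 + y *\<^sub>R u) \<le> h * norm w + \<bar>pos x - y\<bar> * norm u" by (rule lat_dist[OF l])
    also have "\<dots> \<le> d * norm w + d * norm u" using that by (intro add_mono mult_right_mono) auto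
    also have "\<dots> < d * (norm w + norm u + 1)" using d by (simp add: distrib_left)
    also have "\<dots> = \<rho>" using nu by (simp add: d_def)
    finally show ?thesis .
  qed
  then show ?thesis using that[OF d] by blast
qed

lemma lat_eventually: "eventually (\<lambda>h. 0 < h \<and> h < h0 \<and> lat h (Sh h) \<and> xh h \<in> Sh h) (at_right 0)"
proof -
  obtain d where d: "d > 0" "\<And>\<beta>. \<bar>\<beta>\<bar> < d \<Longrightarrow> segment D x0 u w \<beta> \<noteq> {} \<Longrightarrow>
        \<bar>seg_lo D x0 u w \<beta> - a\<bar> \<le> \<omega>0 \<bar>\<beta>\<bar> \<and> \<bar>seg_hi D x0 u w \<beta> - b\<bar> \<le> \<omega>0 \<bar>\<beta>\<bar>"
    using modulus by (auto simp: segment_modulus_def)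
  have "eventually (\<lambda>h. 0 < h \<and> h < h0 \<and> h < d) (at_right (0::real))"
    using h0 d(1) by (auto simp: eventually_at_right_field intro!: exI[of _ "min h0 d"])
  then show ?thesis
  proof eventually_elim
    case (elim h)
    have "finite (Sh h)" using process[of h] elim by (simp add: markov_chain_on_def Sh_def)
    moreover have "\<bar>\<beta> h\<bar> \<le> h" "\<omega>0 \<bar>\<beta> h\<bar> \<le> h" using \<beta>[of h] elim by auto
    moreover have "segment D x0 u w (\<beta> h) \<noteq> {} \<longrightarrow> \<bar>seg_lo D x0 u w (\<beta> h) - a\<bar> \<le> h \<and> \<bar>seg_hi D x0 u w (\<beta> h) - b\<bar> \<le> h"
      using d(2)[of "\<beta> h"] calculation(2,3) elim by linarith
    ultimately have "lat h (Sh h)" using elim unfolding lat_def Sh_def by blast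
    moreover have "xh h \<in> Sh h" using xh[of h] elim unfolding Sh_def lattice_states_def by blast
    ultimately show ?case using elim by simp
  qed
qed

lemma eventually_small: "0 < d \<Longrightarrow> eventually (\<lambda>h. 0 < h \<and> h < d) (at_right (0::real))"
  by (auto simp: eventually_at_right_field)

lemma pos_xh: "((\<lambda>h. pos (xh h)) \<longlongrightarrow> 0) (at_right 0)"
proof -
  have "((\<lambda>h. r h + of_int (k0 h) * h) \<longlongrightarrow> 0 + 0) (at_right 0)"
    by (intro tendsto_add r_lim \<alpha>0_lim)
  moreover have "eventually (\<lambda>h. r h + of_int (k0 h) * h = pos (xh h)) (at_right 0)"
    using eventually_small[OF h0] by eventually_elim (simp add: xh pos_affine)
  ultimately show ?thesis using Lim_transform_eventually by fastforce
qed

definition law :: "real \<Rightarrow> real \<Rightarrow> real^2 \<Rightarrow> real" where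
  "law t h x = measure (M h) {\<omega> \<in> space (M h). X h t \<omega> = x}"

text \<open>The Markov property enters only here, for the single time \<open>0\<close>, at which the state is known.\<close>

lemma law_semigroup:
  assumes t: "0 \<le> t" and h: "0 < h" "h < h0"
  shows "semigroup_of (reaction_generator (Sh h) u \<Phi>p \<Phi>m h) t F (xh h) = (\<Sum>x\<in>Sh h. F x * law t h x)"
proof -
  let ?Q = "reaction_generator (Sh h) u \<Phi>p \<Phi>m h"
  note mc = process[OF h, folded Sh_def, unfolded markov_chain_on_def]
  interpret prob_space "M h" using mc by blast
  have fin: "finite (Sh h)" and ms: "\<And>t. 0 \<le> t \<Longrightarrow> X h t \<in> borel_measurable (M h)" and start: "AE \<omega> in M h. X h 0 \<omega> = xh h"
    using mc by auto
  have x: "xh h \<in> Sh h" using xh[OF h] unfolding Sh_def lattice_states_def by blast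
  have "law t h y = semigroup_of ?Q t (indicator {y}) (xh h)" if y: "y \<in> Sh h" for y
  proof -
    have "prob {\<omega> \<in> space (M h). (\<forall>i\<le>0::nat. X h ((\<lambda>_. 0) i) \<omega> = (\<lambda>_. xh h) i) \<and> X h t \<omega> = y}
       = prob {\<omega> \<in> space (M h). \<forall>i\<le>0::nat. X h ((\<lambda>_. 0) i) \<omega> = (\<lambda>_. xh h) i} * semigroup_of ?Q (t - (\<lambda>_. 0) (0::nat)) (indicator {y}) ((\<lambda>_. xh h) (0::nat))"
      using mc t x y by (elim conjE allE[of _ "0::nat"] allE[of _ "\<lambda>_. 0"] allE[of _ "\<lambda>_. xh h"]) auto
    then have eq: "prob {\<omega> \<in> space (M h). X h 0 \<omega> = xh h \<and> X h t \<omega> = y}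
       = prob {\<omega> \<in> space (M h). X h 0 \<omega> = xh h} * semigroup_of ?Q t (indicator {y}) (xh h)" by simp
    have s: "{\<omega> \<in> space (M h). X h s \<omega> = z} \<in> sets (M h)" if "0 \<le> s" for s z
    proof -
      have "{\<omega> \<in> space (M h). X h s \<omega> = z} = X h s -` {z} \<inter> space (M h)" by auto
      then show ?thesis using measurable_sets[OF ms[OF that], of "{z}"] by simp
    qed
    have "prob {\<omega> \<in> space (M h). X h 0 \<omega> = xh h} = 1" using start s[of 0] by (simp add: prob_Collect_eq_1)
    moreover have "prob {\<omega> \<in> space (M h). X h 0 \<omega> = xh h \<and> X h t \<omega> = y} = law t h y"
      unfolding law_def
    proof (rule finite_measure_eq_AE)
      show "AE \<omega> in M h. \<omega> \<in> {\<omega> \<in> space (M h). X h 0 \<omega> = xh h \<and> X h t \<omega> = y} \<longleftrightarrow> \<omega> \<in> {\<omega> \<in> space (M h). X h t \<omega> = y}"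
        using start by eventually_elim auto
      have "{\<omega> \<in> space (M h). X h 0 \<omega> = xh h \<and> X h t \<omega> = y} = {\<omega> \<in> space (M h). X h 0 \<omega> = xh h} \<inter> {\<omega> \<in> space (M h). X h t \<omega> = y}" by auto
      then show "{\<omega> \<in> space (M h). X h 0 \<omega> = xh h \<and> X h t \<omega> = y} \<in> sets (M h)" using s[of 0] s[OF t] by simp
    qed (rule s[OF t])
    ultimately show ?thesis using eq by simp
  qed
  then show ?thesis using semigroup_expand[OF fin reaction_generator_matrix[OF fin] x, where f = F and t = t] by simp
qed

lemma measure_eq_law:
  assumes t: "0 \<le> t" and h: "0 < h" "h < h0" and F: "F \<in> sets borel"
  shows "measure (distr (M h) borel (X h t)) F = (\<Sum>x\<in>Sh h \<inter> F. law t h x)"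
proof -
  note mc = process[OF h, folded Sh_def, unfolded markov_chain_on_def]
  show ?thesis unfolding law_def by (rule measure_distr_finite_range) (use mc t F in auto)
qed

lemma distr_prob:
  assumes t: "0 \<le> t" and h: "0 < h" "h < h0"
  shows "prob_space (distr (M h) borel (X h t))"
  using process[OF h] t by (auto simp: markov_chain_on_def intro: prob_space.prob_space_distr)

lemma law_sum:
  assumes t: "0 \<le> t" and h: "0 < h" "h < h0"
  shows "(\<Sum>x\<in>Sh h. law t h x) = 1"
  using measure_eq_law[OF t h, of UNIV] prob_space.prob_space[OF distr_prob[OF t h]] by simp

text \<open>The states lie within \<open>h (norm w + norm u)\<close> of the limiting segment.\<close>

lemma avoid_compact:
  assumes G: "compact G" "G \<inter> S0 = {}"
  shows "eventually (\<lambda>h. Sh h \<inter> G = {}) (at_right 0)"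
proof -
  have "compact S0" unfolding S0_eq by (intro compact_continuous_image continuous_intros compact_Icc)
  then obtain d where d: "d > 0" "\<And>x y. x \<in> G \<Longrightarrow> y \<in> S0 \<Longrightarrow> d \<le> dist x y"
    using separate_compact_closed[OF G(1) compact_imp_closed G(2)] by metis
  have "0 < norm w + norm u" using u by (simp add: add_nonneg_pos)
  then have "0 < d / (norm w + norm u)" using d(1) by simp
  from eventually_small[OF this] lat_eventually show ?thesis
  proof eventually_elim
    case (elim h)
    have "x \<notin> G" if x: "x \<in> Sh h" for x
    proof
      assume xG: "x \<in> G"
      define y where "y = max a (min b (pos x))"
      have y: "y \<in> {a..b}" "\<bar>pos x - y\<bar> \<le> h"
        using lat_coordinates(3)[of h "Sh h" x] elim x zero_mem by (auto simp: y_def)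
      then have "x0 + y *\<^sub>R u \<in> S0" unfolding S0_eq by blast
      then have "d \<le> dist x (x0 + y *\<^sub>R u)" using d(2) xG by blast
      also have "\<dots> \<le> h * norm w + \<bar>pos x - y\<bar> * norm u" using lat_dist elim x by blast
      also have "\<dots> \<le> h * (norm w + norm u)" using y(2) by (simp add: distrib_left mult_right_mono)
      also have "\<dots> < d" using elim(1) \<open>0 < norm w + norm u\<close> by (simp add: pos_less_divide_eq)
      finally show False by simp
    qed
    then show ?case by auto
  qed
qed

abbreviation "\<phi>p \<equiv> \<lambda>\<alpha>. \<Phi>p (x0 + \<alpha> *\<^sub>R u)"
abbreviation "\<phi>m \<equiv> \<lambda>\<alpha>. \<Phi>m (x0 + \<alpha> *\<^sub>R u)"
abbreviation "J t \<equiv> \<lambda>y. rate_function D u w \<Phi>p \<Phi>m y x0 t"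
abbreviation "\<mu> t \<equiv> \<lambda>h. distr (M h) borel (X h t)"

lemma J_eq: "J t y = (if y \<in> S0 then action_inf \<phi>p \<phi>m a b (pos y) 0 t else \<infinity>)"
  by (simp add: rate_function_def pos_def)

lemma J_nonneg: "0 \<le> J t y"
  by (simp add: J_eq action_inf_nonneg)

lemma bounded_rates: "\<exists>C1. \<forall>x\<in>D. \<Phi>p x \<le> C1 \<and> \<Phi>m x \<le> C1"
proof -
  have "bounded (\<Phi>p ` D)" "bounded (\<Phi>m ` D)"
    using cont D(1) by (auto intro: compact_imp_bounded compact_continuous_image)
  then obtain B1 B2 where "\<forall>x\<in>D. \<bar>\<Phi>p x\<bar> \<le> B1" "\<forall>x\<in>D. \<bar>\<Phi>m x\<bar> \<le> B2" by (auto simp: bounded_iff)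
  then show ?thesis by (intro exI[of _ "max B1 B2"]) (force simp: abs_le_iff)
qed

lemma reflected_segment_axioms_hold:
  assumes "a < b" "\<forall>x\<in>D. \<Phi>p x \<le> C1 \<and> \<Phi>m x \<le> C1"
  shows "reflected_segment a b c0 C1 \<phi>p \<phi>m"
proof
  show "continuous_on {a..b} \<phi>p" "continuous_on {a..b} \<phi>m"
    using S0_mem by (auto intro!: continuous_on_compose2[OF cont(1)] continuous_on_compose2[OF cont(2)] continuous_intros)
qed (use assms c0 ge S0_mem in auto)

end

context reaction_family begin

lemma eventually_prob:
  assumes t: "0 \<le> t"
  shows "eventually (\<lambda>h. prob_space (\<mu> t h) \<and> sets (\<mu> t h) = sets borel \<and> measure (\<mu> t h) D = 1) (at_right 0)"
  using lat_eventually
proof eventually_elim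
  case (elim h)
  have "Sh h \<inter> D = Sh h" by (auto simp: Sh_def lattice_states_def)
  moreover have "D \<in> sets borel" using D(1) by (simp add: borel_compact)
  ultimately show ?case
    using elim measure_eq_law[OF t, of h D] law_sum[OF t, of h] distr_prob[OF t, of h] by simp
qed

lemma principle_degenerate_segment:
  assumes t: "0 \<le> t" and ab: "\<not> a < b"
  shows "good_rate_function D (J t) \<and> satisfies_LDP D (\<mu> t) (J t)"
proof (rule degenerate_principle[OF compact_imp_closed[OF D(1)] x0 _ eventually_prob[OF t]])
  have ab0: "a = 0" "b = 0" using ab zero_mem by auto
  have S0: "S0 = {x0}" unfolding S0_eq by (simp add: ab0)
  show "J t y = (if y = x0 then 0 else \<infinity>)" for y
    using S0 by (simp add: J_eq pos_def action_inf_def ab0)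
  fix T assume T: "open T" "x0 \<in> T"
  have "compact (D - T)" using D(1) T(1) by (simp add: compact_diff)
  then have "eventually (\<lambda>h. Sh h \<inter> (D - T) = {}) (at_right 0)"
    by (rule avoid_compact) (use S0 T in auto)
  then show "eventually (\<lambda>h. measure (\<mu> t h) T = 1) (at_right 0)"
    using lat_eventually
  proof eventually_elim
    case (elim h)
    have "Sh h \<inter> T = Sh h" using elim(1) by (auto simp: Sh_def lattice_states_def)
    then show ?case using elim measure_eq_law[OF t, of h T] law_sum[OF t, of h] T(1) by simp
  qed
qed

lemma principle_initial_time:
  assumes ab: "a < b"
  shows "good_rate_function D (J 0) \<and> satisfies_LDP D (\<mu> 0) (J 0)"
proof (rule degenerate_principle[OF compact_imp_closed[OF D(1)] x0 _ eventually_prob])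
  obtain C1 where C1: "\<forall>x\<in>D. \<Phi>p x \<le> C1 \<and> \<Phi>m x \<le> C1" using bounded_rates by blast
  interpret reflected_segment a b c0 C1 \<phi>p \<phi>m by (rule reflected_segment_axioms_hold[OF ab C1])
  have x0S: "x0 \<in> S0" unfolding S0_eq using zero_mem by (auto intro!: image_eqI[of _ _ 0])
  show "J 0 y = (if y = x0 then 0 else \<infinity>)" for y
  proof (cases "y \<in> S0")
    case True
    show ?thesis
    proof (cases "pos y = 0")
      case True
      then have "y = x0" using pos_S0[OF \<open>y \<in> S0\<close>] by simp
      moreover have "action_inf \<phi>p \<phi>m a b 0 0 0 \<le> ereal 0"
        by (rule reach_imp_action[OF stop]) (use zero_mem in auto)
      then have "action_inf \<phi>p \<phi>m a b 0 0 0 = 0"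
        using action_inf_nonneg[of \<phi>p \<phi>m a b 0 0 0] by (simp add: zero_ereal_def[symmetric])
      ultimately show ?thesis using x0S True by (simp add: J_eq)
    next
      case False
      then have "y \<noteq> x0" by (auto simp: pos_def)
      moreover have none: "{(\<eta>, v, l) \<in> SP a b 0. \<eta> 0 = pos y} = {}" using False by (auto simp: SP_def)
      have "action_inf \<phi>p \<phi>m a b (pos y) 0 0 = \<infinity>"
        unfolding action_inf_def none using False by (simp add: top_ereal_def)
      ultimately show ?thesis using \<open>y \<in> S0\<close> by (simp add: J_eq)
    qed
  next
    case False
    then show ?thesis using x0S by (auto simp: J_eq)
  qed
  fix T assume T: "open T" "x0 \<in> T"
  obtain \<rho> where \<rho>: "\<rho> > 0" "ball x0 \<rho> \<subseteq> T" using T by (meson openE)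
  obtain d where d: "0 < d" "\<And>h S x y. lat h S \<Longrightarrow> h < d \<Longrightarrow> x \<in> S \<Longrightarrow> \<bar>pos x - y\<bar> < d \<Longrightarrow> dist x (x0 + y *\<^sub>R u) < \<rho>"
    using lat_close[OF \<rho>(1)] by metis
  have "eventually (\<lambda>h. \<bar>pos (xh h)\<bar> < d) (at_right 0)"
    using tendstoD[OF pos_xh d(1)] by (simp add: dist_real_def)
  then show "eventually (\<lambda>h. measure (\<mu> 0 h) T = 1) (at_right 0)"
    using lat_eventually eventually_small[OF d(1)]
  proof eventually_elim
    case (elim h)
    have h: "0 < h" "h < h0" using elim by auto
    have "dist (xh h) (x0 + 0 *\<^sub>R u) < \<rho>" by (rule d(2)[of h "Sh h"]) (use elim in auto)
    then have "xh h \<in> T" using \<rho>(2) by (auto simp: dist_commute)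
    moreover have "AE \<omega> in M h. X h 0 \<omega> = xh h" and X0: "X h 0 \<in> borel_measurable (M h)"
      and ps: "prob_space (M h)"
      using process[OF h] by (auto simp: markov_chain_on_def)
    ultimately have "AE \<omega> in M h. X h 0 \<omega> \<in> T" by auto
    then have "AE x in \<mu> 0 h. x \<in> T" using X0 T(1) by (subst AE_distr_iff) auto
    then show ?case
      using prob_space.prob_eq_1[OF distr_prob[of 0 h], of T] h T(1) by simp
  qed
qed simp

text \<open>Since the states approach the limiting segment uniformly, sets in the plane are exchanged for the sets
of their positions. For a closed set \<open>F\<close> the states in \<open>F\<close> have positions close to those of the points
of \<open>F\<close> on the segment, by compactness.\<close>

lemma principle_positive_time:
  assumes ab: "a < b" and t: "0 < t"
  shows "good_rate_function D (J t) \<and> satisfies_LDP D (\<mu> t) (J t)"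
proof -
  obtain C1 where C1: "\<forall>x\<in>D. \<Phi>p x \<le> C1 \<and> \<Phi>m x \<le> C1" using bounded_rates by blast
  interpret seg: reflected_segment a b c0 C1 \<phi>p \<phi>m by (rule reflected_segment_axioms_hold[OF ab C1])
  have t0: "0 \<le> t" using t by simp
  have uc: "\<exists>d>0. \<forall>x\<in>D. \<forall>y\<in>D. dist x y < d \<longrightarrow> \<bar>f x - f y\<bar> \<le> e" if fe: "continuous_on D f" "0 < e" for f :: "real^2 \<Rightarrow> real" and e
  proof -
    obtain d where "d > 0" "\<forall>x\<in>D. \<forall>x'\<in>D. dist x' x < d \<longrightarrow> dist (f x') (f x) < e"
      using compact_uniformly_continuous[OF fe(1) D(1)] fe(2) unfolding uniformly_continuous_on_def by metis
    then show ?thesis by (intro exI[of _ d]) (auto simp: dist_real_def less_imp_le)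
  qed
  note lat_ev = lat_eventually
  interpret approximating_chains a b c0 C1 \<phi>p \<phi>m u pos \<Phi>p \<Phi>m lat Sh xh t "law t"
  proof unfold_locales
    show "lat h S \<Longrightarrow> finite S \<and> 0 < h" for h S by (simp add: lat_def)
    show "pos (x + k *\<^sub>R u) = pos x + k" for x k by (rule pos_step)
    show "lat h S \<Longrightarrow> x \<in> S \<Longrightarrow> a - h \<le> pos x \<and> pos x \<le> b + h" for h S x by (rule lat_coordinates(3))
    show "lat h S \<Longrightarrow> x \<in> S \<Longrightarrow> x + h *\<^sub>R u \<notin> S \<Longrightarrow> b - 2 * h \<le> pos x" for h S x by (rule lat_coordinates(4))
    show "lat h S \<Longrightarrow> x \<in> S \<Longrightarrow> x - h *\<^sub>R u \<notin> S \<Longrightarrow> pos x \<le> a + 2 * h" for h S x by (rule lat_coordinates(5))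
    show "lat h S \<Longrightarrow> x \<in> S \<Longrightarrow> c0 \<le> \<Phi>p x \<and> \<Phi>p x \<le> C1 \<and> c0 \<le> \<Phi>m x \<and> \<Phi>m x \<le> C1" for h S x
      using lat_coordinates(1) ge C1 by blast
    show "\<exists>r>0. \<forall>h S x y. lat h S \<longrightarrow> h < r \<longrightarrow> x \<in> S \<longrightarrow> y \<in> {a..b} \<longrightarrow> \<bar>pos x - y\<bar> < r \<longrightarrow>
        \<bar>\<Phi>p x - \<Phi>p (x0 + y *\<^sub>R u)\<bar> \<le> e \<and> \<bar>\<Phi>m x - \<Phi>m (x0 + y *\<^sub>R u)\<bar> \<le> e" if e: "0 < e" for e
    proof -
      obtain d1 where d1: "d1 > 0" "\<And>x y. x \<in> D \<Longrightarrow> y \<in> D \<Longrightarrow> dist x y < d1 \<Longrightarrow> \<bar>\<Phi>p x - \<Phi>p y\<bar> \<le> e"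
        using uc[OF cont(1) e] by blast
      obtain d2 where d2: "d2 > 0" "\<And>x y. x \<in> D \<Longrightarrow> y \<in> D \<Longrightarrow> dist x y < d2 \<Longrightarrow> \<bar>\<Phi>m x - \<Phi>m y\<bar> \<le> e"
        using uc[OF cont(2) e] by blast
      have "0 < min d1 d2" using d1(1) d2(1) by simp
      then obtain r where r: "0 < r" "\<And>h S x y. lat h S \<Longrightarrow> h < r \<Longrightarrow> x \<in> S \<Longrightarrow> \<bar>pos x - y\<bar> < r \<Longrightarrow> dist x (x0 + y *\<^sub>R u) < min d1 d2"
        using lat_close by metis
      have "\<bar>\<Phi>p x - \<Phi>p (x0 + y *\<^sub>R u)\<bar> \<le> e \<and> \<bar>\<Phi>m x - \<Phi>m (x0 + y *\<^sub>R u)\<bar> \<le> e"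
        if l: "lat h S" "x \<in> S" and hr: "h < r" and y: "y \<in> {a..b}" "\<bar>pos x - y\<bar> < r" for h S x y
      proof -
        have "dist x (x0 + y *\<^sub>R u) < d1" "dist x (x0 + y *\<^sub>R u) < d2" using r(2)[OF l(1) hr l(2) y(2)] by auto
        then show ?thesis using d1(2) d2(2) lat_coordinates(1)[OF l] S0_mem[OF y(1)] by blast
      qed
      then show ?thesis using r(1) by blast
    qed
    show "eventually (\<lambda>h. lat h (Sh h) \<and> xh h \<in> Sh h) (at_right 0)"
      using lat_eventually by eventually_elim simp
    show "((\<lambda>h. pos (xh h)) \<longlongrightarrow> 0) (at_right 0)" by (rule pos_xh)
    show "0 \<in> {a..b}" using zero_mem by simp
    show "0 < t" by (rule t)
    show "0 \<le> law t h x" for h x by (simp add: law_def)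
    show "eventually (\<lambda>h. \<forall>F. semigroup_of (reaction_generator (Sh h) u \<Phi>p \<Phi>m h) t F (xh h) = (\<Sum>x\<in>Sh h. F x * law t h x)) (at_right 0)"
      using lat_eventually by eventually_elim (simp add: law_semigroup[OF t0])
    show "eventually (\<lambda>h. (\<Sum>x\<in>Sh h. law t h x) = 1) (at_right 0)"
      using lat_eventually by eventually_elim (simp add: law_sum[OF t0])
  qed
  have Jr: "J t y = (if y \<in> S0 then rate (pos y) else \<infinity>)" for y by (rule J_eq)
  have S0D: "S0 \<subseteq> D" by (auto simp: segment_def)
  have compact_level: "compact {y \<in> D. J t y \<le> ereal c}" for c
  proof -
    have "{y \<in> D. J t y \<le> ereal c} = (\<lambda>\<alpha>. x0 + \<alpha> *\<^sub>R u) ` {z \<in> {a..b}. rate z \<le> ereal c}"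
    proof (intro equalityI subsetI)
      fix y assume "y \<in> {y \<in> D. J t y \<le> ereal c}"
      then have "y \<in> S0" "rate (pos y) \<le> ereal c" by (auto simp: Jr split: if_splits)
      then show "y \<in> (\<lambda>\<alpha>. x0 + \<alpha> *\<^sub>R u) ` {z \<in> {a..b}. rate z \<le> ereal c}" using pos_S0[of y] by blast
    next
      fix y assume "y \<in> (\<lambda>\<alpha>. x0 + \<alpha> *\<^sub>R u) ` {z \<in> {a..b}. rate z \<le> ereal c}"
      then obtain z where z: "y = x0 + z *\<^sub>R u" "z \<in> {a..b}" "rate z \<le> ereal c" by blast
      then have "y \<in> S0" "pos y = z" using S0_eq pos_affine[of 0 z] by auto
      then show "y \<in> {y \<in> D. J t y \<le> ereal c}" using z(3) S0D by (auto simp: Jr)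
    qed
    moreover have "compact {z \<in> {a..b}. rate z \<le> ereal c}"
    proof -
      have "bounded {z \<in> {a..b}. rate z \<le> ereal c}" by (rule bounded_subset[of "{a..b}"]) auto
      then show ?thesis using rate_sublevel_closed compact_eq_bounded_closed by blast
    qed
    ultimately show ?thesis by (simp only:) (intro compact_continuous_image continuous_intros)
  qed
  have good: "good_rate_function D (J t)"
    unfolding good_rate_function_def
    using J_nonneg compact_level by (auto intro!: closed_subset compact_imp_closed)
  have upper: "Limsup (at_right 0) (\<lambda>h. ereal h * ln_ext (measure (\<mu> t h) F)) \<le> - (INF y\<in>F. J t y)"
    if F: "closedin (top_of_set D) F" for F
  proof (rule ereal_le_uminusI)
    fix \<alpha> :: real assume \<alpha>: "ereal \<alpha> < (INF y\<in>F. J t y)"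
    have cF: "compact F" by (rule closedin_compact[OF D(1) F])
    have Fb: "F \<in> sets borel" using cF by (simp add: borel_compact)
    have J\<alpha>: "ereal \<alpha> < J t y" if "y \<in> F" for y using \<alpha> INF_lower[OF that, of "J t"] by (rule less_le_trans)
    have bound: "Limsup (at_right 0) (\<lambda>h. ereal h * ln_ext (measure (\<mu> t h) F)) \<le> ereal c"
      if "eventually (\<lambda>h. (\<Sum>x\<in>Sh h \<inter> F. law t h x) \<le> exp (c / h)) (at_right 0)" for c
    proof (rule Limsup_bounded)
      show "eventually (\<lambda>h. ereal h * ln_ext (measure (\<mu> t h) F) \<le> ereal c) (at_right 0)"
        using that lat_ev
      proof eventually_elim
        case (elim h)
        then show ?case using measure_eq_law[OF t0 _ _ Fb, of h] by (intro ln_ext_le) (auto simp: law_def intro: sum_nonneg)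
      qed
    qed
    have "Limsup (at_right 0) (\<lambda>h. ereal h * ln_ext (measure (\<mu> t h) F)) \<le> ereal (- \<alpha>)"
    proof (cases "0 < \<alpha>")
      case False
      show ?thesis
      proof (rule bound)
        show "eventually (\<lambda>h. (\<Sum>x\<in>Sh h \<inter> F. law t h x) \<le> exp (- \<alpha> / h)) (at_right 0)"
          using lat_ev
        proof eventually_elim
          case (elim h)
          have "(\<Sum>x\<in>Sh h \<inter> F. law t h x) \<le> (\<Sum>x\<in>Sh h. law t h x)"
            using elim by (intro sum_mono2) (auto simp: lat_def law_def)
          also have "\<dots> = 1" using law_sum[OF t0] elim by simp
          also have "1 \<le> exp (- \<alpha> / h)" using False elim by (simp add: divide_nonpos_pos)
          finally show ?case .
        qed
      qed
    next
      case True
      show ?thesis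
      proof (cases "F \<inter> S0 = {}")
        case True
        then have "eventually (\<lambda>h. (\<Sum>x\<in>Sh h \<inter> F. law t h x) \<le> exp (- \<alpha> / h)) (at_right 0)"
          using avoid_compact[OF cF] by (auto elim: eventually_mono)
        then show ?thesis by (rule bound)
      next
        case False
        define Z where "Z = pos ` (F \<inter> S0)"
        have cpos: "continuous_on A pos" for A unfolding pos_def by (intro continuous_intros) (use u in auto)
        have cS0: "compact S0" unfolding S0_eq by (intro compact_continuous_image continuous_intros compact_Icc)
        have Z: "compact Z" "Z \<subseteq> {a..b}" "Z \<noteq> {}"
          using cF cS0 pos_S0 False by (auto simp: Z_def intro!: compact_continuous_image cpos compact_Int)
        have cZ: "continuous_on A (\<lambda>x. infdist (pos x) Z)" for A by (intro continuous_on_infdist cpos)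
        have near: "eventually (\<lambda>h. \<forall>x\<in>Sh h \<inter> F. infdist (pos x) Z \<le> r) (at_right 0)" if r: "0 < r" for r
        proof -
          have "closed {x. r \<le> infdist (pos x) Z}" by (intro closed_Collect_le continuous_intros cZ)
          then have "compact (F \<inter> {x. r \<le> infdist (pos x) Z})" by (intro compact_Int_closed cF)
          moreover have "F \<inter> {x. r \<le> infdist (pos x) Z} \<inter> S0 = {}"
            using r by (auto simp: Z_def)
          ultimately have "eventually (\<lambda>h. Sh h \<inter> (F \<inter> {x. r \<le> infdist (pos x) Z}) = {}) (at_right 0)"
            by (rule avoid_compact)
          then show ?thesis by eventually_elim fastforce
        qed
        have I: "ereal \<alpha> < rate z" if z: "z \<in> Z" for z
        proof -
          obtain y where "y \<in> F" "y \<in> S0" "z = pos y" using z by (auto simp: Z_def)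
          then show ?thesis using J\<alpha>[of y] by (simp add: Jr)
        qed
        show ?thesis
        proof (rule ereal_le_epsilon2)
          fix e :: real assume e: "0 < e"
          have "eventually (\<lambda>h. (\<Sum>x\<in>Sh h \<inter> F. law t h x) \<le> exp ((- \<alpha> + e) / h)) (at_right 0)"
            by (rule upper_bound_closed[OF compact_imp_closed[OF Z(1)] Z(2,3) \<open>0 < \<alpha>\<close> I _ near e]) auto
          from bound[OF this]
          show "Limsup (at_right 0) (\<lambda>h. ereal h * ln_ext (measure (\<mu> t h) F)) \<le> ereal (- \<alpha>) + ereal e"
            by simp
        qed
      qed
    qed
    then show "Limsup (at_right 0) (\<lambda>h. ereal h * ln_ext (measure (\<mu> t h) F)) \<le> - ereal \<alpha>" by simp
  qed
  have lower: "- (INF y\<in>G. J t y) \<le> Liminf (at_right 0) (\<lambda>h. ereal h * ln_ext (measure (\<mu> t h) G))"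
    (is "_ \<le> ?L") if G: "openin (top_of_set D) G" for G
  proof -
    obtain T where T: "open T" "G = D \<inter> T" using G by (auto simp: openin_open)
    have Gb: "G \<in> sets borel" unfolding T(2) using T(1) D(1) by (simp add: borel_compact sets.Int)
    have point: "- J t y \<le> ?L" if y: "y \<in> G" for y
    proof (cases "J t y")
      case (real c)
      then have yS: "y \<in> S0" "rate (pos y) = ereal c" by (auto simp: Jr split: if_splits)
      obtain \<rho> where \<rho>: "\<rho> > 0" "ball y \<rho> \<subseteq> T" using T y by (meson IntD2 openE)
      obtain d where d: "0 < d" "\<And>h S x y. lat h S \<Longrightarrow> h < d \<Longrightarrow> x \<in> S \<Longrightarrow> \<bar>pos x - y\<bar> < d \<Longrightarrow> dist x (x0 + y *\<^sub>R u) < \<rho>"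
        using lat_close[OF \<rho>(1)] by metis
      have "ereal (- c) \<le> ?L"
      proof (rule ereal_le_epsilon2)
        fix e :: real assume e: "0 < e"
        have "ereal (- (c + e)) \<le> ?L"
        proof (rule Liminf_bounded)
          have le: "rate (pos y) \<le> ereal c" using yS by simp
          show "eventually (\<lambda>h. ereal (- (c + e)) \<le> ereal h * ln_ext (measure (\<mu> t h) G)) (at_right 0)"
            using lower_bound_ball[OF le e d(1)] lat_ev eventually_small[OF d(1)]
          proof eventually_elim
            case (elim h)
            have h: "0 < h" "h < h0" using elim by auto
            have "x \<in> G" if x: "x \<in> Sh h" "\<bar>pos x - pos y\<bar> < d" for x
            proof -
              have "dist x (x0 + pos y *\<^sub>R u) < \<rho>" by (rule d(2)[of h "Sh h"]) (use elim x in auto)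
              then have "dist x y < \<rho>" using pos_S0[OF yS(1)] by simp
              then have "x \<in> T" using \<rho>(2) by (auto simp: dist_commute)
              then show ?thesis using T(2) lat_coordinates(1)[of h "Sh h"] elim x by auto
            qed
            then have "(\<Sum>x\<in>{x \<in> Sh h. \<bar>pos x - pos y\<bar> < d}. law t h x) \<le> (\<Sum>x\<in>Sh h \<inter> G. law t h x)"
              using elim by (intro sum_mono2) (auto simp: lat_def law_def)
            then have "exp (- (c + e) / h) \<le> measure (\<mu> t h) G"
              using elim(1) measure_eq_law[OF t0 h Gb] by simp
            then show ?case using h by (intro ln_ext_ge)
          qed
        qed
        then show "ereal (- c) \<le> ?L + ereal e"
          by (cases ?L) auto
      qed
      then show ?thesis using real by simp
    next
      case PInf
      then show ?thesis by simp
    next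
      case MInf
      then show ?thesis using J_nonneg[of y t] by simp
    qed
    then show ?thesis by (simp add: ereal_SUP_uminus_eq[symmetric] SUP_le_iff)
  qed
  show ?thesis using good upper lower unfolding satisfies_LDP_def by blast
qed

lemma large_deviation_principle:
  assumes "0 \<le> t"
  shows "good_rate_function D (J t) \<and> satisfies_LDP D (\<mu> t) (J t)"
  using principle_degenerate_segment principle_initial_time principle_positive_time assms
  by (cases "a < b"; cases "t = 0") auto

end

section \<open>The theorem\<close>

theorem theorem5p6:
  fixes \<Omega> :: "(real^2) set"
    and m n :: nat
    and \<nu> \<nu>perp x0 :: "real^2"
    and \<Phi>p \<Phi>m :: "real^2 \<Rightarrow> real"
    and c0 h0 :: real
    and \<omega>0 :: "real \<Rightarrow> real"
    and \<beta> r :: "real \<Rightarrow> real"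
    and k0 :: "real \<Rightarrow> int"
    and xh :: "real \<Rightarrow> real^2"
    and M :: "real \<Rightarrow> 'w measure"
    and X :: "real \<Rightarrow> real \<Rightarrow> 'w \<Rightarrow> real^2"
  assumes domain: "open \<Omega>" "connected \<Omega>" "bounded \<Omega>"
      "closure \<Omega> \<subseteq> {x. x $ 1 > 0 \<and> x $ 2 > 0}"
    and convex: "convex \<Omega>"
    and reaction: "\<not> (m = 0 \<and> n = 0)" "\<nu> = vector [- real m, real n]"
      "\<nu>perp = vector [real n, real m]"
    and intensities: "c0 > 0" "continuous_on (closure \<Omega>) \<Phi>p" "continuous_on (closure \<Omega>) \<Phi>m"
      "\<And>x. x \<in> closure \<Omega> \<Longrightarrow> \<Phi>p x \<ge> c0 \<and> \<Phi>m x \<ge> c0"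
    and x0: "x0 \<in> closure \<Omega>"
    and modulus: "segment_modulus (closure \<Omega>) x0 \<nu> \<nu>perp \<omega>0"
    and h0: "h0 > 0"
    and xh: "\<And>h. 0 < h \<Longrightarrow> h < h0 \<Longrightarrow>
        xh h = x0 + \<beta> h *\<^sub>R \<nu>perp + (r h + of_int (k0 h) * h) *\<^sub>R \<nu> \<and> xh h \<in> closure \<Omega>"
    and \<beta>: "\<And>h. 0 < h \<Longrightarrow> h < h0 \<Longrightarrow> max (\<omega>0 \<bar>\<beta> h\<bar>) \<bar>\<beta> h\<bar> \<le> h"
    and r: "\<And>h. 0 < h \<Longrightarrow> h < h0 \<Longrightarrow> \<bar>r h\<bar> < h"
    and r_lim: "(r \<longlongrightarrow> 0) (at_right 0)"
    and \<alpha>0_lim: "((\<lambda>h. of_int (k0 h) * h) \<longlongrightarrow> (0::real)) (at_right 0)"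
    and process: "\<And>h. 0 < h \<Longrightarrow> h < h0 \<Longrightarrow>
        markov_chain_on (M h) (X h)
          (lattice_states (closure \<Omega>) x0 \<nu> \<nu>perp (\<beta> h) (r h) h)
          (reaction_generator
             (lattice_states (closure \<Omega>) x0 \<nu> \<nu>perp (\<beta> h) (r h) h) \<nu> \<Phi>p \<Phi>m h)
          (xh h)"
  shows "\<forall>t\<ge>0.
     good_rate_function (closure \<Omega>)
       (\<lambda>y. rate_function (closure \<Omega>) \<nu> \<nu>perp \<Phi>p \<Phi>m y x0 t) \<and>
     satisfies_LDP (closure \<Omega>) (\<lambda>h. distr (M h) borel (X h t))
       (\<lambda>y. rate_function (closure \<Omega>) \<nu> \<nu>perp \<Phi>p \<Phi>m y x0 t)"
proof (intro allI impI)
  have orth: "\<nu>perp \<bullet> \<nu> = 0"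
    unfolding reaction(2,3) by (simp add: inner_vec_def sum_2)
  have nz: "\<nu> \<noteq> 0"
  proof
    assume "\<nu> = 0"
    then have "\<nu> $ 1 = 0" "\<nu> $ 2 = 0" by simp_all
    then show False using reaction(1) by (simp add: reaction(2))
  qed
  interpret reaction_family "closure \<Omega>" \<nu> \<nu>perp x0 \<Phi>p \<Phi>m c0 h0 \<omega>0 \<beta> r k0 xh M X
  proof
    show "compact (closure \<Omega>)" using domain(3) by (simp add: compact_closure)
    show "convex (closure \<Omega>)" by (rule convex_closure[OF convex])
  qed (fact nz orth intensities x0 modulus h0 xh \<beta> r_lim \<alpha>0_lim process)+
  fix t :: real
  assume "0 \<le> t"
  then show "good_rate_function (closure \<Omega>)
       (\<lambda>y. rate_function (closure \<Omega>) \<nu> \<nu>perp \<Phi>p \<Phi>m y x0 t) \<and>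
     satisfies_LDP (closure \<Omega>) (\<lambda>h. distr (M h) borel (X h t))
       (\<lambda>y. rate_function (closure \<Omega>) \<nu> \<nu>perp \<Phi>p \<Phi>m y x0 t)"
    by (rule large_deviation_principle)
qed

end
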